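(* Let $\Omega$ be a bounded $H^1$-extension domain of $\mathbb R^3$. 1. The bilinear form $$a(\boldsymbol u,\boldsymbol v):=(\mathbf{curl}\,\boldsymbol u,\mathbf{curl}\,\boldsymbol v)_{\boldsymbol L^2(\Omega)}+(\mathrm{div}\,\boldsymbol u,\mathrm{div}\,\boldsymbol v)_{L^2(\Omega)}$$ satisfies, for all $\boldsymbol u\in\boldsymbol H^1_0(\Omega)$, $$a(\boldsymbol u,\boldsymbol u)+\|\boldsymbol u\|^2_{\boldsymbol L^2(\Omega)}=\|\boldsymbol u\|^2_{\boldsymbol H^1(\Omega)} .$$ Consequently, the form $a+(\cdot,\cdot)_{\boldsymbol L^2(\Omega)}$ is coercive on $\boldsymbol H^1_0(\Omega)$ with respect to the $\boldsymbol H^1(\Omega)$-norm. 2. If $\boldsymbol u\in\boldsymbol H^1_0(\Omega)$ satisfies $\mathrm{div}\,\boldsymbol u=0$, then for all $\boldsymbol v\in\boldsymbol H^1_0(\Omega)$ $$(\mathbf{curl}\,\boldsymbol u,\mathbf{curl}\,\boldsymbol v)_{\boldsymbol L^2(\Omega)}+(\boldsymbol u,\boldsymbol v)_{\boldsymbol L^2(\Omega)}=(\nabla\boldsymbol u,\nabla\boldsymbol v)_{\boldsymbol L^2(\Omega)}+(\boldsymbol u,\boldsymbol v)_{\boldsymbol L^2(\Omega)} .$$ Hence the weak formulations of $\mathbf{curl}(\mathbf{curl}\,\boldsymbol u)+\boldsymbol u=\boldsymbol f$ and $-\Delta\boldsymbol u+\boldsymbol u=\boldsymbol f$, tested against $\boldsymbol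 H^1_0(\Omega)$, are identical on the divergence-free subspace. Both are well-posed by the Lax–Milgram theorem.
   Context: A bounded domain (bounded open connected set) $\Omega\subset\mathbb R^3$ is an $H^1$-extension domain if there is a bounded linear operator $E:H^1(\Omega)\to H^1(\mathbb R^3)$ with $(Eu)|_\Omega=u$ for all $u\in H^1(\Omega)$. $\boldsymbol L^2(\Omega)=(L^2(\Omega))^3$, and $\boldsymbol H^1(\Omega)=(H^1(\Omega))^3$ is endowed with the inner product $(\boldsymbol u,\boldsymbol v)_{\boldsymbol H^1(\Omega)}=(\nabla\boldsymbol u,\nabla\boldsymbol v)_{\boldsymbol L^2(\Omega)}+(\boldsymbol u,\boldsymbol v)_{\boldsymbol L^2(\Omega)}$, where $\nabla\boldsymbol u=(\partial_ju_i)_{1\le i,j\le3}$ and $(\nabla\boldsymbol u,\nabla\boldsymbol v)_{\boldsymbol L^2(\Omega)}=\int_\Omega\sum_{1\le i,j\le3}\partial_ju_i\,\partial_jv_i\,dx$. $\boldsymbol H^1_0(\Omega)=(H^1_0(\Omega))^3$, where $H^1_0(\Omega)$ is the closure in $H^1(\Omega)$ of the set of infinitely differentiable functions with compact support in $\Omega$. The operators $\mathbf{curl}$, $\mathrm{div}$ and $\Delta$ are understood in the sense of distributions. $\boldsymbol f$ denotes the given right-hand side of the two equations, and the divergence-free subspace is the set of $\boldsymbol u\in\boldsymbol H^1_0(\Omega)$ with $\mathrm{div}\,\boldsymbol u=0$.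
   Formalization: Well-posedness of the curl-curl problem is stated with trial and test functions both in the divergence-free subspace of H^1_0, since existence fails when tested against all of H^1_0; the Laplace problem is well-posed both there and on all of H^1_0. *)

theory Defs
  imports "HOL-Analysis.Analysis"
begin

type_synonym R3 = "real^3"
type_synonym scalar_field = "R3 \<Rightarrow> real"
type_synonym vector_field = "R3 \<Rightarrow> R3"

text \<open>
  Elements of Lebesgue and Sobolev spaces over \<open>\<Omega>\<close> are represented by functions on the whole of
  \<open>R3\<close>, of which only the values on \<open>\<Omega>\<close> matter, and equality in these spaces is equality almost
  everywhere on \<open>\<Omega>\<close>. All functions are real-valued.
\<close>


section \<open>Test functions and distributions\<close>

definition partial :: "3 \<Rightarrow> scalar_field \<Rightarrow> scalar_field" where
  "partial j f = (\<lambda>x. frechet_derivative f (at x) (axis j 1))"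

text \<open>
  All iterated partial derivatives are (totally) differentiable at every point; in particular they
  are all continuous, so this is the usual notion of an infinitely differentiable function.
\<close>

definition smooth :: "scalar_field \<Rightarrow> bool" where
  "smooth f \<longleftrightarrow> (\<forall>js x. foldr partial js f differentiable (at x))"

definition test_functions :: "R3 set \<Rightarrow> scalar_field set" where
  "test_functions \<Omega> =
    {\<phi>. smooth \<phi> \<and> compact (closure {x. \<phi> x \<noteq> 0}) \<and> closure {x. \<phi> x \<noteq> 0} \<subseteq> \<Omega>}"

text \<open>
  A distribution on \<open>\<Omega>\<close> is represented by its action on \<open>test_functions \<Omega>\<close>. Only distributions
  derived from regular ones by differentiation occur below, so no continuity is imposed.
\<close>

type_synonym distribution = "scalar_field \<Rightarrow> real"

definition regular :: "R3 set \<Rightarrow> scalar_field \<Rightarrow> distribution" where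
  "regular \<Omega> u = (\<lambda>\<phi>. LINT x|lebesgue_on \<Omega>. u x * \<phi> x)"

definition regular_vec :: "R3 set \<Rightarrow> vector_field \<Rightarrow> distribution^3" where
  "regular_vec \<Omega> u = (\<chi> i. regular \<Omega> (\<lambda>x. u x $ i))"

definition dist_partial :: "3 \<Rightarrow> distribution \<Rightarrow> distribution" where
  "dist_partial j T = (\<lambda>\<phi>. - T (partial j \<phi>))"

definition dist_div :: "distribution^3 \<Rightarrow> distribution" where
  "dist_div T = (\<lambda>\<phi>. \<Sum>i\<in>UNIV. dist_partial i (T $ i) \<phi>)"

definition dist_curl :: "distribution^3 \<Rightarrow> distribution^3" where
  "dist_curl T = (\<chi> i.
     if i = 1 then (\<lambda>\<phi>. dist_partial 2 (T $ 3) \<phi> - dist_partial 3 (T $ 2) \<phi>)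
     else if i = 2 then (\<lambda>\<phi>. dist_partial 3 (T $ 1) \<phi> - dist_partial 1 (T $ 3) \<phi>)
     else (\<lambda>\<phi>. dist_partial 1 (T $ 2) \<phi> - dist_partial 2 (T $ 1) \<phi>))"


section \<open>Square-integrable functions and weak derivatives\<close>

definition L2 :: "R3 set \<Rightarrow> scalar_field set" where
  "L2 \<Omega> = {u. u \<in> borel_measurable (lebesgue_on \<Omega>) \<and> integrable (lebesgue_on \<Omega>) (\<lambda>x. (u x)\<^sup>2)}"

definition L2_vec :: "R3 set \<Rightarrow> vector_field set" where
  "L2_vec \<Omega> = {u. \<forall>i. (\<lambda>x. u x $ i) \<in> L2 \<Omega>}"

text \<open>
  Used for scalar fields, vector fields and matrix fields; on matrices \<open>real^3^3\<close> the inner product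
  of the library is the sum of the products of all nine entries.
\<close>

definition L2_inner :: "R3 set \<Rightarrow> (R3 \<Rightarrow> 'b::euclidean_space) \<Rightarrow> (R3 \<Rightarrow> 'b) \<Rightarrow> real" where
  "L2_inner \<Omega> u v = (LINT x|lebesgue_on \<Omega>. u x \<bullet> v x)"

definition L2_norm :: "R3 set \<Rightarrow> (R3 \<Rightarrow> 'b::euclidean_space) \<Rightarrow> real" where
  "L2_norm \<Omega> u = sqrt (L2_inner \<Omega> u u)"

definition has_L2_density :: "R3 set \<Rightarrow> distribution \<Rightarrow> scalar_field \<Rightarrow> bool" where
  "has_L2_density \<Omega> T g \<longleftrightarrow> g \<in> L2 \<Omega> \<and> (\<forall>\<phi>\<in>test_functions \<Omega>. T \<phi> = regular \<Omega> g \<phi>)"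

text \<open>
  For open \<open>\<Omega>\<close> the density of a distribution is unique up to a null set, and a choice of
  representative does not affect any of the integrals below. The value is meaningful only if the
  distribution has a density.
\<close>

definition L2_density :: "R3 set \<Rightarrow> distribution \<Rightarrow> scalar_field" where
  "L2_density \<Omega> T = (SOME g. has_L2_density \<Omega> T g)"

definition weak_partial :: "R3 set \<Rightarrow> 3 \<Rightarrow> scalar_field \<Rightarrow> scalar_field" where
  "weak_partial \<Omega> j u = L2_density \<Omega> (dist_partial j (regular \<Omega> u))"

definition weak_gradient :: "R3 set \<Rightarrow> scalar_field \<Rightarrow> vector_field" where
  "weak_gradient \<Omega> u = (\<lambda>x. \<chi> j. weak_partial \<Omega> j u x)"

definition weak_jacobian :: "R3 set \<Rightarrow> vector_field \<Rightarrow> R3 \<Rightarrow> real^3^3" where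
  "weak_jacobian \<Omega> u = (\<lambda>x. \<chi> i j. weak_partial \<Omega> j (\<lambda>y. u y $ i) x)"

definition weak_div :: "R3 set \<Rightarrow> vector_field \<Rightarrow> scalar_field" where
  "weak_div \<Omega> u = L2_density \<Omega> (dist_div (regular_vec \<Omega> u))"

definition weak_curl :: "R3 set \<Rightarrow> vector_field \<Rightarrow> vector_field" where
  "weak_curl \<Omega> u = (\<lambda>x. \<chi> i. L2_density \<Omega> (dist_curl (regular_vec \<Omega> u) $ i) x)"


section \<open>Sobolev spaces\<close>

definition H1 :: "R3 set \<Rightarrow> scalar_field set" where
  "H1 \<Omega> = {u. u \<in> L2 \<Omega> \<and> (\<forall>j. \<exists>g. has_L2_density \<Omega> (dist_partial j (regular \<Omega> u)) g)}"

definition H1_inner :: "R3 set \<Rightarrow> scalar_field \<Rightarrow> scalar_field \<Rightarrow> real" where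
  "H1_inner \<Omega> u v = L2_inner \<Omega> (weak_gradient \<Omega> u) (weak_gradient \<Omega> v) + L2_inner \<Omega> u v"

definition H1_norm :: "R3 set \<Rightarrow> scalar_field \<Rightarrow> real" where
  "H1_norm \<Omega> u = sqrt (H1_inner \<Omega> u u)"

definition H10 :: "R3 set \<Rightarrow> scalar_field set" where
  "H10 \<Omega> = {u \<in> H1 \<Omega>. \<forall>\<epsilon>>0. \<exists>\<phi>\<in>test_functions \<Omega>. H1_norm \<Omega> (\<lambda>x. u x - \<phi> x) < \<epsilon>}"

definition H1_vec_inner :: "R3 set \<Rightarrow> vector_field \<Rightarrow> vector_field \<Rightarrow> real" where
  "H1_vec_inner \<Omega> u v = L2_inner \<Omega> (weak_jacobian \<Omega> u) (weak_jacobian \<Omega> v) + L2_inner \<Omega> u v"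

definition H1_vec_norm :: "R3 set \<Rightarrow> vector_field \<Rightarrow> real" where
  "H1_vec_norm \<Omega> u = sqrt (H1_vec_inner \<Omega> u u)"

definition H10_vec :: "R3 set \<Rightarrow> vector_field set" where
  "H10_vec \<Omega> = {u. \<forall>i. (\<lambda>x. u x $ i) \<in> H10 \<Omega>}"

definition div_free :: "R3 set \<Rightarrow> vector_field \<Rightarrow> bool" where
  "div_free \<Omega> u \<longleftrightarrow> (\<forall>\<phi>\<in>test_functions \<Omega>. dist_div (regular_vec \<Omega> u) \<phi> = 0)"

definition H10_div_free :: "R3 set \<Rightarrow> vector_field set" where
  "H10_div_free \<Omega> = {u \<in> H10_vec \<Omega>. div_free \<Omega> u}"


section \<open>Extension domains\<close>

definition bounded_domain :: "R3 set \<Rightarrow> bool" where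
  "bounded_domain \<Omega> \<longleftrightarrow> bounded \<Omega> \<and> open \<Omega> \<and> connected \<Omega>"

text \<open>
  Linearity of the extension operator is stated almost everywhere. Together with the norm bound
  this also makes it compatible with equality almost everywhere on \<open>\<Omega>\<close>.
\<close>

definition H1_extension_domain :: "R3 set \<Rightarrow> bool" where
  "H1_extension_domain \<Omega> \<longleftrightarrow> bounded_domain \<Omega> \<and>
    (\<exists>E. (\<forall>u\<in>H1 \<Omega>. E u \<in> H1 UNIV) \<and>
         (\<forall>u\<in>H1 \<Omega>. \<forall>v\<in>H1 \<Omega>. \<forall>a b. AE x in lebesgue.
            E (\<lambda>y. a * u y + b * v y) x = a * E u x + b * E v x) \<and>
         (\<exists>C. \<forall>u\<in>H1 \<Omega>. H1_norm UNIV (E u) \<le> C * H1_norm \<Omega> u) \<and>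
         (\<forall>u\<in>H1 \<Omega>. AE x in lebesgue_on \<Omega>. E u x = u x))"


section \<open>Forms and variational problems\<close>

definition linear_on_fields :: "vector_field set \<Rightarrow> (vector_field \<Rightarrow> real) \<Rightarrow> bool" where
  "linear_on_fields X l \<longleftrightarrow>
    (\<forall>u\<in>X. \<forall>v\<in>X. \<forall>a b. l (\<lambda>x. a *\<^sub>R u x + b *\<^sub>R v x) = a * l u + b * l v)"

definition bilinear_on_fields ::
    "vector_field set \<Rightarrow> (vector_field \<Rightarrow> vector_field \<Rightarrow> real) \<Rightarrow> bool" where
  "bilinear_on_fields X B \<longleftrightarrow>
    (\<forall>u\<in>X. linear_on_fields X (\<lambda>v. B u v)) \<and> (\<forall>v\<in>X. linear_on_fields X (\<lambda>u. B u v))"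

definition H1_coercive_on ::
    "R3 set \<Rightarrow> vector_field set \<Rightarrow> (vector_field \<Rightarrow> vector_field \<Rightarrow> real) \<Rightarrow> bool" where
  "H1_coercive_on \<Omega> X B \<longleftrightarrow> (\<exists>\<alpha>>0. \<forall>u\<in>X. \<alpha> * (H1_vec_norm \<Omega> u)\<^sup>2 \<le> B u u)"

definition curl_div_form :: "R3 set \<Rightarrow> vector_field \<Rightarrow> vector_field \<Rightarrow> real" where
  "curl_div_form \<Omega> u v =
    L2_inner \<Omega> (weak_curl \<Omega> u) (weak_curl \<Omega> v) + L2_inner \<Omega> (weak_div \<Omega> u) (weak_div \<Omega> v)"

text \<open>The left-hand sides of the weak forms of \<open>curl (curl u) + u = f\<close> and \<open>-\<Delta>u + u = f\<close>.\<close>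

definition curl_curl_form :: "R3 set \<Rightarrow> vector_field \<Rightarrow> vector_field \<Rightarrow> real" where
  "curl_curl_form \<Omega> u v = L2_inner \<Omega> (weak_curl \<Omega> u) (weak_curl \<Omega> v) + L2_inner \<Omega> u v"

definition laplace_form :: "R3 set \<Rightarrow> vector_field \<Rightarrow> vector_field \<Rightarrow> real" where
  "laplace_form \<Omega> u v = L2_inner \<Omega> (weak_jacobian \<Omega> u) (weak_jacobian \<Omega> v) + L2_inner \<Omega> u v"

text \<open>
  Right-hand sides are bounded linear functionals with respect to the \<open>H1\<close>-norm, \<open>M\<close> being a bound
  for the dual norm. A right-hand side \<open>f \<in> L2_vec \<Omega>\<close> is the functional \<open>v \<mapsto> L2_inner \<Omega> f v\<close>, see
  \<open>L2_bounded_functional\<close> below.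
\<close>

definition bounded_functional ::
    "R3 set \<Rightarrow> vector_field set \<Rightarrow> real \<Rightarrow> (vector_field \<Rightarrow> real) \<Rightarrow> bool" where
  "bounded_functional \<Omega> X M f \<longleftrightarrow>
    linear_on_fields X f \<and> 0 \<le> M \<and> (\<forall>v\<in>X. \<bar>f v\<bar> \<le> M * H1_vec_norm \<Omega> v)"

definition weak_solution ::
    "(vector_field \<Rightarrow> vector_field \<Rightarrow> real) \<Rightarrow> vector_field set \<Rightarrow> (vector_field \<Rightarrow> real)
      \<Rightarrow> vector_field \<Rightarrow> bool" where
  "weak_solution B X f u \<longleftrightarrow> (\<forall>v\<in>X. B u v = f v)"

text \<open>
  Existence, uniqueness and continuous dependence on the data for the problem with trial and test
  space \<open>X\<close>.
\<close>

definition well_posed ::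
    "R3 set \<Rightarrow> vector_field set \<Rightarrow> (vector_field \<Rightarrow> vector_field \<Rightarrow> real) \<Rightarrow> bool" where
  "well_posed \<Omega> X B \<longleftrightarrow>
    (\<exists>C. \<forall>M f. bounded_functional \<Omega> X M f \<longrightarrow>
      (\<exists>u\<in>X. weak_solution B X f u \<and> H1_vec_norm \<Omega> u \<le> C * M \<and>
        (\<forall>w\<in>X. weak_solution B X f w \<longrightarrow> (AE x in lebesgue_on \<Omega>. w x = u x))))"


lemma L2_bounded_functional:
  assumes f: "f \<in> L2_vec \<Omega>"
  shows "bounded_functional \<Omega> (H10_vec \<Omega>) (L2_norm \<Omega> f) (L2_inner \<Omega> f)"
proof -
  let ?M = "lebesgue_on \<Omega>"
  have H10_L2: "v \<in> L2_vec \<Omega>" if "v \<in> H10_vec \<Omega>" for v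
    using that by (auto simp: H10_vec_def H10_def H1_def L2_vec_def)
  have meas: "v \<in> borel_measurable ?M" if "v \<in> L2_vec \<Omega>" for v
    unfolding borel_measurable_euclidean_space[of v]
    using that by (auto simp: L2_vec_def L2_def Basis_vec_def inner_axis)
  have sq: "integrable ?M (\<lambda>x. v x \<bullet> v x)" if "v \<in> L2_vec \<Omega>" for v
    using that by (auto simp: L2_vec_def L2_def inner_vec_def power2_eq_square)
  have int: "integrable ?M (\<lambda>x. u x \<bullet> v x)" if u: "u \<in> L2_vec \<Omega>" and v: "v \<in> L2_vec \<Omega>" for u v
  proof (rule Bochner_Integration.integrable_bound)
    show "integrable ?M (\<lambda>x. u x \<bullet> u x + v x \<bullet> v x)"
      using sq[OF u] sq[OF v] by simp
    show "(\<lambda>x. u x \<bullet> v x) \<in> borel_measurable ?M"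
      using meas[OF u] meas[OF v] by (rule borel_measurable_inner)
    show "AE x in ?M. norm (u x \<bullet> v x) \<le> norm (u x \<bullet> u x + v x \<bullet> v x)"
    proof (rule AE_I2)
      fix x
      have "0 \<le> (norm (u x) - norm (v x))\<^sup>2" "0 \<le> norm (u x) * norm (v x)"
        by auto
      then have "norm (u x) * norm (v x) \<le> (norm (u x))\<^sup>2 + (norm (v x))\<^sup>2"
        unfolding power2_diff by linarith
      then show "norm (u x \<bullet> v x) \<le> norm (u x \<bullet> u x + v x \<bullet> v x)"
        using Cauchy_Schwarz_ineq2[of "u x" "v x"] by (simp add: dot_square_norm)
    qed
  qed
  have lin: "linear_on_fields (H10_vec \<Omega>) (L2_inner \<Omega> f)"
    unfolding linear_on_fields_def L2_inner_def
    using int[OF f] H10_L2 by (simp add: inner_add_right)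
  have CS: "\<bar>L2_inner \<Omega> f v\<bar> \<le> L2_norm \<Omega> f * L2_norm \<Omega> v" if v: "v \<in> L2_vec \<Omega>" for v
  proof -
    define A where "A = L2_inner \<Omega> f f"
    define B where "B = L2_inner \<Omega> v v"
    define I where "I = L2_inner \<Omega> f v"
    have nonneg: "0 \<le> A" "0 \<le> B"
      by (auto simp: A_def B_def L2_inner_def intro!: Bochner_Integration.integral_nonneg)
    have quad: "0 \<le> t\<^sup>2 * A - 2 * t * s * I + s\<^sup>2 * B" for t s
    proof -
      have "0 \<le> (LINT x|?M. (t *\<^sub>R f x - s *\<^sub>R v x) \<bullet> (t *\<^sub>R f x - s *\<^sub>R v x))"
        by (rule Bochner_Integration.integral_nonneg) auto
      also have "\<dots> = (LINT x|?M. t\<^sup>2 * (f x \<bullet> f x) - 2 * t * s * (f x \<bullet> v x) + s\<^sup>2 * (v x \<bullet> v x))"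
        by (simp add: inner_diff_left inner_diff_right inner_commute algebra_simps power2_eq_square)
      also have "\<dots> = t\<^sup>2 * A - 2 * t * s * I + s\<^sup>2 * B"
        using int[OF f v] sq[OF f] sq[OF v] by (simp add: A_def B_def I_def L2_inner_def)
      finally show ?thesis .
    qed
    have "I\<^sup>2 \<le> A * B"
    proof (cases "B = 0")
      case True
      have "0 \<le> - (I\<^sup>2 * (A + 2))"
        using quad[of I "A + 1"] True by (simp add: algebra_simps power2_eq_square)
      with nonneg have "I\<^sup>2 = 0"
        by (smt (verit) mult_pos_pos zero_le_power2)
      with True show ?thesis by simp
    next
      case False
      have "0 \<le> B * (A * B - I\<^sup>2)"
        using quad[of B I] by (simp add: algebra_simps power2_eq_square)
      with False nonneg show ?thesis by (simp add: zero_le_mult_iff)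
    qed
    then have "\<bar>I\<bar> \<le> sqrt (A * B)"
      by (metis real_sqrt_abs real_sqrt_le_mono)
    then show ?thesis
      by (simp add: A_def B_def I_def L2_norm_def real_sqrt_mult)
  qed
  have L2_H1: "L2_norm \<Omega> v \<le> H1_vec_norm \<Omega> v" for v
    by (auto simp: L2_norm_def H1_vec_norm_def H1_vec_inner_def L2_inner_def intro!: Bochner_Integration.integral_nonneg)
  have nn: "0 \<le> L2_norm \<Omega> f"
    by (auto simp: L2_norm_def L2_inner_def intro!: Bochner_Integration.integral_nonneg)
  have "\<bar>L2_inner \<Omega> f v\<bar> \<le> L2_norm \<Omega> f * H1_vec_norm \<Omega> v" if "v \<in> H10_vec \<Omega>" for v
    using CS[OF H10_L2[OF that]] mult_left_mono[OF L2_H1[of v] nn] by linarith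
  with lin nn show ?thesis
    by (simp add: bounded_functional_def)
qed

end

theory Submission
  imports Defs
begin

text \<open>
  If \<open>u \<in> H\<^sup>1\<close> and \<open>v\<close> is a test function, the definition of the weak derivatives of \<open>u\<close> and the
  symmetry of the second derivatives of \<open>v\<close> give \<open>(\<partial>\<^sub>j u, \<partial>\<^sub>i v) = (\<partial>\<^sub>i u, \<partial>\<^sub>j v)\<close>, and by density this
  holds for all \<open>v \<in> H\<^sup>1\<^sub>0\<close>. Hence the mixed products in \<open>(curl u, curl v) + (div u, div v)\<close> cancel
  and only \<open>(\<nabla>u, \<nabla>v)\<close> remains. On the spaces considered all three variational problems are
  therefore governed by the \<open>H\<^sup>1\<close> inner product itself, and their well-posedness is the Riesz
  representation theorem together with the completeness of \<open>H\<^sup>1\<^sub>0\<close> and of its divergence-free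
  subspace.
\<close>

section \<open>Semi-inner product spaces of functions\<close>

text \<open>Fields are functions on all of space compared almost everywhere, and each weak
  derivative is picked by a choice operator, separately for each function. Hence
  \<open>H1_inner\<close> is only positive semidefinite, and \<open>weak_partial\<close> is linear
  only almost everywhere. The Hilbert space argument is therefore run for semi-inner products,
  without passing to a quotient, and uniqueness is recovered almost everywhere at the end. Before
  products of weak derivatives can be computed, L2 densities have to be shown unique; the smooth
  cut-offs and the fundamental lemma serve this purpose.

  All forms involved are symmetric, so minimising a quadratic functional can take the place of
  Lax-Milgram, and both the coercivity constant and the stability constant come out as 1. The
  curl-curl form is identified with the H1 product only for divergence-free \<open>u\<close>: on
  gradients of test functions it reduces to the L2 product, which does not control the H1
  norm.\<close>

locale semi_inner_space =
  fixes X :: "('a \<Rightarrow> 'b::real_vector) set" and B :: "('a \<Rightarrow> 'b) \<Rightarrow> ('a \<Rightarrow> 'b) \<Rightarrow> real"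
  assumes nonempty: "X \<noteq> {}"
    and comb: "\<lbrakk>u \<in> X; v \<in> X\<rbrakk> \<Longrightarrow> (\<lambda>x. a *\<^sub>R u x + b *\<^sub>R v x) \<in> X"
    and B_comb: "\<lbrakk>u \<in> X; v \<in> X; w \<in> X\<rbrakk> \<Longrightarrow>
      B (\<lambda>x. a *\<^sub>R u x + b *\<^sub>R v x) w = a * B u w + b * B v w"
    and B_sym: "\<lbrakk>u \<in> X; v \<in> X\<rbrakk> \<Longrightarrow> B u v = B v u"
    and B_nonneg: "u \<in> X \<Longrightarrow> 0 \<le> B u u"
begin

lemma B_comb_right:
  "\<lbrakk>u \<in> X; v \<in> X; w \<in> X\<rbrakk> \<Longrightarrow> B w (\<lambda>x. a *\<^sub>R u x + b *\<^sub>R v x) = a * B w u + b * B w v"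
  using B_comb[of u v w a b] by (simp add: B_sym comb)

lemma B_comb_square:
  assumes "u \<in> X" "v \<in> X"
  shows "B (\<lambda>x. a *\<^sub>R u x + b *\<^sub>R v x) (\<lambda>x. a *\<^sub>R u x + b *\<^sub>R v x)
       = a\<^sup>2 * B u u + 2 * a * b * B u v + b\<^sup>2 * B v v"
  using assms by (simp add: B_comb B_comb_right comb B_sym[of v u] algebra_simps power2_eq_square)

lemma diff_closed: "\<lbrakk>u \<in> X; v \<in> X\<rbrakk> \<Longrightarrow> (\<lambda>x. u x - v x) \<in> X"
  using comb[of u v 1 "-1"] by simp

lemma B_diff: "\<lbrakk>u \<in> X; v \<in> X; w \<in> X\<rbrakk> \<Longrightarrow> B (\<lambda>x. u x - v x) w = B u w - B v w"
  using B_comb[of u v w 1 "-1"] by simp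

lemma B_diff_right: "\<lbrakk>u \<in> X; v \<in> X; w \<in> X\<rbrakk> \<Longrightarrow> B w (\<lambda>x. u x - v x) = B w u - B w v"
  using B_comb_right[of u v w 1 "-1"] by simp

lemma B_diff_square:
  "\<lbrakk>u \<in> X; v \<in> X\<rbrakk> \<Longrightarrow> B (\<lambda>x. u x - v x) (\<lambda>x. u x - v x) = B u u - 2 * B u v + B v v"
  using B_comb_square[of u v 1 "-1"] by simp

text \<open>Nonnegativity of \<open>B\<close> on all combinations of \<open>u\<close> and
  \<open>v\<close> gives a nonnegative quadratic form in \<open>a\<close> and \<open>b\<close>.
  Since \<open>B v v = 0\<close> does not force \<open>v\<close> to vanish, that case needs its own
  choice of coefficients.\<close>

lemma Cauchy_Schwarz_square:
  assumes u: "u \<in> X" and v: "v \<in> X"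
  shows "(B u v)\<^sup>2 \<le> B u u * B v v"
proof -
  have quad: "0 \<le> a\<^sup>2 * B u u + 2 * a * b * B u v + b\<^sup>2 * B v v" for a b
    using B_nonneg[OF comb[OF u v]] B_comb_square[OF u v] by metis
  show ?thesis
  proof (cases "B v v = 0")
    case True
    \<comment> \<open>With \<open>B v v = 0\<close> the form is linear in \<open>b\<close>; the
      choice \<open>b = B u u + 1\<close> makes the mixed term outweigh the square of
      \<open>a = - B u v\<close>.\<close>
    have "0 \<le> - ((B u v)\<^sup>2 * (B u u + 2))"
      using quad[of "- B u v" "B u u + 1"] True by (simp add: algebra_simps power2_eq_square)
    with B_nonneg[OF u] have "(B u v)\<^sup>2 = 0"
      by (smt (verit) mult_pos_pos zero_le_power2)
    with True show ?thesis by simp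
  next
    case False
    have "0 \<le> B v v * (B u u * B v v - (B u v)\<^sup>2)"
      using quad[of "B v v" "- B u v"] by (simp add: algebra_simps power2_eq_square)
    with False B_nonneg[OF v] show ?thesis by (simp add: zero_le_mult_iff)
  qed
qed

lemma Cauchy_Schwarz: "\<lbrakk>u \<in> X; v \<in> X\<rbrakk> \<Longrightarrow> \<bar>B u v\<bar> \<le> sqrt (B u u) * sqrt (B v v)"
  by (metis Cauchy_Schwarz_square real_sqrt_abs real_sqrt_le_mono real_sqrt_mult)

text \<open>A triangle inequality for squared distances, which avoids square roots at the price of a
  factor 2: the mixed term \<open>2 * B p q\<close> is at most \<open>B p p + B q q\<close>.\<close>

lemma B_diff_square_triangle:
  assumes "u \<in> X" "v \<in> X" "w \<in> X"
  shows "B (\<lambda>x. u x - w x) (\<lambda>x. u x - w x)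
    \<le> 2 * B (\<lambda>x. u x - v x) (\<lambda>x. u x - v x) + 2 * B (\<lambda>x. v x - w x) (\<lambda>x. v x - w x)"
proof -
  define p q where "p = (\<lambda>x. u x - v x)" and "q = (\<lambda>x. v x - w x)"
  have pq: "p \<in> X" "q \<in> X"
    using assms by (auto simp: p_def q_def diff_closed)
  have "(\<lambda>x. u x - w x) = (\<lambda>x. 1 *\<^sub>R p x + 1 *\<^sub>R q x)"
    by (auto simp: p_def q_def)
  then have "B (\<lambda>x. u x - w x) (\<lambda>x. u x - w x) = B p p + 2 * B p q + B q q"
    using B_comb_square[OF pq, of 1 1] by simp
  moreover have "0 \<le> B p p - 2 * B p q + B q q"
    using B_nonneg[OF diff_closed[OF pq]] B_diff_square[OF pq] by simp
  ultimately show ?thesis by (simp add: p_def q_def)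
qed

text \<open>Continuity in one argument with the other one fixed, by Cauchy-Schwarz. This is the tool
  for passing to the limit in identities tested against a fixed function.\<close>

lemma tendsto_B:
  assumes s: "\<And>n. s n \<in> X" and u: "u \<in> X" and v: "v \<in> X"
    and lim: "(\<lambda>n. B (\<lambda>x. s n x - u x) (\<lambda>x. s n x - u x)) \<longlonglongrightarrow> 0"
  shows "(\<lambda>n. B (s n) v) \<longlonglongrightarrow> B u v"
proof (rule LIM_zero_cancel, rule Lim_null_comparison)
  show "\<forall>\<^sub>F n in sequentially. norm (B (s n) v - B u v)
      \<le> sqrt (B (\<lambda>x. s n x - u x) (\<lambda>x. s n x - u x)) * sqrt (B v v)"
    using Cauchy_Schwarz[OF diff_closed[OF s u] v] s u v by (simp add: B_diff)
  show "(\<lambda>n. sqrt (B (\<lambda>x. s n x - u x) (\<lambda>x. s n x - u x)) * sqrt (B v v)) \<longlonglongrightarrow> 0"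
    using tendsto_mult[OF tendsto_real_sqrt[OF lim] tendsto_const] by simp
qed

definition B_Cauchy :: "(nat \<Rightarrow> 'a \<Rightarrow> 'b) \<Rightarrow> bool" where
  "B_Cauchy s \<longleftrightarrow>
    (\<forall>e>0. \<exists>N. \<forall>m\<ge>N. \<forall>n\<ge>N. B (\<lambda>x. s m x - s n x) (\<lambda>x. s m x - s n x) < e)"

definition B_complete :: bool where
  "B_complete \<longleftrightarrow> (\<forall>s. (\<forall>n. s n \<in> X) \<and> B_Cauchy s \<longrightarrow>
    (\<exists>u\<in>X. (\<lambda>n. B (\<lambda>x. s n x - u x) (\<lambda>x. s n x - u x)) \<longlonglongrightarrow> 0))"

text \<open>The functional is represented by the minimiser of \<open>B v v - 2 * l v\<close>; minimising sequences
  are Cauchy by the parallelogram identity.\<close>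

theorem Riesz_representation:
  assumes complete: "B_complete"
    and l_comb: "\<And>u v a b. \<lbrakk>u \<in> X; v \<in> X\<rbrakk> \<Longrightarrow> l (\<lambda>x. a *\<^sub>R u x + b *\<^sub>R v x) = a * l u + b * l v"
    and l_bound: "\<And>v. v \<in> X \<Longrightarrow> \<bar>l v\<bar> \<le> M * sqrt (B v v)"
  shows "\<exists>u\<in>X. \<forall>v\<in>X. B u v = l v"
proof -
  define J where "J v = B v v - 2 * l v" for v
  have J_comb: "J (\<lambda>x. a *\<^sub>R u x + b *\<^sub>R v x)
      = a\<^sup>2 * B u u + 2 * a * b * B u v + b\<^sup>2 * B v v - 2 * a * l u - 2 * b * l v"
    if "u \<in> X" "v \<in> X" for u v a b
    using that by (simp add: J_def B_comb_square l_comb)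
  have bdd: "bdd_below (J ` X)"
  proof (rule bdd_belowI2)
    fix v assume v: "v \<in> X"
    \<comment> \<open>Completing the square: \<open>J v\<close> is at least
      \<open>(sqrt (B v v) - M)^2 - M^2\<close>.\<close>
    have "0 \<le> (sqrt (B v v) - M)\<^sup>2" by simp
    then have "0 \<le> B v v - 2 * (M * sqrt (B v v)) + M\<^sup>2"
      using B_nonneg[OF v] by (simp add: power2_diff mult_ac)
    then show "- (M\<^sup>2) \<le> J v" using l_bound[OF v] unfolding J_def by linarith
  qed
  define d where "d = Inf (J ` X)"
  have d_le: "d \<le> J v" if "v \<in> X" for v
    unfolding d_def using bdd that by (simp add: cInf_lower)
  have "\<exists>v\<in>X. J v < d + 1 / real (Suc n)" for n
    using cInf_lessD[of "J ` X" "d + 1 / real (Suc n)"] nonempty by (auto simp: d_def)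
  then obtain s where s: "\<And>n. s n \<in> X" and J_s: "\<And>n. J (s n) < d + 1 / real (Suc n)"
    by metis
  have dist_s: "B (\<lambda>x. s m x - s n x) (\<lambda>x. s m x - s n x)
      < 2 * (1 / real (Suc m)) + 2 * (1 / real (Suc n))" for m n
  proof -
    have mid: "d \<le> J (\<lambda>x. (1/2) *\<^sub>R s m x + (1/2) *\<^sub>R s n x)"
      using s by (intro d_le comb)
    \<comment> \<open>On the right the values of \<open>l\<close> cancel. Since the midpoint value
      is at least \<open>d\<close> and the two end values barely exceed \<open>d\<close>, the terms
      in \<open>d\<close> cancel as well.\<close>
    have "B (\<lambda>x. s m x - s n x) (\<lambda>x. s m x - s n x)
        = 2 * J (s m) + 2 * J (s n) - 4 * J (\<lambda>x. (1/2) *\<^sub>R s m x + (1/2) *\<^sub>R s n x)"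
      using s by (simp add: B_diff_square J_comb J_def[of "s _"] power2_eq_square algebra_simps)
    with mid J_s[of m] J_s[of n] show ?thesis by linarith
  qed
  have "B_Cauchy s"
    unfolding B_Cauchy_def
  proof (intro allI impI)
    fix e :: real assume "0 < e"
    then obtain N where N: "1 / real (Suc N) < e / 4"
      using nat_approx_posE[of "e / 4"] by auto
    have le: "1 / real (Suc n) \<le> 1 / real (Suc N)" if "n \<ge> N" for n
      using that by (simp add: frac_le)
    have "B (\<lambda>x. s m x - s n x) (\<lambda>x. s m x - s n x) < e" if "m \<ge> N" "n \<ge> N" for m n
      using dist_s[of m n] le[OF that(1)] le[OF that(2)] N by linarith
    then show "\<exists>N. \<forall>m\<ge>N. \<forall>n\<ge>N. B (\<lambda>x. s m x - s n x) (\<lambda>x. s m x - s n x) < e"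
      by blast
  qed
  with complete s obtain u where u: "u \<in> X"
    and lim: "(\<lambda>n. B (\<lambda>x. s n x - u x) (\<lambda>x. s n x - u x)) \<longlonglongrightarrow> 0"
    unfolding B_complete_def by blast
  have l_diff: "l (\<lambda>x. s n x - u x) = l (s n) - l u" for n
    using l_comb[OF s[of n] u, of 1 "-1"] by simp
  have "(\<lambda>n. l (s n)) \<longlonglongrightarrow> l u"
  proof (rule LIM_zero_cancel, rule Lim_null_comparison)
    show "\<forall>\<^sub>F n in sequentially. norm (l (s n) - l u)
        \<le> M * sqrt (B (\<lambda>x. s n x - u x) (\<lambda>x. s n x - u x))"
      using l_bound[OF diff_closed[OF s u]] by (simp add: l_diff)
    show "(\<lambda>n. M * sqrt (B (\<lambda>x. s n x - u x) (\<lambda>x. s n x - u x))) \<longlonglongrightarrow> 0"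
      using tendsto_mult[OF tendsto_const tendsto_real_sqrt[OF lim]] by simp
  qed
  moreover have "(\<lambda>n. B (s n) u) \<longlonglongrightarrow> B u u"
    using tendsto_B[OF s u u lim] .
  \<comment> \<open>\<open>tendsto_B\<close> wants a fixed second argument, so
    \<open>B (s n) (s n)\<close> is expressed through the squared distance to \<open>u\<close> and
    \<open>B (s n) u\<close>.\<close>
  moreover have "J (s n) = B (\<lambda>x. s n x - u x) (\<lambda>x. s n x - u x) + 2 * B (s n) u - B u u - 2 * l (s n)"
    for n using s u by (simp add: J_def B_diff_square)
  ultimately have "(\<lambda>n. J (s n)) \<longlonglongrightarrow> 0 + 2 * B u u - B u u - 2 * l u"
    by (simp only:) (intro tendsto_intros lim)
  then have "(\<lambda>n. J (s n)) \<longlonglongrightarrow> J u" by (simp add: J_def)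
  moreover have "(\<lambda>n. d + 1 / real (Suc n)) \<longlonglongrightarrow> d + 0"
    by (intro tendsto_intros LIMSEQ_Suc[OF lim_1_over_n])
  ultimately have "J u \<le> d + 0"
    using J_s by (intro LIMSEQ_le[of "\<lambda>n. J (s n)"]) (auto intro: less_imp_le)
  then have J_u: "J u \<le> J v" if "v \<in> X" for v
    using d_le[OF that] by simp
  have "B u v = l v" if v: "v \<in> X" for v
  proof (rule ccontr)
    assume "B u v \<noteq> l v"
    define c where "c = B u v - l v"
    \<comment> \<open>The minimiser of \<open>2 * t * c + t^2 * (B v v + 1)\<close>. The added 1
      keeps the denominator positive even if \<open>B v v = 0\<close>.\<close>
    define t where "t = - c / (B v v + 1)"
    have pos: "B v v + 1 > 0" using B_nonneg[OF v] by simp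
    have "0 \<le> 2 * t * c + t\<^sup>2 * B v v"
      using J_u[OF comb[OF u v, of 1 t]] u v J_comb[OF u v, of 1 t]
      by (simp add: c_def J_def[of u] algebra_simps)
    also have "\<dots> \<le> 2 * t * c + t\<^sup>2 * (B v v + 1)" by (simp add: mult_left_mono)
    also have "\<dots> = 2 * t * c + t * (t * (B v v + 1))" by (simp add: power2_eq_square)
    also have "\<dots> = - (c\<^sup>2 / (B v v + 1))"
      using pos by (simp add: t_def power2_eq_square)
    finally have "c = 0" using pos by (simp add: divide_le_0_iff zero_le_divide_iff)
    with \<open>B u v \<noteq> l v\<close> show False by (simp add: c_def)
  qed
  with u show ?thesis by blast
qed

end

section \<open>Square-integrable functions\<close>

text \<open>Along a subsequence with \<open>\<integral>(s (r (Suc k)) - s (r k))\<^sup>2 < 8\<^sup>-\<^sup>k\<close>, the bound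
  \<open>\<bar>t\<bar> \<le> 2\<^sup>-\<^sup>k + 2\<^sup>k t\<^sup>2\<close> makes the increments summable almost everywhere, also when the
  measure is infinite.\<close>

lemma square_integrable_complete:
  fixes s :: "nat \<Rightarrow> 'a \<Rightarrow> real"
  assumes [measurable]: "\<And>n. s n \<in> borel_measurable M"
    and sq: "\<And>n. integrable M (\<lambda>x. (s n x)\<^sup>2)"
    and Cauchy: "\<And>e. 0 < e \<Longrightarrow> \<exists>N. \<forall>m\<ge>N. \<forall>n\<ge>N. (LINT x|M. (s m x - s n x)\<^sup>2) < e"
  obtains u where "u \<in> borel_measurable M" "integrable M (\<lambda>x. (u x)\<^sup>2)"
    "(\<lambda>n. LINT x|M. (s n x - u x)\<^sup>2) \<longlonglongrightarrow> 0"
proof -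
  have sq_diff: "integrable M (\<lambda>x. (f x - g x)\<^sup>2)"
    if f: "f \<in> borel_measurable M" "integrable M (\<lambda>x. (f x)\<^sup>2)"
      and g: "g \<in> borel_measurable M" "integrable M (\<lambda>x. (g x)\<^sup>2)" for f g :: "'a \<Rightarrow> real"
  proof (rule Bochner_Integration.integrable_bound)
    show "integrable M (\<lambda>x. 2 * (f x)\<^sup>2 + 2 * (g x)\<^sup>2)" using f g by simp
    show "(\<lambda>x. (f x - g x)\<^sup>2) \<in> borel_measurable M" using f g by simp
    have "norm ((f x - g x)\<^sup>2) \<le> norm (2 * (f x)\<^sup>2 + 2 * (g x)\<^sup>2)" for x
    proof -
      have "(f x - g x)\<^sup>2 \<le> 2 * (f x)\<^sup>2 + 2 * (g x)\<^sup>2"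
        using zero_le_power2[of "f x + g x"] unfolding power2_sum power2_diff by linarith
      then show ?thesis by simp
    qed
    then show "AE x in M. norm ((f x - g x)\<^sup>2) \<le> norm (2 * (f x)\<^sup>2 + 2 * (g x)\<^sup>2)" by simp
  qed
  have nn_eq: "(\<integral>\<^sup>+ x. ennreal ((s m x - s n x)\<^sup>2) \<partial>M) = ennreal (LINT x|M. (s m x - s n x)\<^sup>2)"
    for m n by (rule nn_integral_eq_integral) (auto intro!: sq_diff sq)
  have "\<exists>N. \<forall>m\<ge>N. \<forall>n\<ge>N. (LINT x|M. (s m x - s n x)\<^sup>2) < (1/8)^k" for k :: nat
    by (rule Cauchy) simp
  then obtain N where N: "\<And>k m n. \<lbrakk>m \<ge> N k; n \<ge> N k\<rbrakk> \<Longrightarrow> (LINT x|M. (s m x - s n x)\<^sup>2) < (1/8)^k"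
    by metis
  \<comment> \<open>Summing the thresholds makes \<open>r\<close> monotone and puts both
    \<open>r k\<close> and \<open>r (Suc k)\<close> beyond \<open>N k\<close>; the summand
    \<open>k\<close> makes \<open>r\<close> tend to infinity.\<close>
  define r where "r k = k + (\<Sum>i\<le>k. N i)" for k
  have r_ge: "N k \<le> r k" "N k \<le> r (Suc k)" "k \<le> r k" for k
    unfolding r_def using member_le_sum[of k "{..k}" N] by auto
  define d where "d k x = s (r (Suc k)) x - s (r k) x" for k x
  have [measurable]: "d k \<in> borel_measurable M" for k
    unfolding d_def by measurable
  \<comment> \<open>The rate \<open>(1/8)^k\<close> was chosen so that a summable bound remains
    after multiplication by the weight \<open>2^k\<close>.\<close>
  have d_int: "(\<integral>\<^sup>+ x. ennreal (2^k * (d k x)\<^sup>2) \<partial>M) \<le> ennreal ((1/4)^k)" for k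
  proof -
    have "(\<integral>\<^sup>+ x. ennreal (2^k * (d k x)\<^sup>2) \<partial>M) = ennreal (2^k) * (\<integral>\<^sup>+ x. ennreal ((d k x)\<^sup>2) \<partial>M)"
      by (simp add: ennreal_mult' nn_integral_cmult)
    also have "\<dots> = ennreal (2^k * (LINT x|M. (d k x)\<^sup>2))"
      unfolding d_def nn_eq by (simp add: ennreal_mult')
    also have "\<dots> \<le> ennreal (2^k * (1/8)^k)"
      unfolding d_def using N[of k "r (Suc k)" "r k"] r_ge
      by (intro ennreal_leI mult_left_mono) (auto intro: less_imp_le)
    finally show ?thesis by (simp flip: power_mult_distrib)
  qed
  have "(\<integral>\<^sup>+ x. (\<Sum>k. ennreal (2^k * (d k x)\<^sup>2)) \<partial>M) = (\<Sum>k. \<integral>\<^sup>+ x. ennreal (2^k * (d k x)\<^sup>2) \<partial>M)"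
    by (rule nn_integral_suminf) auto
  also have "\<dots> \<le> (\<Sum>k. ennreal ((1/4)^k))"
    by (intro suminf_le d_int) auto
  also have "\<dots> < \<infinity>"
    by (subst suminf_ennreal2) auto
  finally have "AE x in M. (\<Sum>k. ennreal (2^k * (d k x)\<^sup>2)) \<noteq> \<infinity>"
    by (intro nn_integral_noteq_infinite) auto
  then have conv: "AE x in M. convergent (\<lambda>k. s (r k) x)"
  proof eventually_elim
    fix x assume "(\<Sum>k. ennreal (2^k * (d k x)\<^sup>2)) \<noteq> \<infinity>"
    then have "summable (\<lambda>k. 2^k * (d k x)\<^sup>2)"
      by (intro summable_suminf_not_top) auto
    then have "summable (\<lambda>k. (1/2)^k + 2^k * (d k x)\<^sup>2)"
      by (intro summable_add) auto
    then have "summable (\<lambda>k. d k x)"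
    proof (rule summable_comparison_test')
      fix k :: nat
      show "norm (d k x) \<le> (1/2)^k + 2^k * (d k x)\<^sup>2"
      proof (cases "\<bar>d k x\<bar> \<le> (1/2)^k")
        case True
        then show ?thesis by (simp add: add_increasing2)
      next
        case False
        then have "(2^k * \<bar>d k x\<bar>) * \<bar>d k x\<bar> \<ge> 1 * \<bar>d k x\<bar>"
          by (intro mult_right_mono) (auto simp: field_simps power_divide)
        then show ?thesis by (simp add: power2_eq_square mult.assoc add_increasing)
      qed
    qed
    then have "convergent (\<lambda>n. s (r 0) x + (\<Sum>k<n. d k x))"
      by (intro convergent_add convergent_const) (simp add: summable_iff_convergent)
    moreover have "s (r 0) x + (\<Sum>k<n. d k x) = s (r n) x" for n
      unfolding d_def using sum_lessThan_telescope[of "\<lambda>k. s (r k) x" n] by simp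
    ultimately show "convergent (\<lambda>k. s (r k) x)" by simp
  qed
  define u where "u x = lim (\<lambda>k. s (r k) x)" for x
  have u_meas[measurable]: "u \<in> borel_measurable M"
    unfolding u_def[abs_def] by (rule borel_measurable_lim_metric) simp
  have lim: "AE x in M. (\<lambda>k. s (r k) x) \<longlonglongrightarrow> u x"
    using conv by eventually_elim (simp add: u_def convergent_LIMSEQ_iff)
  have small: "\<exists>N. \<forall>n\<ge>N. (\<integral>\<^sup>+ x. ennreal ((s n x - u x)\<^sup>2) \<partial>M) \<le> ennreal e" if e: "0 < e" for e
  proof -
    obtain N where N: "\<And>m n. \<lbrakk>m \<ge> N; n \<ge> N\<rbrakk> \<Longrightarrow> (LINT x|M. (s m x - s n x)\<^sup>2) < e"
      using Cauchy[OF e] by blast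
    have "(\<integral>\<^sup>+ x. ennreal ((s n x - u x)\<^sup>2) \<partial>M) \<le> ennreal e" if n: "n \<ge> N" for n
    proof -
      \<comment> \<open>Preparation for Fatou's lemma: the Cauchy bound on
        \<open>s n - s (r k)\<close>, available once \<open>k \<ge> N\<close>, passes to
        \<open>s n - u\<close>. Working with nonnegative integrals postpones the integrability of
        \<open>u\<close>.\<close>
      have "AE x in M. ennreal ((s n x - u x)\<^sup>2) = liminf (\<lambda>k. ennreal ((s n x - s (r k) x)\<^sup>2))"
        using lim
      proof eventually_elim
        fix x assume "(\<lambda>k. s (r k) x) \<longlonglongrightarrow> u x"
        then have "(\<lambda>k. ennreal ((s n x - s (r k) x)\<^sup>2)) \<longlonglongrightarrow> ennreal ((s n x - u x)\<^sup>2)"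
          by (intro tendsto_intros tendsto_ennrealI)
        then show "ennreal ((s n x - u x)\<^sup>2) = liminf (\<lambda>k. ennreal ((s n x - s (r k) x)\<^sup>2))"
          by (rule lim_imp_Liminf[OF trivial_limit_sequentially, symmetric])
      qed
      then have "(\<integral>\<^sup>+ x. ennreal ((s n x - u x)\<^sup>2) \<partial>M)
          = (\<integral>\<^sup>+ x. liminf (\<lambda>k. ennreal ((s n x - s (r k) x)\<^sup>2)) \<partial>M)"
        by (rule nn_integral_cong_AE)
      also have "\<dots> \<le> liminf (\<lambda>k. \<integral>\<^sup>+ x. ennreal ((s n x - s (r k) x)\<^sup>2) \<partial>M)"
        by (rule nn_integral_liminf) simp
      also have "\<dots> \<le> ennreal e"
      proof (rule Liminf_le)
        show "\<forall>\<^sub>F k in sequentially. (\<integral>\<^sup>+ x. ennreal ((s n x - s (r k) x)\<^sup>2) \<partial>M) \<le> ennreal e"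
          unfolding eventually_sequentially nn_eq
        proof (intro exI[of _ N] allI impI)
          fix k assume "N \<le> k"
          then have "N \<le> r k" using r_ge(3)[of k] by linarith
          then show "ennreal (LINT x|M. (s n x - s (r k) x)\<^sup>2) \<le> ennreal e"
            using N[OF n] by (intro ennreal_leI) (rule less_imp_le)
        qed
      qed simp
      finally show ?thesis .
    qed
    then show ?thesis by blast
  qed
  have diff_int: "integrable M (\<lambda>x. (s n x - u x)\<^sup>2)"
    if "(\<integral>\<^sup>+ x. ennreal ((s n x - u x)\<^sup>2) \<partial>M) \<le> ennreal e" for n e
    using that by (intro integrableI_nonneg) (auto simp: less_top[symmetric] top_unique)
  \<comment> \<open>One index at finite distance from \<open>u\<close> suffices: \<open>u\<close> is
    the difference of the square-integrable functions \<open>s n\<close> and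
    \<open>s n - u\<close>.\<close>
  obtain n where n: "(\<integral>\<^sup>+ x. ennreal ((s n x - u x)\<^sup>2) \<partial>M) \<le> ennreal 1"
    using small[of 1] by auto
  have u_int: "integrable M (\<lambda>x. (u x)\<^sup>2)"
    using sq_diff[of "s n" "\<lambda>x. s n x - u x"] sq[of n] diff_int[OF n] by simp
  have "(\<lambda>n. LINT x|M. (s n x - u x)\<^sup>2) \<longlonglongrightarrow> 0"
  proof (rule LIMSEQ_I)
    fix e :: real assume e: "0 < e"
    obtain N where N: "\<And>n. n \<ge> N \<Longrightarrow> (\<integral>\<^sup>+ x. ennreal ((s n x - u x)\<^sup>2) \<partial>M) \<le> ennreal (e / 2)"
      using small[of "e / 2"] e by auto
    have "(LINT x|M. (s n x - u x)\<^sup>2) \<le> e / 2" if "n \<ge> N" for n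
    proof -
      have "ennreal (LINT x|M. (s n x - u x)\<^sup>2) \<le> ennreal (e / 2)"
        using N[OF that] nn_integral_eq_integral[OF diff_int[OF N[OF that]]] by simp
      then show ?thesis using e by (simp add: ennreal_le_iff)
    qed
    moreover have "0 \<le> (LINT x|M. (s n x - u x)\<^sup>2)" for n by simp
    ultimately show "\<exists>N. \<forall>n\<ge>N. norm ((LINT x|M. (s n x - u x)\<^sup>2) - 0) < e"
      using e by (intro exI[of _ N]) fastforce
  qed
  with u_meas u_int show ?thesis by (rule that)
qed

section \<open>The space L2 as a complete semi-inner product space\<close>

lemma L2_integrable_mult:
  assumes "u \<in> L2 \<Omega>" "v \<in> L2 \<Omega>"
  shows "integrable (lebesgue_on \<Omega>) (\<lambda>x. u x * v x)"
proof (rule Bochner_Integration.integrable_bound)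
  show "integrable (lebesgue_on \<Omega>) (\<lambda>x. (u x)\<^sup>2 + (v x)\<^sup>2)"
    "(\<lambda>x. u x * v x) \<in> borel_measurable (lebesgue_on \<Omega>)"
    using assms by (auto simp: L2_def)
  have "norm (u x * v x) \<le> norm ((u x)\<^sup>2 + (v x)\<^sup>2)" for x
  proof -
    have "\<bar>u x\<bar> * \<bar>v x\<bar> \<le> (u x)\<^sup>2 + (v x)\<^sup>2"
      using zero_le_power2[of "\<bar>u x\<bar> - \<bar>v x\<bar>"] mult_nonneg_nonneg[of "\<bar>u x\<bar>" "\<bar>v x\<bar>"]
      unfolding power2_diff power2_abs by linarith
    then show ?thesis by (simp add: abs_mult)
  qed
  then show "AE x in lebesgue_on \<Omega>. norm (u x * v x) \<le> norm ((u x)\<^sup>2 + (v x)\<^sup>2)" by simp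
qed

lemma L2_inner_real: "L2_inner \<Omega> u v = (LINT x|lebesgue_on \<Omega>. u x * v x)"
  by (simp add: L2_inner_def)

lemma L2_comb:
  assumes "u \<in> L2 \<Omega>" "v \<in> L2 \<Omega>"
  shows "(\<lambda>x. a * u x + b * v x) \<in> L2 \<Omega>"
proof -
  have "(\<lambda>x. (a * u x + b * v x)\<^sup>2) = (\<lambda>x. a\<^sup>2 * (u x)\<^sup>2 + 2 * a * b * (u x * v x) + b\<^sup>2 * (v x)\<^sup>2)"
    by (auto simp: power2_sum power_mult_distrib)
  then show ?thesis
    using assms L2_integrable_mult[OF assms] by (auto simp: L2_def)
qed

interpretation L2: semi_inner_space "L2 \<Omega>" "L2_inner \<Omega>"
proof
  have "(\<lambda>x. 0) \<in> L2 \<Omega>" by (simp add: L2_def)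
  then show "L2 \<Omega> \<noteq> {}" by blast
qed (auto simp: L2_comb L2_inner_real L2_integrable_mult algebra_simps)

lemma L2_complete: "L2.B_complete \<Omega>"
  unfolding L2.B_complete_def
proof safe
  fix s assume s: "\<forall>n. s n \<in> L2 \<Omega>" and Cauchy: "L2.B_Cauchy \<Omega> s"
  have conv: "\<exists>N. \<forall>m\<ge>N. \<forall>n\<ge>N. (LINT x|lebesgue_on \<Omega>. (s m x - s n x)\<^sup>2) < e" if "0 < e" for e
    using Cauchy that unfolding L2.B_Cauchy_def L2_inner_real by (simp add: power2_eq_square)
  have meas: "s n \<in> borel_measurable (lebesgue_on \<Omega>)" and sq: "integrable (lebesgue_on \<Omega>) (\<lambda>x. (s n x)\<^sup>2)" for n
    using s by (auto simp: L2_def)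
  obtain u where "u \<in> borel_measurable (lebesgue_on \<Omega>)"
    "integrable (lebesgue_on \<Omega>) (\<lambda>x. (u x)\<^sup>2)"
    "(\<lambda>n. LINT x|lebesgue_on \<Omega>. (s n x - u x)\<^sup>2) \<longlonglongrightarrow> 0"
    using square_integrable_complete[of s "lebesgue_on \<Omega>", OF meas sq conv] by blast
  then show "\<exists>u\<in>L2 \<Omega>. (\<lambda>n. L2_inner \<Omega> (\<lambda>x. s n x - u x) (\<lambda>x. s n x - u x)) \<longlonglongrightarrow> 0"
    by (intro bexI[of _ u]) (auto simp: L2_def L2_inner_real power2_eq_square)
qed

text \<open>Lets a weak derivative, known only through the choice operator, be replaced by an
  explicit representative inside a product.\<close>

lemma L2_inner_cong_AE:
  assumes "u \<in> L2 \<Omega>" "u' \<in> L2 \<Omega>" "v \<in> L2 \<Omega>" "v' \<in> L2 \<Omega>"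
    and "AE x in lebesgue_on \<Omega>. u x = u' x" "AE x in lebesgue_on \<Omega>. v x = v' x"
  shows "L2_inner \<Omega> u v = L2_inner \<Omega> u' v'"
  unfolding L2_inner_real
proof (rule Bochner_Integration.integral_cong_AE)
  show "AE x in lebesgue_on \<Omega>. u x * v x = u' x * v' x"
    using assms(5,6) by eventually_elim simp
qed (use assms in \<open>auto simp: L2_def\<close>)

section \<open>Smooth cut-off functions\<close>

text \<open>Grading by the order \<open>n\<close> makes closure under products and affine
  substitutions provable by induction; infinitely differentiable functions are those satisfying the
  predicate for every \<open>n\<close>.\<close>

primrec times_differentiable :: "nat \<Rightarrow> (real \<Rightarrow> real) \<Rightarrow> bool" where
  "times_differentiable 0 h \<longleftrightarrow> True"
| "times_differentiable (Suc n) h \<longleftrightarrow>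
    (\<exists>h'. (\<forall>t. (h has_real_derivative h' t) (at t)) \<and> times_differentiable n h')"

lemma times_differentiable_SucD: "times_differentiable (Suc n) h \<Longrightarrow> times_differentiable n h"
proof (induction n arbitrary: h)
  case (Suc n)
  then obtain h' where "\<forall>t. (h has_real_derivative h' t) (at t)" "times_differentiable (Suc n) h'"
    by auto
  with Suc.IH[of h'] show ?case by auto
qed simp

lemma times_differentiable_add:
  "\<lbrakk>times_differentiable n f; times_differentiable n g\<rbrakk> \<Longrightarrow> times_differentiable n (\<lambda>t. f t + g t)"
proof (induction n arbitrary: f g)
  case (Suc n)
  then obtain f' g' where "\<forall>t. (f has_real_derivative f' t) (at t)" "times_differentiable n f'"
    "\<forall>t. (g has_real_derivative g' t) (at t)" "times_differentiable n g'" by auto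
  with Suc.IH[of f' g'] show ?case
    by (auto intro!: exI[of _ "\<lambda>t. f' t + g' t"] DERIV_add)
qed simp

lemma times_differentiable_mult:
  "\<lbrakk>times_differentiable n f; times_differentiable n g\<rbrakk> \<Longrightarrow> times_differentiable n (\<lambda>t. f t * g t)"
proof (induction n arbitrary: f g)
  case (Suc n)
  then obtain f' g' where *: "\<forall>t. (f has_real_derivative f' t) (at t)" "times_differentiable n f'"
    "\<forall>t. (g has_real_derivative g' t) (at t)" "times_differentiable n g'" by auto
  have "times_differentiable n (\<lambda>t. f' t * g t + f t * g' t)"
    using * Suc.prems[THEN times_differentiable_SucD]
    by (intro times_differentiable_add Suc.IH)
  moreover have "((\<lambda>t. f t * g t) has_real_derivative f' t * g t + f t * g' t) (at t)" for t
    using * by (auto intro!: derivative_eq_intros)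
  ultimately show ?case by (auto intro!: exI[of _ "\<lambda>t. f' t * g t + f t * g' t"])
qed simp

lemma times_differentiable_const: "times_differentiable n (\<lambda>t. c)"
proof (induction n arbitrary: c)
  case (Suc n)
  then show ?case by (auto intro!: exI[of _ "\<lambda>t. 0"])
qed simp

lemma times_differentiable_affine:
  "times_differentiable n f \<Longrightarrow> times_differentiable n (\<lambda>t. f (c * t + d))"
proof (induction n arbitrary: f)
  case (Suc n)
  then obtain f' where *: "\<forall>t. (f has_real_derivative f' t) (at t)" "times_differentiable n f'"
    by auto
  have "((\<lambda>t. f (c * t + d)) has_real_derivative c * f' (c * t + d)) (at t)" for t
  proof -
    have "((\<lambda>t. f (c * t + d)) has_real_derivative f' (c * t + d) * c) (at t)"
      by (rule DERIV_chain2) (use * in \<open>auto intro!: derivative_eq_intros\<close>)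
    then show ?thesis by (simp add: mult.commute)
  qed
  moreover have "times_differentiable n (\<lambda>t. c * f' (c * t + d))"
    using * by (intro times_differentiable_mult times_differentiable_const Suc.IH)
  ultimately show ?case by (auto intro!: exI[of _ "\<lambda>t. c * f' (c * t + d)"])
qed simp

text \<open>The family is closed under differentiation: \<open>flat P\<close> has the derivative
  \<open>flat (X\<^sup>2 (P - P'))\<close>, also at \<open>0\<close>.\<close>

definition flat :: "real poly \<Rightarrow> real \<Rightarrow> real" where
  "flat P t = (if 0 < t then poly P (inverse t) * exp (- inverse t) else 0)"

lemma poly_mult_exp_minus_tendsto_0: "((\<lambda>s. poly P s * exp (- s)) \<longlongrightarrow> (0::real)) at_top"
proof -
  have "((\<lambda>s. \<Sum>i\<le>degree P. coeff P i * (s ^ i / exp s)) \<longlongrightarrow> (\<Sum>i\<le>degree P. coeff P i * 0)) at_top"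
    by (intro tendsto_intros tendsto_power_div_exp_0)
  then show ?thesis
    by (simp add: poly_altdef sum_distrib_right exp_minus divide_inverse mult.assoc)
qed

text \<open>With \<open>s = 1 / t\<close> the operator \<open>d/dt\<close> becomes
  \<open>- s^2 * d/ds\<close>, which maps \<open>P(s) * exp (- s)\<close> to
  \<open>s^2 * (P(s) - P'(s)) * exp (- s)\<close>. The point 0 is treated by one-sided difference
  quotients.\<close>

lemma flat_has_real_derivative:
  "(flat P has_real_derivative flat ([:0, 0, 1:] * (P - pderiv P)) t) (at t)"
proof -
  consider "t < 0" | "t = 0" | "0 < t" by linarith
  then show ?thesis
  proof cases
    case 1
    have "((\<lambda>t. 0) has_real_derivative 0) (at t)" by simp
    then have "(flat P has_real_derivative 0) (at t)"
      by (rule has_field_derivative_transform_within_open[of _ _ _ "{..<0}"])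
        (use 1 in \<open>auto simp: flat_def\<close>)
    with 1 show ?thesis by (simp add: flat_def)
  next
    case 2
    have "((\<lambda>h. flat P h / h) \<longlongrightarrow> 0) (at_left 0)"
      by (rule tendsto_eventually) (auto simp: eventually_at_filter flat_def)
    moreover have "((\<lambda>h. flat P h / h) \<longlongrightarrow> 0) (at_right 0)"
    proof (rule Lim_transform_eventually)
      \<comment> \<open>Dividing by \<open>h\<close> multiplies the polynomial in
        \<open>1 / h\<close> by its variable, and the exponential still wins at infinity.\<close>
      show "((\<lambda>h. poly ([:0, 1:] * P) (inverse h) * exp (- inverse h)) \<longlongrightarrow> 0) (at_right 0)"
        by (rule filterlim_compose[OF poly_mult_exp_minus_tendsto_0 filterlim_inverse_at_top_right])
      show "\<forall>\<^sub>F h in at_right 0. poly ([:0, 1:] * P) (inverse h) * exp (- inverse h) = flat P h / h"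
        by (auto simp: eventually_at_filter flat_def field_simps)
    qed
    ultimately have "((\<lambda>h. flat P h / h) \<longlongrightarrow> 0) (at 0)"
      by (simp add: filterlim_split_at)
    with 2 show ?thesis by (simp add: DERIV_def flat_def)
  next
    case 3
    have "((\<lambda>t. poly P (inverse t) * exp (- inverse t)) has_real_derivative
        poly ([:0, 0, 1:] * (P - pderiv P)) (inverse t) * exp (- inverse t)) (at t)"
      using 3 by (auto intro!: derivative_eq_intros DERIV_chain2[OF poly_DERIV]
          simp: power2_eq_square algebra_simps)
    then have "(flat P has_real_derivative
        poly ([:0, 0, 1:] * (P - pderiv P)) (inverse t) * exp (- inverse t)) (at t)"
      by (rule has_field_derivative_transform_within_open[of _ _ _ "{0<..}"])
        (use 3 in \<open>auto simp: flat_def\<close>)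
    with 3 show ?thesis by (simp add: flat_def)
  qed
qed

lemma times_differentiable_flat: "times_differentiable n (flat P)"
proof (induction n arbitrary: P)
  case (Suc n)
  then show ?case
    by (auto intro!: exI[of _ "flat ([:0, 0, 1:] * (P - pderiv P))"] flat_has_real_derivative
        simp del: mult_pCons_left)
qed simp

text \<open>This is \<open>exp (- 1 / t)\<close> for \<open>t > 0\<close> and 0 otherwise. As it
  increases to 1 at infinity, rescaling its argument approximates the indicator of the positive
  half-line.\<close>

definition cutoff :: "real \<Rightarrow> real" where "cutoff = flat 1"

lemma cutoff_nonneg: "0 \<le> cutoff t"
  and cutoff_le_1: "cutoff t \<le> 1"
  and cutoff_eq_0_iff: "cutoff t = 0 \<longleftrightarrow> t \<le> 0"
  by (auto simp: cutoff_def flat_def)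

lemma cutoff_tendsto:
  assumes "0 < t" shows "(\<lambda>n. cutoff (real (Suc n) * t)) \<longlonglongrightarrow> 1"
proof -
  have "(\<lambda>n. exp (- (inverse (real (Suc n)) * inverse t))) \<longlonglongrightarrow> exp (- (0 * inverse t))"
    by (intro tendsto_intros LIMSEQ_inverse_real_of_nat)
  with assms show ?thesis by (simp add: cutoff_def flat_def)
qed

text \<open>The witness in \<open>times_differentiable (Suc n) h\<close> might depend on
  \<open>n\<close>; uniqueness of derivatives identifies it with \<open>deriv h\<close> for every
  order.\<close>

lemma deriv_times_differentiable:
  assumes "\<And>n. times_differentiable n h"
  shows "(h has_real_derivative deriv h t) (at t)" "times_differentiable n (deriv h)"
proof -
  obtain h' where h': "\<And>t. (h has_real_derivative h' t) (at t)" "times_differentiable n h'"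
    using assms[of "Suc n"] by auto
  then have "h' = deriv h" by (intro ext) (rule DERIV_imp_deriv[symmetric])
  with h' show "(h has_real_derivative deriv h t) (at t)" "times_differentiable n (deriv h)"
    by auto
qed

text \<open>A partial derivative in direction \<open>j\<close> replaces the factor
  \<open>h j\<close> by its derivative, so products of one-variable functions are closed under
  \<open>partial\<close>, and each of them is totally differentiable.\<close>

lemma smooth_prod:
  fixes h :: "3 \<Rightarrow> real \<Rightarrow> real"
  assumes h: "\<And>i n. times_differentiable n (h i)"
  shows "smooth (\<lambda>x. \<Prod>i\<in>UNIV. h i (x $ i))"
proof -
  have der: "((\<lambda>x. \<Prod>i\<in>UNIV. h i (x $ i)) has_derivative
      (\<lambda>v. \<Sum>i\<in>UNIV. (deriv (h i) (x $ i) * v $ i) * (\<Prod>k\<in>UNIV - {i}. h k (x $ k)))) (at x)"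
    if h: "\<And>i n. times_differentiable n (h i)" for h :: "3 \<Rightarrow> real \<Rightarrow> real" and x
  proof (rule has_derivative_prod)
    fix i :: 3
    have "((h i \<circ> (\<lambda>x. x $ i)) has_derivative (\<lambda>d. deriv (h i) (x $ i) * d) \<circ> (\<lambda>v. v $ i)) (at x)"
      using deriv_times_differentiable(1)[OF h, of i "x $ i"]
      by (intro diff_chain_at bounded_linear_imp_has_derivative bounded_linear_vec_nth)
        (simp add: has_field_derivative_def)
    then show "((\<lambda>x. h i (x $ i)) has_derivative (\<lambda>v. deriv (h i) (x $ i) * v $ i)) (at x)"
      by (simp add: o_def)
  qed
  have "\<exists>h'. (\<forall>i n. times_differentiable n (h' i)) \<and>
      foldr partial js (\<lambda>x. \<Prod>i\<in>UNIV. h i (x $ i)) = (\<lambda>x. \<Prod>i\<in>UNIV. h' i (x $ i))" for js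
  proof (induction js)
    case Nil
    show ?case using h by (intro exI[of _ h]) simp
  next
    case (Cons j js)
    then obtain h' where h': "\<And>i n. times_differentiable n (h' i)"
      and eq: "foldr partial js (\<lambda>x. \<Prod>i\<in>UNIV. h i (x $ i)) = (\<lambda>x. \<Prod>i\<in>UNIV. h' i (x $ i))"
      by blast
    define h'' where "h'' = h'(j := deriv (h' j))"
    have "partial j (\<lambda>x. \<Prod>i\<in>UNIV. h' i (x $ i)) x = (\<Prod>i\<in>UNIV. h'' i (x $ i))" for x
    proof -
      have "partial j (\<lambda>x. \<Prod>i\<in>UNIV. h' i (x $ i)) x
          = (\<Sum>i\<in>UNIV. (deriv (h' i) (x $ i) * axis j 1 $ i) * (\<Prod>k\<in>UNIV - {i}. h' k (x $ k)))"
        unfolding partial_def by (simp flip: frechet_derivative_at[OF der[OF h']])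
      also have "\<dots> = (\<Sum>i\<in>UNIV. if i = j then deriv (h' j) (x $ j) * (\<Prod>k\<in>UNIV - {j}. h' k (x $ k)) else 0)"
        by (intro sum.cong) (auto simp: axis_def)
      also have "\<dots> = deriv (h' j) (x $ j) * (\<Prod>k\<in>UNIV - {j}. h' k (x $ k))" by simp
      also have "\<dots> = (\<Prod>i\<in>UNIV. h'' i (x $ i))"
        by (subst prod.remove[of UNIV j]) (auto simp: h''_def)
      finally show ?thesis .
    qed
    moreover have "times_differentiable n (h'' i)" for i n
      using h' deriv_times_differentiable(2)[OF h'] by (auto simp: h''_def)
    ultimately show ?case by (intro exI[of _ h'']) (simp add: eq)
  qed
  note iterated = this
  show ?thesis
    unfolding smooth_def
  proof (intro allI)
    fix js x
    obtain h' where h': "\<And>i n. times_differentiable n (h' i)"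
      and eq: "foldr partial js (\<lambda>x. \<Prod>i\<in>UNIV. h i (x $ i)) = (\<lambda>x. \<Prod>i\<in>UNIV. h' i (x $ i))"
      using iterated[of js] by blast
    show "foldr partial js (\<lambda>x. \<Prod>i\<in>UNIV. h i (x $ i)) differentiable at x"
      unfolding eq by (rule differentiableI[OF der[OF h']])
  qed
qed

text \<open>In each coordinate two opposing cut-offs are multiplied, so \<open>\<phi> n\<close> is
  nonzero exactly on the open box and its support lies in the closed one. The scale
  \<open>n + 1\<close> drives every factor to 1 inside the box.\<close>

lemma box_approximation:
  assumes "cbox a b \<subseteq> \<Omega>"
  obtains \<phi> where "\<And>n. \<phi> n \<in> test_functions \<Omega>" "\<And>n x. \<bar>\<phi> n x\<bar> \<le> indicator (box a b) x"
    "\<And>x. (\<lambda>n. \<phi> n x) \<longlonglongrightarrow> indicator (box a b) x"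
proof -
  define h where "h n i t = cutoff (real (Suc n) * (t - a $ i)) * cutoff (real (Suc n) * (b $ i - t))"
    for n i t
  define \<phi> where "\<phi> n x = (\<Prod>i\<in>UNIV. h n i (x $ i))" for n x
  have h_bounds: "0 \<le> h n i t" "h n i t \<le> 1" for n i t
    using cutoff_nonneg cutoff_le_1 by (auto simp: h_def intro: mult_le_one)
  have h_nonzero: "h n i t \<noteq> 0 \<longleftrightarrow> a $ i < t \<and> t < b $ i" for n i t
    by (auto simp: h_def cutoff_eq_0_iff not_le zero_less_mult_iff mult_le_0_iff)
  have \<phi>_nonzero: "\<phi> n x \<noteq> 0 \<longleftrightarrow> x \<in> box a b" for n x
    using h_nonzero by (auto simp: \<phi>_def mem_box_cart)
  \<comment> \<open>Both arguments are brought into the form \<open>c * t + d\<close> expected by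
    \<open>times_differentiable_affine\<close>.\<close>
  have "h n i = (\<lambda>t. cutoff (real (Suc n) * t + (- real (Suc n) * a $ i))
      * cutoff (- real (Suc n) * t + real (Suc n) * b $ i))" for n i
    by (auto simp: h_def algebra_simps)
  then have "times_differentiable k (h n i)" for k n i
    unfolding cutoff_def
    by (simp only:) (intro times_differentiable_mult times_differentiable_affine times_differentiable_flat)
  then have "smooth (\<phi> n)" for n
    unfolding \<phi>_def by (rule smooth_prod)
  moreover have "closure {x. \<phi> n x \<noteq> 0} \<subseteq> cbox a b" for n
    unfolding \<phi>_nonzero by (intro closure_minimal) (auto simp: box_subset_cbox)
  ultimately have "\<phi> n \<in> test_functions \<Omega>" for n
    using assms bounded_subset[OF bounded_cbox] unfolding test_functions_def compact_eq_bounded_closed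
    by blast
  moreover have "\<bar>\<phi> n x\<bar> \<le> indicator (box a b) x" for n x
  proof (cases "x \<in> box a b")
    case True
    have "0 \<le> \<phi> n x" "\<phi> n x \<le> 1"
      unfolding \<phi>_def using h_bounds by (auto intro!: prod_nonneg prod_le_1)
    with True show ?thesis by simp
  qed (use \<phi>_nonzero in auto)
  moreover have "(\<lambda>n. \<phi> n x) \<longlonglongrightarrow> indicator (box a b) x" for x
  proof (cases "x \<in> box a b")
    case True
    have "(\<lambda>n. h n i (x $ i)) \<longlonglongrightarrow> 1 * 1" for i
      unfolding h_def using True by (intro tendsto_mult cutoff_tendsto) (auto simp: mem_box_cart)
    then have "(\<lambda>n. \<phi> n x) \<longlonglongrightarrow> (\<Prod>i::3\<in>UNIV. 1)"
      unfolding \<phi>_def by (intro tendsto_prod) simp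
    with True show ?thesis by simp
  next
    case False
    then have "\<phi> n x = 0" for n using \<phi>_nonzero by blast
    with False show ?thesis by simp
  qed
  ultimately show ?thesis by (rule that)
qed

section \<open>The fundamental lemma of the calculus of variations\<close>

text \<open>The positive and the negative part of \<open>g\<close> are densities of two measures
  that agree on all open boxes. Boxes are stable under intersection, generate the Borel sets and
  exhaust the space with finite measure, so the measures agree, and hence so do the
  densities.\<close>

lemma AE_zero_of_integral_box_zero:
  fixes g :: "'a::euclidean_space \<Rightarrow> real"
  assumes g: "integrable lebesgue g"
    and zero: "\<And>c d. (LINT x|lebesgue. indicator (box c d) x * g x) = 0"
  shows "AE x in lebesgue. g x = 0"
proof -
  \<comment> \<open>Boxes generate only the Borel sets, hence the passage from the Lebesgue
    measurable \<open>g\<close> to a Borel representative \<open>g'\<close>.\<close>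
  have "g \<in> borel_measurable (completion lborel)" using g by auto
  then obtain g' where g'[measurable]: "g' \<in> borel_measurable lborel"
    and eq: "AE x in lborel. g x = g' x"
    using completion_ex_borel_measurable_real by blast
  then have eq': "AE x in lebesgue. g x = g' x" by (intro AE_completion)
  have [measurable]: "g \<in> borel_measurable lebesgue" "g' \<in> borel_measurable lebesgue"
    using g g' by (auto intro: measurable_completion)
  have g'_int: "integrable lborel g'"
    using Bochner_Integration.integrable_cong_AE[of g lebesgue g', OF _ _ eq'] g
    by (simp add: integrable_completion)
  have int: "integrable lborel (\<lambda>x. max 0 (g' x) * indicator (box c d) x)"
    "integrable lborel (\<lambda>x. max 0 (- g' x) * indicator (box c d) x)" for c d
    using integrable_real_mult_indicator[of "box c d" lborel "\<lambda>x. max 0 (g' x)"]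
      integrable_real_mult_indicator[of "box c d" lborel "\<lambda>x. max 0 (- g' x)"] g'_int by auto
  have box_eq: "(LINT x|lborel. max 0 (g' x) * indicator (box c d) x)
      = (LINT x|lborel. max 0 (- g' x) * indicator (box c d) x)" for c d
  proof -
    have "0 = (LINT x|lebesgue. indicator (box c d) x * g' x)"
      unfolding zero[of c d, symmetric] using eq'
      by (intro Bochner_Integration.integral_cong_AE borel_measurable_times borel_measurable_indicator)
        (auto elim: eventually_mono)
    also have "\<dots> = (LINT x|lborel. indicator (box c d) x * g' x)"
      by (rule integral_completion) simp
    also have "\<dots> = (LINT x|lborel. max 0 (g' x) * indicator (box c d) x
        - max 0 (- g' x) * indicator (box c d) x)"
      by (intro Bochner_Integration.integral_cong) (auto simp: max_def)
    also have "\<dots> = (LINT x|lborel. max 0 (g' x) * indicator (box c d) x)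
        - (LINT x|lborel. max 0 (- g' x) * indicator (box c d) x)"
      by (intro Bochner_Integration.integral_diff int)
    finally show ?thesis by simp
  qed
  have em: "emeasure (density lborel (\<lambda>x. ennreal (f x))) (box c d)
      = ennreal (LINT x|lborel. max 0 (f x) * indicator (box c d) x)"
    if [measurable]: "f \<in> borel_measurable lborel"
      and "integrable lborel (\<lambda>x. max 0 (f x) * indicator (box c d) x)" for f :: "'a \<Rightarrow> real" and c d
  proof -
    have "emeasure (density lborel (\<lambda>x. ennreal (f x))) (box c d)
        = (\<integral>\<^sup>+ x. ennreal (f x) * indicator (box c d) x \<partial>lborel)"
      by (rule emeasure_density) auto
    also have "\<dots> = (\<integral>\<^sup>+ x. ennreal (max 0 (f x) * indicator (box c d) x) \<partial>lborel)"
      by (intro nn_integral_cong) (auto simp: max_def ennreal_neg split: split_indicator)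
    also have "\<dots> = ennreal (LINT x|lborel. max 0 (f x) * indicator (box c d) x)"
      by (rule nn_integral_eq_integral) (use that in auto)
    finally show ?thesis .
  qed
  \<comment> \<open>\<open>ennreal\<close> sends negative numbers to 0, so these densities are the
    positive and the negative part of \<open>g'\<close>.\<close>
  have "density lborel (\<lambda>x. ennreal (g' x)) = density lborel (\<lambda>x. ennreal (- g' x))" (is "?P = ?N")
  proof (rule measure_eqI_generator_eq)
    let ?E = "range (\<lambda>(a, b). box a b::'a set)"
    show "Int_stable ?E"
      by (auto simp: Int_stable_def box_Int_box)
    show "?E \<subseteq> Pow UNIV" "sets ?P = sigma_sets UNIV ?E" "sets ?N = sigma_sets UNIV ?E"
      by (simp_all add: borel_eq_box)
    let ?A = "\<lambda>n::nat. box (- (real n *\<^sub>R One)) (real n *\<^sub>R One) :: 'a set"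
    show "range ?A \<subseteq> ?E" "(\<Union>i. ?A i) = UNIV"
      unfolding UN_box_eq_UNIV by auto
    show "emeasure ?P (?A i) \<noteq> \<infinity>" for i
      by (subst em) (auto intro: int)
    show "emeasure ?P X = emeasure ?N X" if "X \<in> ?E" for X
      using that by (auto simp: em int box_eq)
  qed
  then have "AE x in lborel. ennreal (g' x) = ennreal (- g' x)"
    by (intro sigma_finite_measure.density_unique[OF sigma_finite_lborel]) auto
  with eq have "AE x in lborel. g x = 0"
  proof eventually_elim
    fix x assume "g x = g' x" "ennreal (g' x) = ennreal (- g' x)"
    moreover from this have "g' x \<le> 0 \<longleftrightarrow> - g' x \<le> 0"
      by (metis ennreal_eq_0_iff)
    ultimately show "g x = 0" by linarith
  qed
  then show ?thesis by (rule AE_completion)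
qed

lemma indicator_cbox_L2: "indicator (cbox a b) \<in> L2 \<Omega>" if "\<Omega> \<in> sets lebesgue"
proof -
  have "integrable lebesgue (\<lambda>x. indicator \<Omega> x *\<^sub>R (indicator (cbox a b) x :: real))"
  proof (rule Bochner_Integration.integrable_bound)
    show "integrable lebesgue (indicator (cbox a b) :: R3 \<Rightarrow> real)"
      by (rule integrable_real_indicator) (auto simp: emeasure_lborel_cbox_eq)
    show "(\<lambda>x. indicator \<Omega> x *\<^sub>R (indicator (cbox a b) x :: real)) \<in> borel_measurable lebesgue"
      using that by (intro borel_measurable_scaleR borel_measurable_indicator) auto
  qed (auto simp: indicator_def)
  then have "integrable (lebesgue_on \<Omega>) (indicator (cbox a b) :: R3 \<Rightarrow> real)"
    using that by (subst integrable_restrict_space) auto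
  moreover have "(\<lambda>x. (indicator (cbox a b) x :: real)\<^sup>2) = indicator (cbox a b)"
    by (auto simp: indicator_def)
  ultimately show ?thesis
    unfolding L2_def by (auto dest: borel_measurable_integrable)
qed

lemma open_lebesgue [simp]: "open \<Omega> \<Longrightarrow> \<Omega> \<in> sets lebesgue"
  by (simp add: borel_open)

lemma test_function_differentiable:
  assumes "\<phi> \<in> test_functions \<Omega>"
  shows "\<phi> differentiable at x" "continuous_on S \<phi>"
proof -
  have "foldr partial [] \<phi> differentiable at x" for x
    using assms unfolding test_functions_def smooth_def by blast
  then show "\<phi> differentiable at x" for x by simp
  then show "continuous_on S \<phi>"
    by (simp add: continuous_at_imp_continuous_on differentiable_imp_continuous_within)
qed

lemma test_function_support:
  assumes "\<phi> \<in> test_functions \<Omega>"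
  obtains a b where "\<And>x. \<phi> x \<noteq> 0 \<Longrightarrow> x \<in> cbox a b"
proof -
  have "bounded {x. \<phi> x \<noteq> 0}"
    using assms bounded_subset[OF compact_imp_bounded closure_subset] by (auto simp: test_functions_def)
  then obtain a where "{x. \<phi> x \<noteq> 0} \<subseteq> cbox (- a) a"
    using bounded_subset_cbox_symmetric by blast
  then show ?thesis by (intro that[of "- a" a]) auto
qed

lemma test_functions_L2:
  assumes "open \<Omega>" and \<phi>: "\<phi> \<in> test_functions \<Omega>'"
  shows "\<phi> \<in> L2 \<Omega>"
proof -
  have [measurable]: "\<phi> \<in> borel_measurable (lebesgue_on \<Omega>)"
    using test_function_differentiable(2)[OF \<phi>] \<open>open \<Omega>\<close>
    by (intro continuous_imp_measurable_on_sets_lebesgue) auto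
  obtain a b where supp: "\<And>x. \<phi> x \<noteq> 0 \<Longrightarrow> x \<in> cbox a b"
    using test_function_support[OF \<phi>] by blast
  obtain K where K: "\<And>x. x \<in> cbox a b \<Longrightarrow> norm (\<phi> x) \<le> K"
    using compact_continuous_image[OF test_function_differentiable(2)[OF \<phi>] compact_cbox, of a b]
    by (meson bounded_iff compact_imp_bounded imageI)
  have "integrable (lebesgue_on \<Omega>) (\<lambda>x. (\<phi> x)\<^sup>2)"
  proof (rule Bochner_Integration.integrable_bound)
    show "integrable (lebesgue_on \<Omega>) (\<lambda>x. K\<^sup>2 * (indicator (cbox a b) x * indicator (cbox a b) x))"
      using \<open>open \<Omega>\<close> by (intro integrable_mult_right L2_integrable_mult indicator_cbox_L2) auto
    have "(\<phi> x)\<^sup>2 \<le> K\<^sup>2 * (indicator (cbox a b) x * indicator (cbox a b) x)" for x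
    proof (cases "\<phi> x = 0")
      case False
      then have "\<bar>\<phi> x\<bar>\<^sup>2 \<le> K\<^sup>2"
        using supp K by (intro power_mono) auto
      with False supp show ?thesis by simp
    qed simp
    then show "AE x in lebesgue_on \<Omega>. norm ((\<phi> x)\<^sup>2)
        \<le> norm (K\<^sup>2 * (indicator (cbox a b) x * indicator (cbox a b) x))" by simp
  qed measurable
  then show ?thesis by (simp add: L2_def)
qed

text \<open>The indicator of the box is a bounded pointwise limit of test functions. The majorant is
  cut down to the closed box because a function in \<open>L2 \<Omega>\<close> need not be integrable
  over an arbitrary open set.\<close>

lemma integral_box_zero:
  assumes "open \<Omega>" and g: "g \<in> L2 \<Omega>" and box: "cbox a b \<subseteq> \<Omega>"
    and zero: "\<And>\<phi>. \<phi> \<in> test_functions \<Omega> \<Longrightarrow> regular \<Omega> g \<phi> = 0"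
  shows "(LINT x|lebesgue_on \<Omega>. g x * indicator (box a b) x) = 0"
proof -
  have [measurable]: "g \<in> borel_measurable (lebesgue_on \<Omega>)" using g by (simp add: L2_def)
  have [measurable]: "(indicator (box a b) :: R3 \<Rightarrow> real) \<in> borel_measurable (lebesgue_on \<Omega>)"
    by (intro measurable_restrict_space1 borel_measurable_indicator) auto
  obtain \<phi> where \<phi>: "\<And>n. \<phi> n \<in> test_functions \<Omega>" "\<And>n x. \<bar>\<phi> n x\<bar> \<le> indicator (box a b) x"
    "\<And>x. (\<lambda>n. \<phi> n x) \<longlonglongrightarrow> indicator (box a b) x"
    using box_approximation[OF box] by blast
  have [measurable]: "\<phi> n \<in> borel_measurable (lebesgue_on \<Omega>)" for n
    using test_functions_L2[OF \<open>open \<Omega>\<close> \<phi>(1)] by (simp add: L2_def)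
  have "(\<lambda>n. LINT x|lebesgue_on \<Omega>. g x * \<phi> n x) \<longlonglongrightarrow> (LINT x|lebesgue_on \<Omega>. g x * indicator (box a b) x)"
  proof (rule integral_dominated_convergence)
    show "integrable (lebesgue_on \<Omega>) (\<lambda>x. \<bar>g x * indicator (cbox a b) x\<bar>)"
      using L2_integrable_mult[OF g indicator_cbox_L2] \<open>open \<Omega>\<close> by (intro integrable_abs) auto
    show "AE x in lebesgue_on \<Omega>. (\<lambda>n. g x * \<phi> n x) \<longlonglongrightarrow> g x * indicator (box a b) x"
      by (intro AE_I2 tendsto_intros \<phi>)
    have "(indicator (box a b) x :: real) \<le> indicator (cbox a b) x" for x
      using box_subset_cbox[of a b] by (auto simp: indicator_def)
    then have "\<bar>g x\<bar> * \<bar>\<phi> n x\<bar> \<le> \<bar>g x\<bar> * \<bar>indicator (cbox a b) x\<bar>" for n x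
      using \<phi>(2)[of n x] by (intro mult_left_mono) (auto intro: order_trans)
    then show "AE x in lebesgue_on \<Omega>. norm (g x * \<phi> n x) \<le> \<bar>g x * indicator (cbox a b) x\<bar>" for n
      by (simp add: abs_mult)
  qed auto
  moreover have "(LINT x|lebesgue_on \<Omega>. g x * \<phi> n x) = 0" for n
    using zero[OF \<phi>(1)] by (simp add: regular_def)
  ultimately show ?thesis by (simp add: LIMSEQ_const_iff)
qed

text \<open>Localisation to boxes with closure in \<open>\<Omega>\<close> makes \<open>g\<close>
  integrable and its box integrals accessible through \<open>integral_box_zero\<close>; countably
  many such boxes cover \<open>\<Omega>\<close>.\<close>

lemma fundamental_lemma:
  assumes "open \<Omega>" and g: "g \<in> L2 \<Omega>"
    and zero: "\<And>\<phi>. \<phi> \<in> test_functions \<Omega> \<Longrightarrow> regular \<Omega> g \<phi> = 0"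
  shows "AE x in lebesgue_on \<Omega>. g x = 0"
proof -
  have on_box: "AE x in lebesgue. x \<in> box a b \<longrightarrow> g x = 0" if ab: "cbox a b \<subseteq> \<Omega>" for a b
  proof -
    have "AE x in lebesgue. indicator (box a b) x * g x = 0"
    proof (rule AE_zero_of_integral_box_zero)
      have "integrable lebesgue (\<lambda>x. indicator \<Omega> x *\<^sub>R (g x * indicator (cbox a b) x))"
        using L2_integrable_mult[OF g indicator_cbox_L2[OF open_lebesgue[OF \<open>open \<Omega>\<close>]]] \<open>open \<Omega>\<close>
        by (subst (asm) integrable_restrict_space) auto
      then have "integrable lebesgue (\<lambda>x. indicator (box a b) x *\<^sub>R (indicator \<Omega> x *\<^sub>R (g x * indicator (cbox a b) x)))"
        by (rule integrable_mult_indicator[rotated]) auto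
      moreover have "indicator (box a b) x *\<^sub>R (indicator \<Omega> x *\<^sub>R (g x * indicator (cbox a b) x))
          = indicator (box a b) x * g x" for x
        using ab box_subset_cbox[of a b] by (auto simp: indicator_def)
      ultimately show "integrable lebesgue (\<lambda>x. indicator (box a b) x * g x)" by (simp only:)
    next
      fix c d :: R3
      \<comment> \<open>An arbitrary test box meets the fixed one in a box whose closure still lies
        in \<open>\<Omega>\<close>.\<close>
      obtain p q where pq: "box c d \<inter> box a b = box p q" "cbox c d \<inter> cbox a b = cbox p q"
        using box_Int_box[of c d a b] Int_interval[of c d a b] by blast
      have sub: "cbox p q \<subseteq> \<Omega>" using pq ab by auto
      have "(LINT x|lebesgue. indicator (box c d) x * (indicator (box a b) x * g x))
          = (LINT x|lebesgue. indicator \<Omega> x *\<^sub>R (g x * indicator (box p q) x))"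
        using sub box_subset_cbox[of p q]
        by (intro Bochner_Integration.integral_cong) (auto simp: indicator_def simp flip: pq)
      also have "\<dots> = (LINT x|lebesgue_on \<Omega>. g x * indicator (box p q) x)"
        using \<open>open \<Omega>\<close> by (subst integral_restrict_space) auto
      also have "\<dots> = 0"
        by (rule integral_box_zero[OF \<open>open \<Omega>\<close> g sub zero])
      finally show "(LINT x|lebesgue. indicator (box c d) x * (indicator (box a b) x * g x)) = 0" .
    qed
    then show ?thesis by eventually_elim (auto simp: indicator_def split: if_splits)
  qed
  define F where "F = {box a b |a b. cbox a b \<subseteq> \<Omega>}"
  \<comment> \<open>Countability lets the exceptional null sets of the individual boxes be
    united.\<close>
  obtain F' where F': "F' \<subseteq> F" "countable F'" "\<Union>F' = \<Union>F"
    using Lindelof[of F] by (auto simp: F_def)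
  have "\<Omega> \<subseteq> \<Union>F"
  proof
    fix x assume "x \<in> \<Omega>"
    then obtain e where "0 < e" "ball x e \<subseteq> \<Omega>"
      using \<open>open \<Omega>\<close> open_contains_ball by blast
    then obtain a b where "x \<in> box a b" "cbox a b \<subseteq> ball x e"
      by (metis open_contains_cbox open_ball centre_in_ball)
    with \<open>ball x e \<subseteq> \<Omega>\<close> show "x \<in> \<Union>F" unfolding F_def by blast
  qed
  moreover have "AE x in lebesgue. \<forall>B\<in>F'. x \<in> B \<longrightarrow> g x = 0"
    using F' on_box by (subst AE_ball_countable) (auto simp: F_def)
  ultimately have "AE x in lebesgue. x \<in> \<Omega> \<longrightarrow> g x = 0"
    using F'(3) by (auto elim!: eventually_mono)
  then show ?thesis
    using \<open>open \<Omega>\<close> by (subst AE_restrict_space_iff) auto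
qed

text \<open>Makes \<open>L2_density\<close> usable: any density found by calculation agrees almost
  everywhere with the one selected by the choice operator.\<close>

lemma has_L2_density_unique:
  assumes "open \<Omega>" and g: "has_L2_density \<Omega> T g" and h: "has_L2_density \<Omega> T h"
  shows "AE x in lebesgue_on \<Omega>. g x = h x"
proof -
  have gh: "g \<in> L2 \<Omega>" "h \<in> L2 \<Omega>"
    using g h by (simp_all only: has_L2_density_def)
  have "AE x in lebesgue_on \<Omega>. g x - h x = 0"
  proof (rule fundamental_lemma[OF \<open>open \<Omega>\<close> L2.diff_closed[OF gh]])
    fix \<phi> assume \<phi>: "\<phi> \<in> test_functions \<Omega>"
    then have "regular \<Omega> g \<phi> = regular \<Omega> h \<phi>"
      using g h unfolding has_L2_density_def by metis
    then show "regular \<Omega> (\<lambda>x. g x - h x) \<phi> = 0"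
      using L2.B_diff[OF gh test_functions_L2[OF \<open>open \<Omega>\<close> \<phi>]]
      by (simp add: regular_def L2_inner_real)
  qed
  then show ?thesis by simp
qed

section \<open>Calculus of test functions\<close>

lemma partial_along_line:
  assumes "\<And>x. f differentiable at x"
  shows "((\<lambda>t. f (x + t *\<^sub>R axis j 1)) has_real_derivative partial j f (x + t *\<^sub>R axis j 1)) (at t)"
proof -
  have "(f has_derivative frechet_derivative f (at (x + t *\<^sub>R axis j 1))) (at (x + t *\<^sub>R axis j 1))"
    using assms by (simp add: frechet_derivative_works[symmetric])
  then have "((f \<circ> (\<lambda>t. x + t *\<^sub>R axis j 1)) has_derivative
      (frechet_derivative f (at (x + t *\<^sub>R axis j 1)) \<circ> (\<lambda>h. h *\<^sub>R axis j 1))) (at t)"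
    by (intro diff_chain_at) (auto intro!: derivative_eq_intros)
  moreover have "frechet_derivative f (at (x + t *\<^sub>R axis j 1)) (h *\<^sub>R axis j 1)
      = partial j f (x + t *\<^sub>R axis j 1) * h" for h
    using linear_frechet_derivative[OF assms] by (simp add: partial_def linear_scale)
  ultimately show ?thesis by (simp add: has_field_derivative_def o_def)
qed

lemma partial_mean_value:
  assumes "\<And>x. f differentiable at x" and "0 < h"
  obtains r where "0 < r" "r < h"
    "f (x + h *\<^sub>R axis j 1) - f x = h * partial j f (x + r *\<^sub>R axis j 1)"
proof -
  have "\<exists>r>0. r < h \<and> f (x + h *\<^sub>R axis j 1) - f (x + 0 *\<^sub>R axis j 1)
      = (h - 0) * partial j f (x + r *\<^sub>R axis j 1)"
    by (rule MVT2[OF \<open>0 < h\<close>]) (rule partial_along_line[OF assms(1)])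
  then show ?thesis using that by auto
qed

lemma partial_comb:
  assumes "\<And>x. f differentiable at x" "\<And>x. g differentiable at x"
  shows "partial j (\<lambda>x. a * f x + b * g x) = (\<lambda>x. a * partial j f x + b * partial j g x)"
proof
  fix x
  have "((\<lambda>x. a * f x + b * g x) has_derivative
      (\<lambda>v. a * frechet_derivative f (at x) v + b * frechet_derivative g (at x) v)) (at x)"
    using assms by (intro has_derivative_add has_derivative_mult_right) (simp_all add: frechet_derivative_works[symmetric])
  from fun_cong[OF frechet_derivative_at[OF this], of "axis j 1"]
  show "partial j (\<lambda>x. a * f x + b * g x) x = a * partial j f x + b * partial j g x"
    unfolding partial_def by (rule sym)
qed

lemma partial_mult:
  assumes "f differentiable at x" "g differentiable at x"
  shows "partial j (\<lambda>x. f x * g x) x = f x * partial j g x + partial j f x * g x"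
proof -
  have "((\<lambda>x. f x * g x) has_derivative
      (\<lambda>v. f x * frechet_derivative g (at x) v + frechet_derivative f (at x) v * g x)) (at x)"
    using assms by (intro has_derivative_mult) (simp_all add: frechet_derivative_works[symmetric])
  from fun_cong[OF frechet_derivative_at[OF this], of "axis j 1"]
  show ?thesis unfolding partial_def by (rule sym)
qed

lemma partial_eq_0:
  assumes "open U" "x \<in> U" "\<And>y. y \<in> U \<Longrightarrow> f y = 0"
  shows "partial j f x = 0"
proof -
  have "((\<lambda>x. 0 :: real) has_derivative (\<lambda>v. 0)) (at x)" by simp
  then have "(f has_derivative (\<lambda>v. 0)) (at x)"
    by (rule has_derivative_transform_within_open[of _ _ _ _ U]) (use assms in auto)
  from fun_cong[OF frechet_derivative_at[OF this], of "axis j 1"]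
  show ?thesis unfolding partial_def by (rule sym)
qed

lemma smooth_differentiable: "smooth f \<Longrightarrow> foldr partial js f differentiable at x"
  by (simp add: smooth_def)

lemma smooth_comb:
  assumes "smooth f" "smooth g"
  shows "smooth (\<lambda>x. a * f x + b * g x)"
proof -
  have "foldr partial js (\<lambda>x. a * f x + b * g x)
      = (\<lambda>x. a * foldr partial js f x + b * foldr partial js g x)" for js
  proof (induction js)
    case (Cons j js)
    then show ?case
      using partial_comb[OF smooth_differentiable[OF assms(1)] smooth_differentiable[OF assms(2)]] by simp
  qed simp
  with assms show ?thesis by (simp add: smooth_def)
qed

lemma test_functions_comb:
  assumes "\<phi> \<in> test_functions \<Omega>" "\<psi> \<in> test_functions \<Omega>"
  shows "(\<lambda>x. a * \<phi> x + b * \<psi> x) \<in> test_functions \<Omega>"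
proof -
  let ?A = "closure {x. \<phi> x \<noteq> 0}" and ?B = "closure {x. \<psi> x \<noteq> 0}"
  have "closure {x. a * \<phi> x + b * \<psi> x \<noteq> 0} \<subseteq> closure ({x. \<phi> x \<noteq> 0} \<union> {x. \<psi> x \<noteq> 0})"
    by (rule closure_mono) auto
  also have "\<dots> = ?A \<union> ?B" by simp
  finally have sub: "closure {x. a * \<phi> x + b * \<psi> x \<noteq> 0} \<subseteq> ?A \<union> ?B" .
  have AB: "compact (?A \<union> ?B)" "?A \<union> ?B \<subseteq> \<Omega>"
    using assms by (auto simp: test_functions_def intro: compact_Un)
  have "compact (closure {x. a * \<phi> x + b * \<psi> x \<noteq> 0})"
    using AB(1) sub bounded_subset compact_eq_bounded_closed closed_closure by blast
  with sub AB(2) assms show ?thesis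
    by (auto simp: test_functions_def smooth_comb)
qed

lemma test_functions_partial:
  assumes "\<phi> \<in> test_functions \<Omega>"
  shows "partial j \<phi> \<in> test_functions \<Omega>"
proof -
  have "foldr partial js (partial j \<phi>) differentiable at x" for js x
    using smooth_differentiable[of \<phi> "js @ [j]"] assms by (simp add: test_functions_def)
  then have "smooth (partial j \<phi>)" by (simp add: smooth_def)
  define C where "C = closure {x. \<phi> x \<noteq> 0}"
  have C: "compact C" "C \<subseteq> \<Omega>" "closed C"
    using assms by (simp_all add: C_def test_functions_def)
  have "\<phi> y = 0" if "y \<in> - C" for y
    using that closure_subset[of "{x. \<phi> x \<noteq> 0}"] by (auto simp: C_def)
  then have "partial j \<phi> x = 0" if "x \<notin> C" for x
    using that C(3) by (intro partial_eq_0[of "- C"]) auto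
  then have "{x. partial j \<phi> x \<noteq> 0} \<subseteq> C" by blast
  then have sub: "closure {x. partial j \<phi> x \<noteq> 0} \<subseteq> C"
    using C(3) by (rule closure_minimal)
  moreover have "compact (closure {x. partial j \<phi> x \<noteq> 0})"
    using compact_Int_closed[OF C(1) closed_closure, of "{x. partial j \<phi> x \<noteq> 0}"]
    unfolding Int_absorb1[OF sub] .
  ultimately show ?thesis
    using C(2) \<open>smooth (partial j \<phi>)\<close> by (simp add: test_functions_def)
qed

text \<open>The mean value theorem is applied in direction \<open>i\<close> to the increment of
  \<open>f\<close> across \<open>j\<close>, then in direction \<open>j\<close> to
  \<open>partial i f\<close>. The second difference is symmetric in \<open>i\<close> and
  \<open>j\<close>, whereas the resulting mixed derivative is not obviously so.\<close>

lemma second_difference: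
  assumes "\<And>x. f differentiable at x" "\<And>x. partial i f differentiable at x" and "0 < h"
  obtains r s where "0 < r" "r < h" "0 < s" "s < h"
    "f (x + h *\<^sub>R axis i 1 + h *\<^sub>R axis j 1) - f (x + h *\<^sub>R axis i 1) - f (x + h *\<^sub>R axis j 1) + f x
      = h * (h * partial j (partial i f) (x + r *\<^sub>R axis i 1 + s *\<^sub>R axis j 1))"
proof -
  define g where "g t = f (x + h *\<^sub>R axis j 1 + t *\<^sub>R axis i 1) - f (x + t *\<^sub>R axis i 1)" for t
  have "(g has_real_derivative
      partial i f (x + h *\<^sub>R axis j 1 + t *\<^sub>R axis i 1) - partial i f (x + t *\<^sub>R axis i 1)) (at t)" for t
    unfolding g_def[abs_def] by (intro DERIV_diff partial_along_line assms(1))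
  then obtain r where r: "0 < r" "r < h" and "g h - g 0
      = h * (partial i f (x + h *\<^sub>R axis j 1 + r *\<^sub>R axis i 1) - partial i f (x + r *\<^sub>R axis i 1))"
    using MVT2[OF \<open>0 < h\<close>, of g "\<lambda>t. partial i f (x + h *\<^sub>R axis j 1 + t *\<^sub>R axis i 1)
      - partial i f (x + t *\<^sub>R axis i 1)"] by auto
  moreover obtain s where "0 < s" "s < h"
    "partial i f (x + r *\<^sub>R axis i 1 + h *\<^sub>R axis j 1) - partial i f (x + r *\<^sub>R axis i 1)
      = h * partial j (partial i f) (x + r *\<^sub>R axis i 1 + s *\<^sub>R axis j 1)"
    by (rule partial_mean_value[OF assms(2,3)])
  ultimately show ?thesis
    using that[OF r, of s] by (simp add: g_def algebra_simps)
qed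

text \<open>At every scale \<open>h n\<close> the same second difference equals either mixed
  derivative, taken at two points that converge to \<open>x\<close>; continuity of both mixed
  derivatives at \<open>x\<close> finishes the argument.\<close>

lemma partial_commute:
  assumes f: "\<And>x. f differentiable at x" "\<And>x. partial i f differentiable at x"
      "\<And>x. partial j f differentiable at x"
    and cont: "isCont (partial j (partial i f)) x" "isCont (partial i (partial j f)) x"
  shows "partial j (partial i f) x = partial i (partial j f) x"
proof -
  define h where "h n = 1 / real (Suc n)" for n
  have h: "0 < h n" for n by (simp add: h_def)
  have "h \<longlonglongrightarrow> 0" unfolding h_def[abs_def] by (rule LIMSEQ_Suc[OF lim_1_over_n])
  have "\<exists>r s r' s'. 0 < r \<and> r < h n \<and> 0 < s \<and> s < h n \<and> 0 < r' \<and> r' < h n \<and> 0 < s' \<and> s' < h n \<and>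
      partial j (partial i f) (x + r *\<^sub>R axis i 1 + s *\<^sub>R axis j 1)
      = partial i (partial j f) (x + r' *\<^sub>R axis j 1 + s' *\<^sub>R axis i 1)" for n
  proof -
    obtain r s where rs: "0 < r" "r < h n" "0 < s" "s < h n"
      "f (x + h n *\<^sub>R axis i 1 + h n *\<^sub>R axis j 1) - f (x + h n *\<^sub>R axis i 1) - f (x + h n *\<^sub>R axis j 1) + f x
        = h n * (h n * partial j (partial i f) (x + r *\<^sub>R axis i 1 + s *\<^sub>R axis j 1))"
      by (rule second_difference[OF f(1,2) h])
    obtain r' s' where rs': "0 < r'" "r' < h n" "0 < s'" "s' < h n"
      "f (x + h n *\<^sub>R axis j 1 + h n *\<^sub>R axis i 1) - f (x + h n *\<^sub>R axis j 1) - f (x + h n *\<^sub>R axis i 1) + f x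
        = h n * (h n * partial i (partial j f) (x + r' *\<^sub>R axis j 1 + s' *\<^sub>R axis i 1))"
      by (rule second_difference[OF f(1,3) h])
    have "h n * (h n * partial j (partial i f) (x + r *\<^sub>R axis i 1 + s *\<^sub>R axis j 1))
        = h n * (h n * partial i (partial j f) (x + r' *\<^sub>R axis j 1 + s' *\<^sub>R axis i 1))"
      unfolding rs(5)[symmetric] rs'(5)[symmetric] by (simp add: add.commute add.left_commute)
    with h[of n] rs rs' show ?thesis by (intro exI[of _ r] exI[of _ s] exI[of _ r'] exI[of _ s']) simp
  qed
  then obtain r s r' s' where
    bounds: "\<And>n. 0 < r n" "\<And>n. r n < h n" "\<And>n. 0 < s n" "\<And>n. s n < h n"
      "\<And>n. 0 < r' n" "\<And>n. r' n < h n" "\<And>n. 0 < s' n" "\<And>n. s' n < h n"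
    and eq: "\<And>n. partial j (partial i f) (x + r n *\<^sub>R axis i 1 + s n *\<^sub>R axis j 1)
      = partial i (partial j f) (x + r' n *\<^sub>R axis j 1 + s' n *\<^sub>R axis i 1)"
    by metis
  have lim0: "q \<longlonglongrightarrow> 0" if "\<And>n. 0 < q n" "\<And>n. q n < h n" for q
    by (rule tendsto_sandwich[OF _ _ tendsto_const \<open>h \<longlonglongrightarrow> 0\<close>])
      (use that in \<open>auto intro!: always_eventually less_imp_le\<close>)
  have "(\<lambda>n. x + r n *\<^sub>R axis i 1 + s n *\<^sub>R axis j 1) \<longlonglongrightarrow> x + 0 *\<^sub>R axis i 1 + 0 *\<^sub>R axis j 1"
    by (intro tendsto_intros lim0 bounds)
  then have "(\<lambda>n. partial j (partial i f) (x + r n *\<^sub>R axis i 1 + s n *\<^sub>R axis j 1))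
      \<longlonglongrightarrow> partial j (partial i f) x"
    using cont(1) by (intro isCont_tendsto_compose[OF cont(1)]) simp
  moreover have "(\<lambda>n. x + r' n *\<^sub>R axis j 1 + s' n *\<^sub>R axis i 1) \<longlonglongrightarrow> x + 0 *\<^sub>R axis j 1 + 0 *\<^sub>R axis i 1"
    by (intro tendsto_intros lim0 bounds)
  then have "(\<lambda>n. partial i (partial j f) (x + r' n *\<^sub>R axis j 1 + s' n *\<^sub>R axis i 1))
      \<longlonglongrightarrow> partial i (partial j f) x"
    by (intro isCont_tendsto_compose[OF cont(2)]) simp
  ultimately show ?thesis
    unfolding eq by (rule LIMSEQ_unique)
qed

lemma test_function_partial_commute:
  assumes "\<phi> \<in> test_functions \<Omega>"
  shows "partial j (partial i \<phi>) = partial i (partial j \<phi>)"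
proof
  fix x
  note * = test_functions_partial test_function_differentiable(1) assms
  show "partial j (partial i \<phi>) x = partial i (partial j \<phi>) x"
    by (rule partial_commute) (rule * differentiable_imp_continuous_within)+
qed

text \<open>The difference quotients have integral zero by translation invariance.\<close>

lemma integral_partial_eq_0:
  assumes f: "\<And>x. f differentiable at x" and cont: "continuous_on UNIV (partial j f)"
    and supp: "\<And>x. x \<notin> cbox a b \<Longrightarrow> f x = 0"
  shows "(LINT x|lborel. partial j f x) = 0"
proof -
  have "continuous_on UNIV f"
    using f by (simp add: continuous_at_imp_continuous_on differentiable_imp_continuous_within)
  then have [measurable]: "f \<in> borel_measurable borel" "partial j f \<in> borel_measurable borel"
    using cont by (auto intro: borel_measurable_continuous_onI)
  define e :: R3 where "e = axis j 1"
  obtain K where K: "\<And>x. x \<in> cbox a b \<Longrightarrow> norm (partial j f x) \<le> K"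
    using compact_continuous_image[OF continuous_on_subset[OF cont] compact_cbox, of a b]
    by (metis bounded_iff compact_imp_bounded imageI subset_UNIV)
  have partial_0: "partial j f x = 0" if "x \<notin> cbox a b" for x
    using partial_eq_0[of "- cbox a b" x f j] that supp by (auto simp: closed_cbox)
  have bound: "\<bar>partial j f x\<bar> \<le> \<bar>K\<bar>" for x
    using K[of x] partial_0[of x] by (cases "x \<in> cbox a b") auto
  define h where "h n = 1 / real (Suc n)" for n
  have h: "0 < h n" "h n \<le> 1" for n by (simp_all add: h_def)
  define D where "D n x = (f (x + h n *\<^sub>R e) - f x) / h n" for n x
  \<comment> \<open>As \<open>h n \<le> 1\<close>, a margin of 1 in each coordinate contains the
    supports of all difference quotients, so that one majorant serves for every
    \<open>n\<close>.\<close>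
  define Q :: "R3 set" where "Q = cbox (a - 1) (b + 1)"
  have f_int: "integrable lborel f"
  proof -
    have "integrable lborel (\<lambda>x. indicator (cbox a b) x *\<^sub>R f x)"
      using \<open>continuous_on UNIV f\<close> by (intro borel_integrable_compact) (auto intro: continuous_on_subset)
    moreover have "indicator (cbox a b) x *\<^sub>R f x = f x" for x
      using supp by (auto simp: indicator_def)
    ultimately show ?thesis by (simp only:)
  qed
  have shift: "integrable lborel (\<lambda>x. f (x + c))" "(LINT x|lborel. f (x + c)) = (LINT x|lborel. f x)" for c
  proof -
    have "integrable (distr lborel borel ((+) c)) f"
      using f_int by (simp add: lborel_distr_plus)
    then show "integrable lborel (\<lambda>x. f (x + c))"
      by (simp add: integrable_distr_eq add.commute)
    have "(LINT x|distr lborel borel ((+) c). f x) = (LINT x|lborel. f (c + x))"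
      by (rule integral_distr) auto
    then show "(LINT x|lborel. f (x + c)) = (LINT x|lborel. f x)"
      by (simp add: lborel_distr_plus add.commute)
  qed
  have "(\<lambda>n. LINT x|lborel. D n x) \<longlonglongrightarrow> (LINT x|lborel. partial j f x)"
  proof (rule integral_dominated_convergence)
    show "integrable lborel (\<lambda>x. \<bar>K\<bar> * indicator Q x)"
      unfolding Q_def by (intro integrable_mult_right integrable_real_indicator) (auto simp: emeasure_lborel_cbox_eq)
    show "AE x in lborel. (\<lambda>n. D n x) \<longlonglongrightarrow> partial j f x"
    proof (rule AE_I2)
      fix x
      have "((\<lambda>t. (f (x + t *\<^sub>R e) - f x) / t) \<longlongrightarrow> partial j f x) (at 0)"
        using partial_along_line[OF f, of x j 0] by (simp add: DERIV_def e_def)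
      moreover have "filterlim h (at 0) sequentially"
        unfolding filterlim_at using LIMSEQ_Suc[OF lim_1_over_n]
        by (simp add: h_def[abs_def])
      ultimately show "(\<lambda>n. D n x) \<longlonglongrightarrow> partial j f x"
        unfolding D_def by (rule filterlim_compose)
    qed
    show "AE x in lborel. norm (D n x) \<le> \<bar>K\<bar> * indicator Q x" for n
    proof (rule AE_I2)
      fix x
      \<comment> \<open>The mean value theorem bounds the quotients by the bound on the partial
        derivative, uniformly in \<open>n\<close>.\<close>
      obtain r where "f (x + h n *\<^sub>R e) - f x = h n * partial j f (x + r *\<^sub>R e)"
        unfolding e_def by (rule partial_mean_value[OF f h(1)])
      then have le: "norm (D n x) \<le> \<bar>K\<bar>"
        using h(1)[of n] bound by (simp add: D_def)
      show "norm (D n x) \<le> \<bar>K\<bar> * indicator Q x"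
      proof (cases "x \<in> Q")
        case False
        have e: "0 \<le> h n * e $ i" "h n * e $ i \<le> 1" for i
          using h[of n] by (simp_all add: e_def axis_def)
        \<comment> \<open>Used contrapositively: for \<open>x\<close> outside \<open>Q\<close>,
          neither \<open>x\<close> nor the shifted point lies in the support, so the quotient
          vanishes.\<close>
        have "y + c *\<^sub>R e \<in> Q" if "y \<in> cbox a b" "c = 0 \<or> c = - h n" for y c
          unfolding Q_def mem_box_cart
        proof
          fix i
          have "a $ i \<le> y $ i" "y $ i \<le> b $ i" using that by (auto simp: mem_box_cart)
          with e[of i] that(2) show "(a - 1) $ i \<le> (y + c *\<^sub>R e) $ i \<and> (y + c *\<^sub>R e) $ i \<le> (b + 1) $ i"
            by auto
        qed
        from this[of x 0] this[of "x + h n *\<^sub>R e" "- h n"]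
        have "x \<notin> cbox a b" "x + h n *\<^sub>R e \<notin> cbox a b"
          using False by auto
        then show ?thesis using False supp by (simp add: D_def)
      qed (use le in simp)
    qed
  qed (auto simp: D_def)
  moreover have "(LINT x|lborel. D n x) = 0" for n
    unfolding D_def using shift f_int by simp
  ultimately show ?thesis by (simp add: LIMSEQ_const_iff)
qed

text \<open>The derivative of the compactly supported product has integral zero over the whole
  space. Both terms of the product rule vanish off \<open>\<Omega>\<close>, so the same holds over
  \<open>\<Omega>\<close>.\<close>

lemma test_function_integration_by_parts:
  assumes "open \<Omega>" and \<phi>: "\<phi> \<in> test_functions \<Omega>" and \<psi>: "\<psi> \<in> test_functions \<Omega>"
  shows "(LINT x|lebesgue_on \<Omega>. \<phi> x * partial j \<psi> x) = - (LINT x|lebesgue_on \<Omega>. partial j \<phi> x * \<psi> x)"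
proof -
  define f where "f x = \<phi> x * \<psi> x" for x
  note d = test_function_differentiable
  have partial_f: "partial j f = (\<lambda>x. \<phi> x * partial j \<psi> x + partial j \<phi> x * \<psi> x)"
    unfolding f_def[abs_def] using partial_mult[OF d(1)[OF \<phi>] d(1)[OF \<psi>]] by auto
  have cont: "continuous_on UNIV (partial j f)"
    unfolding partial_f using d(2) test_functions_partial \<phi> \<psi> by (intro continuous_intros) blast+
  obtain a b where "\<And>x. \<phi> x \<noteq> 0 \<Longrightarrow> x \<in> cbox a b"
    using test_function_support[OF \<phi>] by blast
  then have "(LINT x|lborel. partial j f x) = 0"
    using d(1)[OF \<phi>] d(1)[OF \<psi>] cont
    by (intro integral_partial_eq_0[of f j a b]) (auto simp: f_def[abs_def])
  moreover have "(LINT x|lebesgue_on \<Omega>. partial j f x) = (LINT x|lborel. partial j f x)"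
  proof -
    have "\<eta> x = 0" if "x \<notin> \<Omega>" and \<eta>: "\<eta> \<in> test_functions \<Omega>" for x \<eta>
    proof (rule ccontr)
      assume "\<eta> x \<noteq> 0"
      then have "x \<in> closure {x. \<eta> x \<noteq> 0}"
        using closure_subset[of "{x. \<eta> x \<noteq> 0}"] by blast
      with \<eta> \<open>x \<notin> \<Omega>\<close> show False by (auto simp: test_functions_def)
    qed
    from this[OF _ \<phi>] this[OF _ test_functions_partial[OF \<phi>]] have indicator_partial: "indicator \<Omega> x *\<^sub>R partial j f x = partial j f x" for x
      unfolding partial_f by (auto simp: indicator_def)
    have "(LINT x|lebesgue_on \<Omega>. partial j f x) = (LINT x|lebesgue. indicator \<Omega> x *\<^sub>R partial j f x)"
      using \<open>open \<Omega>\<close> by (intro integral_restrict_space) simp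
    also have "\<dots> = (LINT x|lebesgue. partial j f x)"
      by (simp only: indicator_partial)
    also have "\<dots> = (LINT x|lborel. partial j f x)"
      using cont by (intro integral_completion) (simp add: borel_measurable_continuous_onI)
    finally show ?thesis .
  qed
  moreover have "(LINT x|lebesgue_on \<Omega>. partial j f x)
      = (LINT x|lebesgue_on \<Omega>. \<phi> x * partial j \<psi> x) + (LINT x|lebesgue_on \<Omega>. partial j \<phi> x * \<psi> x)"
    unfolding partial_f using \<phi> \<psi> test_functions_partial \<open>open \<Omega>\<close>
    by (intro Bochner_Integration.integral_add L2_integrable_mult test_functions_L2) blast+
  ultimately show ?thesis by simp
qed

section \<open>Scalar Sobolev spaces\<close>

lemma has_L2_density_cong:
  assumes "has_L2_density \<Omega> S g" and eq: "\<And>\<phi>. \<phi> \<in> test_functions \<Omega> \<Longrightarrow> T \<phi> = S \<phi>"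
  shows "has_L2_density \<Omega> T g"
proof -
  have "g \<in> L2 \<Omega>" and S: "\<And>\<phi>. \<phi> \<in> test_functions \<Omega> \<Longrightarrow> S \<phi> = regular \<Omega> g \<phi>"
    using assms(1) by (simp_all only: has_L2_density_def)
  then show ?thesis
    unfolding has_L2_density_def by (intro conjI ballI trans[OF eq S])
qed

lemma has_L2_density_L2_density: "has_L2_density \<Omega> T g \<Longrightarrow> has_L2_density \<Omega> T (L2_density \<Omega> T)"
  unfolding L2_density_def by (rule someI[of "has_L2_density \<Omega> T"])

lemma H1_L2: "u \<in> H1 \<Omega> \<Longrightarrow> u \<in> L2 \<Omega>"
  by (simp add: H1_def)

lemma H1_weak_partial:
  assumes "u \<in> H1 \<Omega>"
  shows "has_L2_density \<Omega> (dist_partial j (regular \<Omega> u)) (weak_partial \<Omega> j u)"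
proof -
  obtain g where "has_L2_density \<Omega> (dist_partial j (regular \<Omega> u)) g"
    using assms unfolding H1_def by blast
  then show ?thesis
    unfolding weak_partial_def by (rule has_L2_density_L2_density)
qed

lemma weak_partial_L2: "u \<in> H1 \<Omega> \<Longrightarrow> weak_partial \<Omega> j u \<in> L2 \<Omega>"
  using H1_weak_partial by (simp add: has_L2_density_def)

lemma regular_eq_L2_inner: "regular \<Omega> u \<phi> = L2_inner \<Omega> u \<phi>"
  by (simp add: regular_def L2_inner_real)

lemma H1_weak_partial_test:
  assumes "u \<in> H1 \<Omega>" "\<phi> \<in> test_functions \<Omega>"
  shows "L2_inner \<Omega> (weak_partial \<Omega> j u) \<phi> = - L2_inner \<Omega> u (partial j \<phi>)"
  using H1_weak_partial[OF assms(1), of j] assms(2)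
  by (simp add: has_L2_density_def dist_partial_def regular_eq_L2_inner)

lemma H1I:
  "\<lbrakk>u \<in> L2 \<Omega>; \<And>j. has_L2_density \<Omega> (dist_partial j (regular \<Omega> u)) (g j)\<rbrakk> \<Longrightarrow> u \<in> H1 \<Omega>"
  unfolding H1_def by blast

section \<open>Weak derivatives on an open set and completeness of H1\<close>

locale open_domain =
  fixes \<Omega> :: "R3 set"
  assumes open_domain: "open \<Omega>"
begin

lemma weak_partial_eq:
  "\<lbrakk>has_L2_density \<Omega> (dist_partial j (regular \<Omega> u)) g\<rbrakk> \<Longrightarrow>
    AE x in lebesgue_on \<Omega>. weak_partial \<Omega> j u x = g x"
  unfolding weak_partial_def
  by (rule has_L2_density_unique[OF open_domain has_L2_density_L2_density])

lemma test_L2: "\<phi> \<in> test_functions \<Omega> \<Longrightarrow> \<phi> \<in> L2 \<Omega>"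
  using test_functions_L2[OF open_domain] .

lemma regular_comb:
  assumes "u \<in> L2 \<Omega>" "v \<in> L2 \<Omega>" "\<phi> \<in> test_functions \<Omega>"
  shows "regular \<Omega> (\<lambda>x. a * u x + b * v x) \<phi> = a * regular \<Omega> u \<phi> + b * regular \<Omega> v \<phi>"
  using L2.B_comb[of u \<Omega> v \<phi> a b] assms test_L2 by (simp add: regular_eq_L2_inner)

lemma has_L2_density_comb:
  assumes "has_L2_density \<Omega> T g" "has_L2_density \<Omega> S h"
  shows "has_L2_density \<Omega> (\<lambda>\<phi>. a * T \<phi> + b * S \<phi>) (\<lambda>x. a * g x + b * h x)"
proof -
  have gh: "g \<in> L2 \<Omega>" "h \<in> L2 \<Omega>"
    and T: "\<And>\<phi>. \<phi> \<in> test_functions \<Omega> \<Longrightarrow> T \<phi> = regular \<Omega> g \<phi>"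
    and S: "\<And>\<phi>. \<phi> \<in> test_functions \<Omega> \<Longrightarrow> S \<phi> = regular \<Omega> h \<phi>"
    using assms by (simp_all only: has_L2_density_def)
  show ?thesis
    unfolding has_L2_density_def
  proof (intro conjI ballI)
    show "(\<lambda>x. a * g x + b * h x) \<in> L2 \<Omega>"
      using gh by (rule L2_comb)
    fix \<phi> assume "\<phi> \<in> test_functions \<Omega>"
    then show "a * T \<phi> + b * S \<phi> = regular \<Omega> (\<lambda>x. a * g x + b * h x) \<phi>"
      using T[of \<phi>] S[of \<phi>] regular_comb[OF gh] by metis
  qed
qed

lemma H1_comb_weak_partial:
  assumes u: "u \<in> H1 \<Omega>" and v: "v \<in> H1 \<Omega>"
  shows "has_L2_density \<Omega> (dist_partial j (regular \<Omega> (\<lambda>x. a * u x + b * v x)))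
    (\<lambda>x. a * weak_partial \<Omega> j u x + b * weak_partial \<Omega> j v x)"
proof (rule has_L2_density_cong[OF has_L2_density_comb[OF H1_weak_partial[OF u] H1_weak_partial[OF v]]])
  fix \<phi> assume "\<phi> \<in> test_functions \<Omega>"
  then show "dist_partial j (regular \<Omega> (\<lambda>x. a * u x + b * v x)) \<phi>
      = a * dist_partial j (regular \<Omega> u) \<phi> + b * dist_partial j (regular \<Omega> v) \<phi>"
    using regular_comb[OF H1_L2[OF u] H1_L2[OF v] test_functions_partial]
    by (simp add: dist_partial_def algebra_simps)
qed

lemma H1_comb: "\<lbrakk>u \<in> H1 \<Omega>; v \<in> H1 \<Omega>\<rbrakk> \<Longrightarrow> (\<lambda>x. a * u x + b * v x) \<in> H1 \<Omega>"
  by (rule H1I[OF L2_comb[OF H1_L2 H1_L2] H1_comb_weak_partial])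

lemma weak_partial_comb:
  "\<lbrakk>u \<in> H1 \<Omega>; v \<in> H1 \<Omega>\<rbrakk> \<Longrightarrow> AE x in lebesgue_on \<Omega>.
    weak_partial \<Omega> j (\<lambda>x. a * u x + b * v x) x = a * weak_partial \<Omega> j u x + b * weak_partial \<Omega> j v x"
  by (rule weak_partial_eq[OF H1_comb_weak_partial])

text \<open>The weak derivatives of \<open>u\<close>, of \<open>v\<close> and of their combination
  are chosen independently, so linearity is an exact equality only after integration.\<close>

lemma L2_inner_weak_partial_comb:
  assumes u: "u \<in> H1 \<Omega>" and v: "v \<in> H1 \<Omega>" and w: "w \<in> L2 \<Omega>"
  shows "L2_inner \<Omega> (weak_partial \<Omega> j (\<lambda>x. a * u x + b * v x)) w
    = a * L2_inner \<Omega> (weak_partial \<Omega> j u) w + b * L2_inner \<Omega> (weak_partial \<Omega> j v) w"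
proof -
  note L = weak_partial_L2[OF u, of j] weak_partial_L2[OF v, of j]
  have "L2_inner \<Omega> (weak_partial \<Omega> j (\<lambda>x. a * u x + b * v x)) w
      = L2_inner \<Omega> (\<lambda>x. a * weak_partial \<Omega> j u x + b * weak_partial \<Omega> j v x) w"
    by (rule L2_inner_cong_AE[OF weak_partial_L2[OF H1_comb[OF u v]] L2_comb[OF L] w w
          weak_partial_comb[OF u v]]) simp
  then show ?thesis using L2.B_comb[OF L w, of a b] by simp
qed

lemma H1_inner_expand:
  assumes "u \<in> H1 \<Omega>" "v \<in> H1 \<Omega>"
  shows "H1_inner \<Omega> u v
    = (\<Sum>j\<in>UNIV. L2_inner \<Omega> (weak_partial \<Omega> j u) (weak_partial \<Omega> j v)) + L2_inner \<Omega> u v"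
proof -
  have "L2_inner \<Omega> (weak_gradient \<Omega> u) (weak_gradient \<Omega> v)
      = (LINT x|lebesgue_on \<Omega>. (\<Sum>j\<in>UNIV. weak_partial \<Omega> j u x * weak_partial \<Omega> j v x))"
    by (simp add: L2_inner_def weak_gradient_def inner_vec_def)
  also have "\<dots> = (\<Sum>j\<in>UNIV. L2_inner \<Omega> (weak_partial \<Omega> j u) (weak_partial \<Omega> j v))"
    unfolding L2_inner_real using assms
    by (intro Bochner_Integration.integral_sum L2_integrable_mult weak_partial_L2)
  finally show ?thesis by (simp add: H1_inner_def)
qed

sublocale H1: semi_inner_space "H1 \<Omega>" "H1_inner \<Omega>"
proof
  have "has_L2_density \<Omega> (dist_partial j (regular \<Omega> (\<lambda>x. 0))) (\<lambda>x. 0)" for j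
    by (simp add: has_L2_density_def dist_partial_def regular_def L2_def)
  then have "(\<lambda>x. 0) \<in> H1 \<Omega>"
    by (intro H1I) (simp add: L2_def)
  then show "H1 \<Omega> \<noteq> {}" by blast
next
  fix u v w a b
  assume uv: "u \<in> H1 \<Omega>" "v \<in> H1 \<Omega>"
  show "(\<lambda>x. a *\<^sub>R u x + b *\<^sub>R v x) \<in> H1 \<Omega>"
    using H1_comb[OF uv] by simp
  assume w: "w \<in> H1 \<Omega>"
  show "H1_inner \<Omega> (\<lambda>x. a *\<^sub>R u x + b *\<^sub>R v x) w = a * H1_inner \<Omega> u w + b * H1_inner \<Omega> v w"
    using uv w L2.B_comb[OF uv[THEN H1_L2] H1_L2[OF w], of a b]
    by (simp add: H1_inner_expand H1_comb L2_inner_weak_partial_comb weak_partial_L2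
        sum.distrib sum_distrib_left algebra_simps)
next
  fix u v
  assume uv: "u \<in> H1 \<Omega>" "v \<in> H1 \<Omega>"
  show "H1_inner \<Omega> u v = H1_inner \<Omega> v u"
    by (simp add: H1_inner_def L2_inner_def inner_commute mult.commute)
  show "0 \<le> H1_inner \<Omega> u u"
    by (simp add: H1_inner_def L2_inner_def)
qed

lemma H1_diff_weak_partial:
  assumes "u \<in> H1 \<Omega>" "v \<in> H1 \<Omega>"
  shows "AE x in lebesgue_on \<Omega>. weak_partial \<Omega> j (\<lambda>x. u x - v x) x = weak_partial \<Omega> j u x - weak_partial \<Omega> j v x"
  using weak_partial_comb[OF assms, of j 1 "-1"] by simp

text \<open>The representatives \<open>g j\<close> are left free because in the completeness proof
  the derivatives of the limit are known as L2 limits and not as chosen weak derivatives.\<close>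

lemma H1_diff_square:
  assumes uv: "u \<in> H1 \<Omega>" "v \<in> H1 \<Omega>"
    and g: "\<And>j. AE x in lebesgue_on \<Omega>. weak_partial \<Omega> j v x = g j x" "\<And>j. g j \<in> L2 \<Omega>"
  shows "H1_inner \<Omega> (\<lambda>x. u x - v x) (\<lambda>x. u x - v x)
    = (\<Sum>j\<in>UNIV. L2_inner \<Omega> (\<lambda>x. weak_partial \<Omega> j u x - g j x) (\<lambda>x. weak_partial \<Omega> j u x - g j x))
      + L2_inner \<Omega> (\<lambda>x. u x - v x) (\<lambda>x. u x - v x)"
proof -
  have AE: "AE x in lebesgue_on \<Omega>. weak_partial \<Omega> j (\<lambda>x. u x - v x) x = weak_partial \<Omega> j u x - g j x" for j
    using H1_diff_weak_partial[OF uv, of j] g(1)[of j] by eventually_elim simp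
  have "L2_inner \<Omega> (weak_partial \<Omega> j (\<lambda>x. u x - v x)) (weak_partial \<Omega> j (\<lambda>x. u x - v x))
      = L2_inner \<Omega> (\<lambda>x. weak_partial \<Omega> j u x - g j x) (\<lambda>x. weak_partial \<Omega> j u x - g j x)" for j
    using uv g(2) by (intro L2_inner_cong_AE AE weak_partial_L2 H1.diff_closed L2.diff_closed)
  then show ?thesis
    by (simp add: H1_inner_expand H1.diff_closed uv)
qed

lemma L2_inner_self_nonneg: "0 \<le> L2_inner \<Omega> u (u :: R3 \<Rightarrow> 'c::euclidean_space)"
  by (simp add: L2_inner_def)

text \<open>The functions and their weak derivatives converge separately in L2. The identity
  defining weak derivatives pairs them with fixed test functions, so it survives in the limit and
  identifies the limits of the derivatives.\<close>

lemma H1_complete: "H1.B_complete"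
  unfolding H1.B_complete_def
proof safe
  fix s assume s': "\<forall>n. s n \<in> H1 \<Omega>" and Cauchy: "H1.B_Cauchy s"
  then have s: "s n \<in> H1 \<Omega>" for n by blast
  have expand: "H1_inner \<Omega> (\<lambda>x. s m x - s n x) (\<lambda>x. s m x - s n x)
      = (\<Sum>j\<in>UNIV. L2_inner \<Omega> (\<lambda>x. weak_partial \<Omega> j (s m) x - weak_partial \<Omega> j (s n) x)
          (\<lambda>x. weak_partial \<Omega> j (s m) x - weak_partial \<Omega> j (s n) x))
        + L2_inner \<Omega> (\<lambda>x. s m x - s n x) (\<lambda>x. s m x - s n x)" for m n
    using s by (intro H1_diff_square weak_partial_L2) auto
  have "L2.B_Cauchy \<Omega> s"
    unfolding L2.B_Cauchy_def
  proof (intro allI impI)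
    fix e :: real assume "0 < e"
    then obtain N where N: "\<And>m n. \<lbrakk>m \<ge> N; n \<ge> N\<rbrakk> \<Longrightarrow> H1_inner \<Omega> (\<lambda>x. s m x - s n x) (\<lambda>x. s m x - s n x) < e"
      using Cauchy unfolding H1.B_Cauchy_def by blast
    have "L2_inner \<Omega> (\<lambda>x. s m x - s n x) (\<lambda>x. s m x - s n x)
        \<le> H1_inner \<Omega> (\<lambda>x. s m x - s n x) (\<lambda>x. s m x - s n x)" for m n
      unfolding expand by (simp add: sum_nonneg L2_inner_self_nonneg)
    with N show "\<exists>N. \<forall>m\<ge>N. \<forall>n\<ge>N. L2_inner \<Omega> (\<lambda>x. s m x - s n x) (\<lambda>x. s m x - s n x) < e"
      by (meson order_le_less_trans)
  qed
  then obtain u where u: "u \<in> L2 \<Omega>"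
    and u_lim: "(\<lambda>n. L2_inner \<Omega> (\<lambda>x. s n x - u x) (\<lambda>x. s n x - u x)) \<longlonglongrightarrow> 0"
    using L2_complete[of \<Omega>] s H1_L2 unfolding L2.B_complete_def by blast
  have "\<exists>g\<in>L2 \<Omega>. (\<lambda>n. L2_inner \<Omega> (\<lambda>x. weak_partial \<Omega> j (s n) x - g x)
      (\<lambda>x. weak_partial \<Omega> j (s n) x - g x)) \<longlonglongrightarrow> 0" for j
  proof -
    have "L2.B_Cauchy \<Omega> (\<lambda>n. weak_partial \<Omega> j (s n))"
      unfolding L2.B_Cauchy_def
    proof (intro allI impI)
      fix e :: real assume "0 < e"
      then obtain N where N: "\<And>m n. \<lbrakk>m \<ge> N; n \<ge> N\<rbrakk> \<Longrightarrow> H1_inner \<Omega> (\<lambda>x. s m x - s n x) (\<lambda>x. s m x - s n x) < e"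
        using Cauchy unfolding H1.B_Cauchy_def by blast
      have "L2_inner \<Omega> (\<lambda>x. weak_partial \<Omega> j (s m) x - weak_partial \<Omega> j (s n) x)
          (\<lambda>x. weak_partial \<Omega> j (s m) x - weak_partial \<Omega> j (s n) x)
          \<le> H1_inner \<Omega> (\<lambda>x. s m x - s n x) (\<lambda>x. s m x - s n x)" for m n
        unfolding expand
        by (rule order_trans[OF member_le_sum[of j UNIV]]) (simp_all add: L2_inner_self_nonneg)
      with N show "\<exists>N. \<forall>m\<ge>N. \<forall>n\<ge>N. L2_inner \<Omega> (\<lambda>x. weak_partial \<Omega> j (s m) x - weak_partial \<Omega> j (s n) x)
          (\<lambda>x. weak_partial \<Omega> j (s m) x - weak_partial \<Omega> j (s n) x) < e"
        by (meson order_le_less_trans)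
    qed
    then show ?thesis
      using L2_complete[of \<Omega>, unfolded L2.B_complete_def, rule_format, of "\<lambda>n. weak_partial \<Omega> j (s n)"]
        weak_partial_L2[OF s] by simp
  qed
  then have "\<forall>j. \<exists>g. g \<in> L2 \<Omega> \<and> (\<lambda>n. L2_inner \<Omega> (\<lambda>x. weak_partial \<Omega> j (s n) x - g x)
      (\<lambda>x. weak_partial \<Omega> j (s n) x - g x)) \<longlonglongrightarrow> 0"
    by blast
  from choice[OF this] obtain g where g: "\<And>j. g j \<in> L2 \<Omega>" and g_lim: "\<And>j. (\<lambda>n. L2_inner \<Omega>
      (\<lambda>x. weak_partial \<Omega> j (s n) x - g j x) (\<lambda>x. weak_partial \<Omega> j (s n) x - g j x)) \<longlonglongrightarrow> 0"
    by blast
  have density: "has_L2_density \<Omega> (dist_partial j (regular \<Omega> u)) (g j)" for j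
    unfolding has_L2_density_def
  proof (intro conjI ballI g)
    fix \<phi> assume \<phi>: "\<phi> \<in> test_functions \<Omega>"
    have "(\<lambda>n. L2_inner \<Omega> (weak_partial \<Omega> j (s n)) \<phi>) \<longlonglongrightarrow> L2_inner \<Omega> (g j) \<phi>"
      by (rule L2.tendsto_B[OF weak_partial_L2[OF s] g test_L2[OF \<phi>] g_lim])
    moreover have "(\<lambda>n. - L2_inner \<Omega> (s n) (partial j \<phi>)) \<longlonglongrightarrow> - L2_inner \<Omega> u (partial j \<phi>)"
      by (intro tendsto_minus
          L2.tendsto_B[OF H1_L2[OF s] u test_L2[OF test_functions_partial[OF \<phi>]] u_lim])
    ultimately have "- L2_inner \<Omega> u (partial j \<phi>) = L2_inner \<Omega> (g j) \<phi>"
      unfolding H1_weak_partial_test[OF s \<phi>] by (rule LIMSEQ_unique[rotated])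
    then show "dist_partial j (regular \<Omega> u) \<phi> = regular \<Omega> (g j) \<phi>"
      by (simp add: dist_partial_def regular_eq_L2_inner)
  qed
  have u_H1: "u \<in> H1 \<Omega>"
    by (rule H1I[OF u density])
  have "(\<lambda>n. H1_inner \<Omega> (\<lambda>x. s n x - u x) (\<lambda>x. s n x - u x)) \<longlonglongrightarrow> (\<Sum>j\<in>(UNIV::3 set). 0) + 0"
    unfolding H1_diff_square[OF s u_H1 weak_partial_eq[OF density] g]
    by (intro tendsto_add tendsto_sum g_lim u_lim)
  with u_H1 show "\<exists>u\<in>H1 \<Omega>. (\<lambda>n. H1_inner \<Omega> (\<lambda>x. s n x - u x) (\<lambda>x. s n x - u x)) \<longlonglongrightarrow> 0"
    by auto
qed

section \<open>Test functions in H1, their closure H10 and the exchange of derivatives\<close>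

lemma test_weak_partial:
  assumes "\<phi> \<in> test_functions \<Omega>"
  shows "has_L2_density \<Omega> (dist_partial j (regular \<Omega> \<phi>)) (partial j \<phi>)"
  using test_function_integration_by_parts[OF open_domain assms, of _ j]
    test_L2[OF test_functions_partial[OF assms]]
  by (simp add: has_L2_density_def dist_partial_def regular_def)

lemma test_H1: "\<phi> \<in> test_functions \<Omega> \<Longrightarrow> \<phi> \<in> H1 \<Omega>"
  by (rule H1I[OF test_L2 test_weak_partial])

lemma H10_iff:
  "u \<in> H10 \<Omega> \<longleftrightarrow> u \<in> H1 \<Omega> \<and>
    (\<forall>e>0. \<exists>\<phi>\<in>test_functions \<Omega>. H1_inner \<Omega> (\<lambda>x. u x - \<phi> x) (\<lambda>x. u x - \<phi> x) < e)" (is "_ \<longleftrightarrow> ?R")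
proof
  assume u: "u \<in> H10 \<Omega>"
  have "\<exists>\<phi>\<in>test_functions \<Omega>. H1_inner \<Omega> (\<lambda>x. u x - \<phi> x) (\<lambda>x. u x - \<phi> x) < e" if "0 < e" for e
  proof -
    have "0 < sqrt e" using that by simp
    then obtain \<phi> where "\<phi> \<in> test_functions \<Omega>" "H1_norm \<Omega> (\<lambda>x. u x - \<phi> x) < sqrt e"
      using u unfolding H10_def by blast
    then show ?thesis by (intro bexI[of _ \<phi>]) (simp_all add: H1_norm_def)
  qed
  with u show ?R by (simp add: H10_def)
next
  assume R: ?R
  have "\<exists>\<phi>\<in>test_functions \<Omega>. H1_norm \<Omega> (\<lambda>x. u x - \<phi> x) < e" if "0 < e" for e
  proof -
    have "0 < e\<^sup>2" using that by simp
    then obtain \<phi> where \<phi>: "\<phi> \<in> test_functions \<Omega>" "H1_inner \<Omega> (\<lambda>x. u x - \<phi> x) (\<lambda>x. u x - \<phi> x) < e\<^sup>2"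
      using R by blast
    then have "H1_norm \<Omega> (\<lambda>x. u x - \<phi> x) < e"
      unfolding H1_norm_def using that by (intro real_less_lsqrt) auto
    with \<phi>(1) show ?thesis by blast
  qed
  with R show "u \<in> H10 \<Omega>" by (simp add: H10_def)
qed

lemma H10_H1: "u \<in> H10 \<Omega> \<Longrightarrow> u \<in> H1 \<Omega>"
  by (simp add: H10_def)

lemma H10_closed:
  assumes u: "u \<in> H1 \<Omega>"
    and "\<And>e. 0 < e \<Longrightarrow> \<exists>v\<in>H10 \<Omega>. H1_inner \<Omega> (\<lambda>x. u x - v x) (\<lambda>x. u x - v x) < e"
  shows "u \<in> H10 \<Omega>"
  unfolding H10_iff
proof (intro conjI u allI impI)
  fix e :: real assume "0 < e"
  \<comment> \<open>Two errors below \<open>e / 4\<close>, each doubled by the triangle inequality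
    for squares, add up to less than \<open>e\<close>.\<close>
  then obtain v where v: "v \<in> H10 \<Omega>" "H1_inner \<Omega> (\<lambda>x. u x - v x) (\<lambda>x. u x - v x) < e / 4"
    using assms(2)[of "e / 4"] by auto
  then obtain \<phi> where \<phi>: "\<phi> \<in> test_functions \<Omega>" "H1_inner \<Omega> (\<lambda>x. v x - \<phi> x) (\<lambda>x. v x - \<phi> x) < e / 4"
    using \<open>0 < e\<close> unfolding H10_iff by (meson divide_pos_pos zero_less_numeral)
  have "H1_inner \<Omega> (\<lambda>x. u x - \<phi> x) (\<lambda>x. u x - \<phi> x) < e"
    using H1.B_diff_square_triangle[OF u H10_H1[OF v(1)] test_H1[OF \<phi>(1)]] v(2) \<phi>(2) by linarith
  with \<phi>(1) show "\<exists>\<phi>\<in>test_functions \<Omega>. H1_inner \<Omega> (\<lambda>x. u x - \<phi> x) (\<lambda>x. u x - \<phi> x) < e" by blast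
qed

lemma H10_comb:
  assumes u: "u \<in> H10 \<Omega>" and v: "v \<in> H10 \<Omega>"
  shows "(\<lambda>x. a * u x + b * v x) \<in> H10 \<Omega>"
  unfolding H10_iff
proof (intro conjI allI impI)
  show "(\<lambda>x. a * u x + b * v x) \<in> H1 \<Omega>"
    using u v by (intro H1_comb H10_H1)
  fix e :: real assume "0 < e"
  \<comment> \<open>Chosen to absorb the bound \<open>2 * a^2 * d + 2 * b^2 * d\<close> obtained
    below; the added 1 covers \<open>a = b = 0\<close>.\<close>
  define d where "d = e / (4 * (a\<^sup>2 + b\<^sup>2 + 1))"
  have pos: "0 < a\<^sup>2 + b\<^sup>2 + 1" by (simp add: add_nonneg_pos)
  then have "0 < d" using \<open>0 < e\<close> by (simp add: d_def)
  then obtain \<phi> \<psi> where \<phi>: "\<phi> \<in> test_functions \<Omega>" "H1_inner \<Omega> (\<lambda>x. u x - \<phi> x) (\<lambda>x. u x - \<phi> x) < d"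
    and \<psi>: "\<psi> \<in> test_functions \<Omega>" "H1_inner \<Omega> (\<lambda>x. v x - \<psi> x) (\<lambda>x. v x - \<psi> x) < d"
    using u v unfolding H10_iff by meson
  define p q where "p = (\<lambda>x. u x - \<phi> x)" and "q = (\<lambda>x. v x - \<psi> x)"
  have pq: "p \<in> H1 \<Omega>" "q \<in> H1 \<Omega>"
    unfolding p_def q_def
    by (rule H1.diff_closed[OF H10_H1[OF u] test_H1[OF \<phi>(1)]])
      (rule H1.diff_closed[OF H10_H1[OF v] test_H1[OF \<psi>(1)]])
  have eq: "(\<lambda>x. a * u x + b * v x - (a * \<phi> x + b * \<psi> x)) = (\<lambda>x. a *\<^sub>R p x + b *\<^sub>R q x)"
    by (auto simp: p_def q_def algebra_simps)
  \<comment> \<open>Flipping the sign of \<open>b\<close> bounds the mixed term of the combination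
    by its two squares.\<close>
  have "0 \<le> a\<^sup>2 * H1_inner \<Omega> p p + 2 * a * (- b) * H1_inner \<Omega> p q + (- b)\<^sup>2 * H1_inner \<Omega> q q"
    using H1.B_nonneg[OF H1.comb[OF pq, of a "- b"]] unfolding H1.B_comb_square[OF pq] .
  then have "H1_inner \<Omega> (\<lambda>x. a *\<^sub>R p x + b *\<^sub>R q x) (\<lambda>x. a *\<^sub>R p x + b *\<^sub>R q x)
      \<le> 2 * a\<^sup>2 * H1_inner \<Omega> p p + 2 * b\<^sup>2 * H1_inner \<Omega> q q"
    unfolding H1.B_comb_square[OF pq] by (simp add: algebra_simps)
  also have "\<dots> \<le> 2 * a\<^sup>2 * d + 2 * b\<^sup>2 * d"
    using \<phi>(2) \<psi>(2) by (intro add_mono mult_left_mono) (auto simp: p_def q_def)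
  also have "\<dots> < 4 * (a\<^sup>2 + b\<^sup>2 + 1) * d"
    using \<open>0 < d\<close> by (simp add: algebra_simps add_pos_nonneg add_nonneg_pos)
  also have "\<dots> = e" using pos by (simp add: d_def)
  finally show "\<exists>\<phi>\<in>test_functions \<Omega>. H1_inner \<Omega> (\<lambda>x. a * u x + b * v x - \<phi> x)
      (\<lambda>x. a * u x + b * v x - \<phi> x) < e"
    unfolding eq[symmetric] by (rule bexI[OF _ test_functions_comb[OF \<phi>(1) \<psi>(1)]])
qed

lemma L2_norm_weak_partial_le:
  assumes "u \<in> H1 \<Omega>"
  shows "L2_inner \<Omega> (weak_partial \<Omega> j u) (weak_partial \<Omega> j u) \<le> H1_inner \<Omega> u u"
  unfolding H1_inner_expand[OF assms assms]
  by (rule order_trans[OF member_le_sum[of j UNIV]]) (simp_all add: L2_inner_self_nonneg)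

text \<open>For a test function \<open>v\<close> both sides equal \<open>- \<integral> u \<partial>\<^sub>i \<partial>\<^sub>j v\<close> by the definition of the weak
  derivatives of \<open>u\<close>.\<close>

lemma weak_partial_swap:
  assumes u: "u \<in> H1 \<Omega>" and v: "v \<in> H10 \<Omega>"
  shows "L2_inner \<Omega> (weak_partial \<Omega> j u) (weak_partial \<Omega> i v)
    = L2_inner \<Omega> (weak_partial \<Omega> i u) (weak_partial \<Omega> j v)"
proof -
  note uL = weak_partial_L2[OF u]
  \<comment> \<open>The defect of the claim as a functional of \<open>v\<close>: it is bounded in
    the H1 norm and unchanged when a test function is subtracted, hence zero on the closure.\<close>
  define D where "D v = L2_inner \<Omega> (weak_partial \<Omega> j u) (weak_partial \<Omega> i v)
    - L2_inner \<Omega> (weak_partial \<Omega> i u) (weak_partial \<Omega> j v)" for v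
  define K where "K = sqrt (L2_inner \<Omega> (weak_partial \<Omega> j u) (weak_partial \<Omega> j u))
    + sqrt (L2_inner \<Omega> (weak_partial \<Omega> i u) (weak_partial \<Omega> i u))"
  have "0 \<le> K" by (simp add: K_def L2_inner_self_nonneg)
  have D_bound: "\<bar>D w\<bar> \<le> K * sqrt (H1_inner \<Omega> w w)" if w: "w \<in> H1 \<Omega>" for w
  proof -
    have "\<bar>L2_inner \<Omega> (weak_partial \<Omega> k u) (weak_partial \<Omega> l w)\<bar>
        \<le> sqrt (L2_inner \<Omega> (weak_partial \<Omega> k u) (weak_partial \<Omega> k u)) * sqrt (H1_inner \<Omega> w w)" for k l
      using w by (intro order_trans[OF L2.Cauchy_Schwarz[OF uL weak_partial_L2]] mult_left_mono)
        (auto simp: L2_norm_weak_partial_le L2_inner_self_nonneg)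
    from this[of j i] this[of i j] show ?thesis
      unfolding D_def K_def distrib_right by linarith
  qed
  have D_diff: "D (\<lambda>x. v x - \<phi> x) = D v" if \<phi>: "\<phi> \<in> test_functions \<Omega>" for \<phi>
  proof -
    have "L2_inner \<Omega> (weak_partial \<Omega> k u) (weak_partial \<Omega> l (\<lambda>x. v x - \<phi> x))
        = L2_inner \<Omega> (weak_partial \<Omega> k u) (weak_partial \<Omega> l v) + L2_inner \<Omega> u (partial k (partial l \<phi>))" for k l
    proof -
      note vH = H10_H1[OF v] and \<phi>H = test_H1[OF \<phi>] and \<phi>l = test_functions_partial[OF \<phi>, of l]
      have "AE x in lebesgue_on \<Omega>. weak_partial \<Omega> l (\<lambda>x. v x - \<phi> x) x = weak_partial \<Omega> l v x - partial l \<phi> x"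
        using H1_diff_weak_partial[OF vH \<phi>H, of l] weak_partial_eq[OF test_weak_partial[OF \<phi>, of l]]
        by eventually_elim simp
      then have "L2_inner \<Omega> (weak_partial \<Omega> k u) (weak_partial \<Omega> l (\<lambda>x. v x - \<phi> x))
          = L2_inner \<Omega> (weak_partial \<Omega> k u) (\<lambda>x. weak_partial \<Omega> l v x - partial l \<phi> x)"
        by (intro L2_inner_cong_AE uL weak_partial_L2 H1.diff_closed L2.diff_closed vH \<phi>H test_L2 \<phi>l) auto
      also have "\<dots> = L2_inner \<Omega> (weak_partial \<Omega> k u) (weak_partial \<Omega> l v)
          - L2_inner \<Omega> (weak_partial \<Omega> k u) (partial l \<phi>)"
        by (rule L2.B_diff_right[OF weak_partial_L2[OF vH] test_L2[OF \<phi>l] uL])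
      finally show ?thesis by (simp add: H1_weak_partial_test[OF u \<phi>l])
    qed
    then show ?thesis
      by (simp add: D_def test_function_partial_commute[OF \<phi>, of i j])
  qed
  have "\<bar>D v\<bar> \<le> e" if "0 < e" for e
  proof -
    \<comment> \<open>\<open>K + 1\<close> in place of \<open>K\<close> avoids dividing by zero when
      both derivatives of \<open>u\<close> have norm zero.\<close>
    have "0 < (e / (K + 1))\<^sup>2" using that \<open>0 \<le> K\<close> by simp
    then obtain \<phi> where \<phi>: "\<phi> \<in> test_functions \<Omega>"
      "H1_inner \<Omega> (\<lambda>x. v x - \<phi> x) (\<lambda>x. v x - \<phi> x) < (e / (K + 1))\<^sup>2"
      using v unfolding H10_iff by blast
    have "\<bar>D v\<bar> \<le> K * sqrt (H1_inner \<Omega> (\<lambda>x. v x - \<phi> x) (\<lambda>x. v x - \<phi> x))"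
      using D_bound[OF H1.diff_closed[OF H10_H1[OF v] test_H1[OF \<phi>(1)]]] D_diff[OF \<phi>(1)] by simp
    also have "\<dots> \<le> K * (e / (K + 1))"
      using \<phi>(2) that \<open>0 \<le> K\<close> by (intro mult_left_mono real_le_lsqrt) auto
    also have "\<dots> \<le> e" using that \<open>0 \<le> K\<close> by (simp add: field_simps)
    finally show ?thesis .
  qed
  then have "\<bar>D v\<bar> \<le> 0" by (rule field_le_epsilon) simp
  then show ?thesis by (simp add: D_def)
qed

end

section \<open>Vector fields\<close>

text \<open>Serves for \<open>H10 \<Omega>\<close> inside \<open>H1 \<Omega>\<close> and for
  \<open>H10_div_free \<Omega>\<close> inside \<open>H10_vec \<Omega>\<close>. Closedness concerns
  only limits in \<open>X\<close>, whose existence comes from the completeness of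
  \<open>X\<close>.\<close>

lemma (in semi_inner_space) complete_subset:
  assumes "semi_inner_space Y B" and complete: B_complete and "Y \<subseteq> X"
    and closed: "\<And>s u. \<lbrakk>\<And>n. s n \<in> Y; u \<in> X;
      (\<lambda>n. B (\<lambda>x. s n x - u x) (\<lambda>x. s n x - u x)) \<longlonglongrightarrow> 0\<rbrakk> \<Longrightarrow> u \<in> Y"
  shows "semi_inner_space.B_complete Y B"
proof -
  interpret Y: semi_inner_space Y B by fact
  show ?thesis
    unfolding Y.B_complete_def
  proof safe
    fix s assume s: "\<forall>n. s n \<in> Y" and "Y.B_Cauchy s"
    then have "B_Cauchy s" unfolding B_Cauchy_def Y.B_Cauchy_def by blast
    then obtain u where "u \<in> X" "(\<lambda>n. B (\<lambda>x. s n x - u x) (\<lambda>x. s n x - u x)) \<longlonglongrightarrow> 0"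
      using complete s \<open>Y \<subseteq> X\<close> unfolding B_complete_def by blast
    with closed s show "\<exists>u\<in>Y. (\<lambda>n. B (\<lambda>x. s n x - u x) (\<lambda>x. s n x - u x)) \<longlonglongrightarrow> 0" by blast
  qed
qed

lemma (in semi_inner_space) subspace_semi_inner_space:
  assumes "Y \<subseteq> X" "Y \<noteq> {}" "\<And>u v a b. \<lbrakk>u \<in> Y; v \<in> Y\<rbrakk> \<Longrightarrow> (\<lambda>x. a *\<^sub>R u x + b *\<^sub>R v x) \<in> Y"
  shows "semi_inner_space Y B"
proof
  show "Y \<noteq> {}" by fact
qed (use assms in \<open>auto simp: B_comb B_nonneg subset_iff intro: B_sym\<close>)

section \<open>H10 and its vector-valued version; densities of divergence and curl\<close>

context open_domain
begin

lemma zero_H10: "(\<lambda>x. 0) \<in> H10 \<Omega>"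
proof -
  have "\<And>js. foldr partial js (\<lambda>x. 0) = (\<lambda>x. 0)"
  proof -
    fix js show "foldr partial js (\<lambda>x. 0) = (\<lambda>x. 0)"
      using partial_eq_0[of UNIV _ "\<lambda>x. 0"] by (induction js) auto
  qed
  then have test: "(\<lambda>x. 0) \<in> test_functions \<Omega>"
    by (simp add: test_functions_def smooth_def)
  have "H1_inner \<Omega> (\<lambda>x. 0) (\<lambda>x. 0) = 0"
    using H1.B_diff_square[OF test_H1[OF test] test_H1[OF test]] by simp
  then have "\<exists>\<phi>\<in>test_functions \<Omega>. H1_inner \<Omega> (\<lambda>x. 0 - \<phi> x) (\<lambda>x. 0 - \<phi> x) < e" if "0 < e" for e
    using that test by (intro bexI[of _ "\<lambda>x. 0"]) simp_all
  with test_H1[OF test] show ?thesis unfolding H10_iff by blast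
qed

sublocale H10: semi_inner_space "H10 \<Omega>" "H1_inner \<Omega>"
proof (rule H1.subspace_semi_inner_space)
  show "H10 \<Omega> \<subseteq> H1 \<Omega>" using H10_H1 by blast
  show "H10 \<Omega> \<noteq> {}" using zero_H10 by blast
  show "(\<lambda>x. a *\<^sub>R u x + b *\<^sub>R v x) \<in> H10 \<Omega>" if "u \<in> H10 \<Omega>" "v \<in> H10 \<Omega>" for u v a b
    using H10_comb[OF that] by simp
qed

lemma H10_complete: "H10.B_complete"
proof (rule H1.complete_subset)
  show "semi_inner_space (H10 \<Omega>) (H1_inner \<Omega>)" ..
  show "H10 \<Omega> \<subseteq> H1 \<Omega>" using H10_H1 by blast
  fix s u assume s: "\<And>n. s n \<in> H10 \<Omega>" and u: "u \<in> H1 \<Omega>"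
    and lim: "(\<lambda>n. H1_inner \<Omega> (\<lambda>x. s n x - u x) (\<lambda>x. s n x - u x)) \<longlonglongrightarrow> 0"
  show "u \<in> H10 \<Omega>"
  proof (rule H10_closed[OF u])
    fix e :: real assume "0 < e"
    then obtain n where "H1_inner \<Omega> (\<lambda>x. s n x - u x) (\<lambda>x. s n x - u x) < e"
      using eventually_happens[OF order_tendstoD(2)[OF lim \<open>0 < e\<close>]] by auto
    moreover have "H1_inner \<Omega> (\<lambda>x. s n x - u x) (\<lambda>x. s n x - u x)
        = H1_inner \<Omega> (\<lambda>x. u x - s n x) (\<lambda>x. u x - s n x)"
      using H10_H1[OF s] u by (simp add: H1.B_diff_square H1.B_sym)
    ultimately show "\<exists>v\<in>H10 \<Omega>. H1_inner \<Omega> (\<lambda>x. u x - v x) (\<lambda>x. u x - v x) < e"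
      using s by (intro bexI[of _ "s n"]) simp_all
  qed
qed (rule H1_complete)

lemma H10_vec_component: "u \<in> H10_vec \<Omega> \<Longrightarrow> (\<lambda>x. u x $ i) \<in> H10 \<Omega>"
  by (simp add: H10_vec_def)

lemma H10_vec_H1: "u \<in> H10_vec \<Omega> \<Longrightarrow> (\<lambda>x. u x $ i) \<in> H1 \<Omega>"
  by (rule H10_H1[OF H10_vec_component])

lemma L2_inner_componentwise:
  fixes u v :: vector_field
  assumes "\<And>i. (\<lambda>x. u x $ i) \<in> L2 \<Omega>" "\<And>i. (\<lambda>x. v x $ i) \<in> L2 \<Omega>"
  shows "L2_inner \<Omega> u v = (\<Sum>i\<in>UNIV. L2_inner \<Omega> (\<lambda>x. u x $ i) (\<lambda>x. v x $ i))"
proof -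
  have "L2_inner \<Omega> u v = (LINT x|lebesgue_on \<Omega>. (\<Sum>i\<in>UNIV. u x $ i * v x $ i))"
    by (simp add: L2_inner_def inner_vec_def)
  also have "\<dots> = (\<Sum>i\<in>UNIV. L2_inner \<Omega> (\<lambda>x. u x $ i) (\<lambda>x. v x $ i))"
    unfolding L2_inner_real using assms
    by (intro Bochner_Integration.integral_sum L2_integrable_mult)
  finally show ?thesis .
qed

lemma L2_inner_weak_jacobian:
  assumes u: "u \<in> H10_vec \<Omega>" and v: "v \<in> H10_vec \<Omega>"
  shows "L2_inner \<Omega> (weak_jacobian \<Omega> u) (weak_jacobian \<Omega> v)
    = (\<Sum>i\<in>UNIV. \<Sum>j\<in>UNIV. L2_inner \<Omega> (weak_partial \<Omega> j (\<lambda>x. u x $ i)) (weak_partial \<Omega> j (\<lambda>x. v x $ i)))"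
proof -
  note L = weak_partial_L2[OF H10_vec_H1[OF u]] weak_partial_L2[OF H10_vec_H1[OF v]]
  have "L2_inner \<Omega> (weak_jacobian \<Omega> u) (weak_jacobian \<Omega> v)
      = (LINT x|lebesgue_on \<Omega>. (\<Sum>i\<in>UNIV. \<Sum>j\<in>UNIV.
          weak_partial \<Omega> j (\<lambda>x. u x $ i) x * weak_partial \<Omega> j (\<lambda>x. v x $ i) x))"
    by (simp add: L2_inner_def weak_jacobian_def inner_vec_def)
  also have "\<dots> = (\<Sum>i\<in>UNIV. \<Sum>j\<in>UNIV. LINT x|lebesgue_on \<Omega>.
      weak_partial \<Omega> j (\<lambda>x. u x $ i) x * weak_partial \<Omega> j (\<lambda>x. v x $ i) x)"
    using L by (simp add: Bochner_Integration.integral_sum Bochner_Integration.integrable_sum L2_integrable_mult)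
  finally show ?thesis by (simp add: L2_inner_real)
qed

text \<open>Row \<open>i\<close> of the Jacobian is the gradient of component \<open>i\<close>, so
  questions about vector fields reduce to the scalar space.\<close>

lemma H1_vec_inner_expand:
  assumes u: "u \<in> H10_vec \<Omega>" and v: "v \<in> H10_vec \<Omega>"
  shows "H1_vec_inner \<Omega> u v = (\<Sum>i\<in>UNIV. H1_inner \<Omega> (\<lambda>x. u x $ i) (\<lambda>x. v x $ i))"
  unfolding H1_vec_inner_def L2_inner_weak_jacobian[OF u v]
    L2_inner_componentwise[OF H1_L2[OF H10_vec_H1[OF u]] H1_L2[OF H10_vec_H1[OF v]]]
    H1_inner_expand[OF H10_vec_H1[OF u] H10_vec_H1[OF v]] sum.distrib ..

sublocale H10_vec: semi_inner_space "H10_vec \<Omega>" "H1_vec_inner \<Omega>"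
proof
  have "(\<lambda>x. 0) \<in> H10_vec \<Omega>" by (simp add: H10_vec_def zero_H10)
  then show "H10_vec \<Omega> \<noteq> {}" by blast
next
  fix u v w :: vector_field and a b :: real
  assume u: "u \<in> H10_vec \<Omega>" and v: "v \<in> H10_vec \<Omega>"
  show comb: "(\<lambda>x. a *\<^sub>R u x + b *\<^sub>R v x) \<in> H10_vec \<Omega>"
    using H10_comb[OF H10_vec_component[OF u] H10_vec_component[OF v]] by (simp add: H10_vec_def)
  assume w: "w \<in> H10_vec \<Omega>"
  have "H1_inner \<Omega> (\<lambda>x. a * u x $ i + b * v x $ i) (\<lambda>x. w x $ i)
      = a * H1_inner \<Omega> (\<lambda>x. u x $ i) (\<lambda>x. w x $ i) + b * H1_inner \<Omega> (\<lambda>x. v x $ i) (\<lambda>x. w x $ i)" for i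
    using H1.B_comb[OF H10_vec_H1[OF u] H10_vec_H1[OF v] H10_vec_H1[OF w], of a i b i i] by simp
  then show "H1_vec_inner \<Omega> (\<lambda>x. a *\<^sub>R u x + b *\<^sub>R v x) w
      = a * H1_vec_inner \<Omega> u w + b * H1_vec_inner \<Omega> v w"
    by (simp add: H1_vec_inner_expand[OF comb w] H1_vec_inner_expand[OF u w] H1_vec_inner_expand[OF v w]
        sum.distrib sum_distrib_left)
next
  fix u v :: vector_field
  show "H1_vec_inner \<Omega> u v = H1_vec_inner \<Omega> v u"
    by (simp add: H1_vec_inner_def L2_inner_def inner_commute)
  show "0 \<le> H1_vec_inner \<Omega> u u"
    by (simp add: H1_vec_inner_def L2_inner_def)
qed

lemma H10_vec_diff_component_le:
  assumes u: "u \<in> H10_vec \<Omega>" and v: "v \<in> H10_vec \<Omega>"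
  shows "H1_inner \<Omega> (\<lambda>x. u x $ i - v x $ i) (\<lambda>x. u x $ i - v x $ i)
    \<le> H1_vec_inner \<Omega> (\<lambda>x. u x - v x) (\<lambda>x. u x - v x)"
proof -
  note uv = H10_vec.diff_closed[OF u v]
  have "H1_inner \<Omega> (\<lambda>x. (u x - v x) $ i) (\<lambda>x. (u x - v x) $ i)
      \<le> H1_vec_inner \<Omega> (\<lambda>x. u x - v x) (\<lambda>x. u x - v x)"
    unfolding H1_vec_inner_expand[OF uv uv]
    by (rule member_le_sum[where f = "\<lambda>i. H1_inner \<Omega> (\<lambda>x. (u x - v x) $ i) (\<lambda>x. (u x - v x) $ i)"])
      (use H1.B_nonneg[OF H10_vec_H1[OF uv]] in auto)
  then show ?thesis by simp
qed

lemma H10_vec_complete: "H10_vec.B_complete"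
  unfolding H10_vec.B_complete_def
proof safe
  fix s assume s': "\<forall>n. s n \<in> H10_vec \<Omega>" and Cauchy: "H10_vec.B_Cauchy s"
  then have s: "s n \<in> H10_vec \<Omega>" for n by blast
  have "\<exists>u. u \<in> H10 \<Omega> \<and>
    (\<lambda>n. H1_inner \<Omega> (\<lambda>x. s n x $ i - u x) (\<lambda>x. s n x $ i - u x)) \<longlonglongrightarrow> 0" for i
  proof -
    have "H10.B_Cauchy (\<lambda>n x. s n x $ i)"
      unfolding H10.B_Cauchy_def
    proof (intro allI impI)
      fix e :: real assume "0 < e"
      then obtain N where "\<And>m n. \<lbrakk>m \<ge> N; n \<ge> N\<rbrakk> \<Longrightarrow> H1_vec_inner \<Omega> (\<lambda>x. s m x - s n x) (\<lambda>x. s m x - s n x) < e"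
        using Cauchy unfolding H10_vec.B_Cauchy_def by blast
      then show "\<exists>N. \<forall>m\<ge>N. \<forall>n\<ge>N.
          H1_inner \<Omega> (\<lambda>x. s m x $ i - s n x $ i) (\<lambda>x. s m x $ i - s n x $ i) < e"
        using H10_vec_diff_component_le[OF s s] by (meson order_le_less_trans)
    qed
    then show ?thesis
      using H10_complete[unfolded H10.B_complete_def, rule_format, of "\<lambda>n x. s n x $ i"]
        H10_vec_component[OF s] by auto
  qed
  then have "\<forall>i. \<exists>u. u \<in> H10 \<Omega> \<and>
    (\<lambda>n. H1_inner \<Omega> (\<lambda>x. s n x $ i - u x) (\<lambda>x. s n x $ i - u x)) \<longlonglongrightarrow> 0" by blast
  from choice[OF this] obtain u where u: "\<And>i. u i \<in> H10 \<Omega>"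
    and lim: "\<And>i. (\<lambda>n. H1_inner \<Omega> (\<lambda>x. s n x $ i - u i x) (\<lambda>x. s n x $ i - u i x)) \<longlonglongrightarrow> 0"
    by blast
  define v :: vector_field where "v x = (\<chi> i. u i x)" for x
  have v: "v \<in> H10_vec \<Omega>" using u by (simp add: H10_vec_def v_def)
  have "(\<lambda>n. H1_vec_inner \<Omega> (\<lambda>x. s n x - v x) (\<lambda>x. s n x - v x)) \<longlonglongrightarrow> (\<Sum>i\<in>(UNIV::3 set). 0)"
    unfolding H1_vec_inner_expand[OF H10_vec.diff_closed[OF s v] H10_vec.diff_closed[OF s v]]
    by (intro tendsto_sum) (use lim in \<open>simp add: v_def\<close>)
  with v show "\<exists>u\<in>H10_vec \<Omega>. (\<lambda>n. H1_vec_inner \<Omega> (\<lambda>x. s n x - u x) (\<lambda>x. s n x - u x)) \<longlonglongrightarrow> 0"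
    by auto
qed

text \<open>\<open>weak_div\<close> is a density of the whole distributional divergence, chosen
  without reference to the individual \<open>weak_partial\<close>s; uniqueness of densities links
  the two almost everywhere.\<close>

lemma weak_div_eq:
  assumes u: "\<And>i. (\<lambda>x. u x $ i) \<in> H1 \<Omega>"
  shows "weak_div \<Omega> u \<in> L2 \<Omega>" 
    "AE x in lebesgue_on \<Omega>. weak_div \<Omega> u x = weak_partial \<Omega> 1 (\<lambda>x. u x $ 1) x
      + weak_partial \<Omega> 2 (\<lambda>x. u x $ 2) x + weak_partial \<Omega> 3 (\<lambda>x. u x $ 3) x"
proof -
  \<comment> \<open>The factors 1 reproduce the shape delivered by
    \<open>has_L2_density_comb\<close>.\<close>
  have "has_L2_density \<Omega> (dist_div (regular_vec \<Omega> u)) (\<lambda>x. 1 * (1 * weak_partial \<Omega> 1 (\<lambda>x. u x $ 1) x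
      + 1 * weak_partial \<Omega> 2 (\<lambda>x. u x $ 2) x) + 1 * weak_partial \<Omega> 3 (\<lambda>x. u x $ 3) x)"
    by (rule has_L2_density_cong[OF has_L2_density_comb[OF has_L2_density_comb[OF
          H1_weak_partial[OF u] H1_weak_partial[OF u]] H1_weak_partial[OF u]]])
      (simp add: dist_div_def regular_vec_def sum_3)
  then have d: "has_L2_density \<Omega> (dist_div (regular_vec \<Omega> u)) (\<lambda>x. weak_partial \<Omega> 1 (\<lambda>x. u x $ 1) x
      + weak_partial \<Omega> 2 (\<lambda>x. u x $ 2) x + weak_partial \<Omega> 3 (\<lambda>x. u x $ 3) x)"
    by simp
  show "weak_div \<Omega> u \<in> L2 \<Omega>"
    unfolding weak_div_def using has_L2_density_L2_density[OF d] by (simp only: has_L2_density_def)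
  show "AE x in lebesgue_on \<Omega>. weak_div \<Omega> u x = weak_partial \<Omega> 1 (\<lambda>x. u x $ 1) x
      + weak_partial \<Omega> 2 (\<lambda>x. u x $ 2) x + weak_partial \<Omega> 3 (\<lambda>x. u x $ 3) x"
    unfolding weak_div_def by (rule has_L2_density_unique[OF open_domain has_L2_density_L2_density[OF d] d])
qed

text \<open>The hypothesis \<open>c\<close> abstracts from the case distinction in
  \<open>dist_curl\<close>, so one proof covers the three components.\<close>

lemma weak_curl_eq:
  assumes u: "\<And>i. (\<lambda>x. u x $ i) \<in> H1 \<Omega>"
    and c: "\<And>\<phi>. (dist_curl (regular_vec \<Omega> u) $ k) \<phi>
      = dist_partial i (regular \<Omega> (\<lambda>x. u x $ j)) \<phi> - dist_partial j (regular \<Omega> (\<lambda>x. u x $ i)) \<phi>"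
  shows "(\<lambda>x. weak_curl \<Omega> u x $ k) \<in> L2 \<Omega>"
    "AE x in lebesgue_on \<Omega>. weak_curl \<Omega> u x $ k
      = weak_partial \<Omega> i (\<lambda>x. u x $ j) x - weak_partial \<Omega> j (\<lambda>x. u x $ i) x"
proof -
  have "has_L2_density \<Omega> (dist_curl (regular_vec \<Omega> u) $ k)
      (\<lambda>x. 1 * weak_partial \<Omega> i (\<lambda>x. u x $ j) x + (- 1) * weak_partial \<Omega> j (\<lambda>x. u x $ i) x)"
    by (rule has_L2_density_cong[OF has_L2_density_comb[OF H1_weak_partial[OF u] H1_weak_partial[OF u]]])
      (simp add: c)
  then have d: "has_L2_density \<Omega> (dist_curl (regular_vec \<Omega> u) $ k)
      (\<lambda>x. weak_partial \<Omega> i (\<lambda>x. u x $ j) x - weak_partial \<Omega> j (\<lambda>x. u x $ i) x)"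
    by simp
  show "(\<lambda>x. weak_curl \<Omega> u x $ k) \<in> L2 \<Omega>"
    using has_L2_density_L2_density[OF d] by (simp add: weak_curl_def has_L2_density_def)
  show "AE x in lebesgue_on \<Omega>. weak_curl \<Omega> u x $ k
      = weak_partial \<Omega> i (\<lambda>x. u x $ j) x - weak_partial \<Omega> j (\<lambda>x. u x $ i) x"
    using has_L2_density_unique[OF open_domain has_L2_density_L2_density[OF d] d]
    by (simp add: weak_curl_def)
qed

end

section \<open>The curl-div identity, the bilinear forms and well-posedness\<close>

context open_domain
begin

lemma L2_inner_add:
  assumes "f \<in> L2 \<Omega>" "g \<in> L2 \<Omega>" "h \<in> L2 \<Omega>"
  shows "L2_inner \<Omega> (\<lambda>x. f x + g x) h = L2_inner \<Omega> f h + L2_inner \<Omega> g h"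
    "L2_inner \<Omega> h (\<lambda>x. f x + g x) = L2_inner \<Omega> h f + L2_inner \<Omega> h g"
  using L2.B_comb[OF assms, of 1 1] L2.B_comb_right[OF assms, of 1 1] by simp_all

lemma L2_add: "\<lbrakk>f \<in> L2 \<Omega>; g \<in> L2 \<Omega>\<rbrakk> \<Longrightarrow> (\<lambda>x. f x + g x) \<in> L2 \<Omega>"
  using L2_comb[of f \<Omega> g 1 1] by simp

text \<open>The products \<open>(\<partial>\<^sub>j u\<^sub>i, \<partial>\<^sub>i v\<^sub>j)\<close> occurring in the curl part cancel the products
  \<open>(\<partial>\<^sub>i u\<^sub>i, \<partial>\<^sub>j v\<^sub>j)\<close> of the divergence part.\<close>

lemma curl_div_form_eq_jacobian:
  assumes u: "u \<in> H10_vec \<Omega>" and v: "v \<in> H10_vec \<Omega>"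
  shows "curl_div_form \<Omega> u v = L2_inner \<Omega> (weak_jacobian \<Omega> u) (weak_jacobian \<Omega> v)"
proof -
  \<comment> \<open>The first index is the direction of differentiation, so this is the transpose of
    \<open>weak_jacobian\<close>.\<close>
  define U where "U i j = weak_partial \<Omega> i (\<lambda>x. u x $ j)" for i j
  define V where "V i j = weak_partial \<Omega> i (\<lambda>x. v x $ j)" for i j
  have U: "U i j \<in> L2 \<Omega>" and V: "V i j \<in> L2 \<Omega>" for i j
    using weak_partial_L2[OF H10_vec_H1[OF u]] weak_partial_L2[OF H10_vec_H1[OF v]]
    by (simp_all add: U_def V_def)
  have swap: "L2_inner \<Omega> (U i j) (V k l) = L2_inner \<Omega> (U k j) (V i l)" for i j k l
    unfolding U_def V_def by (rule weak_partial_swap[OF H10_vec_H1[OF u] H10_vec_component[OF v]])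
  have curl: "dist_curl (regular_vec \<Omega> w) $ 1 = (\<lambda>\<phi>. dist_partial 2 (regular \<Omega> (\<lambda>x. w x $ 3)) \<phi>
        - dist_partial 3 (regular \<Omega> (\<lambda>x. w x $ 2)) \<phi>)"
    "dist_curl (regular_vec \<Omega> w) $ 2 = (\<lambda>\<phi>. dist_partial 3 (regular \<Omega> (\<lambda>x. w x $ 1)) \<phi>
        - dist_partial 1 (regular \<Omega> (\<lambda>x. w x $ 3)) \<phi>)"
    "dist_curl (regular_vec \<Omega> w) $ 3 = (\<lambda>\<phi>. dist_partial 1 (regular \<Omega> (\<lambda>x. w x $ 2)) \<phi>
        - dist_partial 2 (regular \<Omega> (\<lambda>x. w x $ 1)) \<phi>)" for w :: vector_field
    by (simp_all add: dist_curl_def regular_vec_def)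
  have comp: "L2_inner \<Omega> (\<lambda>x. weak_curl \<Omega> u x $ k) (\<lambda>x. weak_curl \<Omega> v x $ k)
      = L2_inner \<Omega> (U i j) (V i j) - L2_inner \<Omega> (U j i) (V i j)
        - L2_inner \<Omega> (U i j) (V j i) + L2_inner \<Omega> (U j i) (V j i)"
      "(\<lambda>x. weak_curl \<Omega> u x $ k) \<in> L2 \<Omega>" "(\<lambda>x. weak_curl \<Omega> v x $ k) \<in> L2 \<Omega>"
    if c: "\<And>w. dist_curl (regular_vec \<Omega> w) $ k = (\<lambda>\<phi>. dist_partial i (regular \<Omega> (\<lambda>x. w x $ j)) \<phi>
        - dist_partial j (regular \<Omega> (\<lambda>x. w x $ i)) \<phi>)" for i j k
  proof -
    note cu = weak_curl_eq[OF H10_vec_H1[OF u] fun_cong[OF c]]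
      and cv = weak_curl_eq[OF H10_vec_H1[OF v] fun_cong[OF c]]
    show "(\<lambda>x. weak_curl \<Omega> u x $ k) \<in> L2 \<Omega>" "(\<lambda>x. weak_curl \<Omega> v x $ k) \<in> L2 \<Omega>"
      by (rule cu(1)) (rule cv(1))
    have "L2_inner \<Omega> (\<lambda>x. weak_curl \<Omega> u x $ k) (\<lambda>x. weak_curl \<Omega> v x $ k)
        = L2_inner \<Omega> (\<lambda>x. U i j x - U j i x) (\<lambda>x. V i j x - V j i x)"
      using cu(2) cv(2) unfolding U_def[symmetric] V_def[symmetric]
      by (intro L2_inner_cong_AE cu(1) cv(1) L2.diff_closed U V)
    then show "L2_inner \<Omega> (\<lambda>x. weak_curl \<Omega> u x $ k) (\<lambda>x. weak_curl \<Omega> v x $ k)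
        = L2_inner \<Omega> (U i j) (V i j) - L2_inner \<Omega> (U j i) (V i j)
          - L2_inner \<Omega> (U i j) (V j i) + L2_inner \<Omega> (U j i) (V j i)"
      by (simp add: L2.B_diff L2.B_diff_right L2.diff_closed U V)
  qed
  have "(\<lambda>x. weak_curl \<Omega> w x $ i) \<in> L2 \<Omega>" if "w = u \<or> w = v" for i w
    using that comp(2,3)[OF curl(1)] comp(2,3)[OF curl(2)] comp(2,3)[OF curl(3)] exhaust_3[of i]
    by auto
  then have curl_form: "L2_inner \<Omega> (weak_curl \<Omega> u) (weak_curl \<Omega> v)
      = (\<Sum>k\<in>UNIV. L2_inner \<Omega> (\<lambda>x. weak_curl \<Omega> u x $ k) (\<lambda>x. weak_curl \<Omega> v x $ k))"
    by (intro L2_inner_componentwise) auto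
  note du = weak_div_eq[OF H10_vec_H1[OF u]] and dv = weak_div_eq[OF H10_vec_H1[OF v]]
  have "L2_inner \<Omega> (weak_div \<Omega> u) (weak_div \<Omega> v)
      = L2_inner \<Omega> (\<lambda>x. U 1 1 x + U 2 2 x + U 3 3 x) (\<lambda>x. V 1 1 x + V 2 2 x + V 3 3 x)"
    using du(2) dv(2) unfolding U_def[symmetric] V_def[symmetric]
    by (intro L2_inner_cong_AE du(1) dv(1) L2_add U V)
  also have "\<dots> = (\<Sum>i\<in>UNIV. \<Sum>j\<in>UNIV. L2_inner \<Omega> (U i i) (V j j))"
    by (simp add: L2_inner_add L2_add U V sum_3)
  finally have div_form: "L2_inner \<Omega> (weak_div \<Omega> u) (weak_div \<Omega> v)
      = (\<Sum>i\<in>UNIV. \<Sum>j\<in>UNIV. L2_inner \<Omega> (U i i) (V j j))" .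
  show ?thesis
    unfolding curl_div_form_def curl_form div_form L2_inner_weak_jacobian[OF u v]
      U_def[symmetric] V_def[symmetric] sum_3 comp(1)[OF curl(1)] comp(1)[OF curl(2)] comp(1)[OF curl(3)]
    \<comment> \<open>One exchange for each ordered pair of distinct indices. The curl keeps the six
      off-diagonal products of the Jacobian and the divergence its three diagonal ones.\<close>
    using swap[of 1 1 2 2] swap[of 1 1 3 3] swap[of 2 2 1 1] swap[of 2 2 3 3] swap[of 3 3 1 1]
      swap[of 3 3 2 2] by linarith
qed

lemma curl_div_form_eq_H1:
  "\<lbrakk>u \<in> H10_vec \<Omega>; v \<in> H10_vec \<Omega>\<rbrakk> \<Longrightarrow> curl_div_form \<Omega> u v + L2_inner \<Omega> u v = H1_vec_inner \<Omega> u v"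
  by (simp add: curl_div_form_eq_jacobian H1_vec_inner_def)

lemma H10_vec_L2: "u \<in> H10_vec \<Omega> \<Longrightarrow> (\<lambda>x. u x $ i) \<in> L2 \<Omega>"
  by (rule H1_L2[OF H10_vec_H1])

lemma L2_inner_vec_comb:
  assumes u: "u \<in> H10_vec \<Omega>" and v: "v \<in> H10_vec \<Omega>" and w: "w \<in> H10_vec \<Omega>"
  shows "L2_inner \<Omega> (\<lambda>x. a *\<^sub>R u x + b *\<^sub>R v x) w = a * L2_inner \<Omega> u w + b * L2_inner \<Omega> v w"
proof -
  have "L2_inner \<Omega> (\<lambda>x. a * u x $ i + b * v x $ i) (\<lambda>x. w x $ i)
      = a * L2_inner \<Omega> (\<lambda>x. u x $ i) (\<lambda>x. w x $ i) + b * L2_inner \<Omega> (\<lambda>x. v x $ i) (\<lambda>x. w x $ i)" for i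
    using L2.B_comb[OF H10_vec_L2[OF u] H10_vec_L2[OF v] H10_vec_L2[OF w], of a i b i i] by simp
  then show ?thesis
    using L2_inner_componentwise[OF H10_vec_L2[OF H10_vec.comb[OF u v, of a b]] H10_vec_L2[OF w]]
      L2_inner_componentwise[OF H10_vec_L2[OF u] H10_vec_L2[OF w]]
      L2_inner_componentwise[OF H10_vec_L2[OF v] H10_vec_L2[OF w]]
    by (simp add: sum.distrib sum_distrib_left)
qed

text \<open>The form is the difference of the H1 and the L2 product on
  \<open>H10_vec \<Omega>\<close>, so linearity is inherited without another computation with curl
  and divergence.\<close>

lemma curl_div_form_comb:
  assumes u: "u \<in> H10_vec \<Omega>" and v: "v \<in> H10_vec \<Omega>" and w: "w \<in> H10_vec \<Omega>"
  shows "curl_div_form \<Omega> (\<lambda>x. a *\<^sub>R u x + b *\<^sub>R v x) w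
    = a * curl_div_form \<Omega> u w + b * curl_div_form \<Omega> v w"
proof -
  have eq: "curl_div_form \<Omega> z w = H1_vec_inner \<Omega> z w - L2_inner \<Omega> z w" if "z \<in> H10_vec \<Omega>" for z
    using curl_div_form_eq_H1[OF that w] by simp
  show ?thesis
    unfolding eq[OF u] eq[OF v] eq[OF H10_vec.comb[OF u v]] H10_vec.B_comb[OF u v w]
      L2_inner_vec_comb[OF u v w] by (simp add: algebra_simps)
qed

lemma curl_div_form_bilinear: "bilinear_on_fields (H10_vec \<Omega>) (curl_div_form \<Omega>)"
proof -
  have "curl_div_form \<Omega> u v = curl_div_form \<Omega> v u" for u v
    by (simp add: curl_div_form_def L2_inner_def inner_commute mult.commute)
  then have "curl_div_form \<Omega> w (\<lambda>x. a *\<^sub>R u x + b *\<^sub>R v x)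
      = a * curl_div_form \<Omega> w u + b * curl_div_form \<Omega> w v"
    if "u \<in> H10_vec \<Omega>" "v \<in> H10_vec \<Omega>" "w \<in> H10_vec \<Omega>" for u v w a b
    using curl_div_form_comb[OF that] by (simp only:)
  then show ?thesis
    unfolding bilinear_on_fields_def linear_on_fields_def
    by (intro conjI ballI allI curl_div_form_comb)
qed

lemma H1_vec_norm_square: "(H1_vec_norm \<Omega> u)\<^sup>2 = H1_vec_inner \<Omega> u u"
  by (simp add: H1_vec_norm_def H1_vec_inner_def L2_inner_def)

lemma L2_norm_square: "(L2_norm \<Omega> u)\<^sup>2 = L2_inner \<Omega> u u"
  by (simp add: L2_norm_def L2_inner_def)

text \<open>The zero function is a density of the vanishing distributional divergence, so
  \<open>weak_div \<Omega> u\<close> is zero almost everywhere and the divergence part of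
  \<open>curl_div_form_eq_jacobian\<close> drops out.\<close>

lemma div_free_curl_curl_form:
  assumes u: "u \<in> H10_vec \<Omega>" "div_free \<Omega> u" and v: "v \<in> H10_vec \<Omega>"
  shows "L2_inner \<Omega> (weak_curl \<Omega> u) (weak_curl \<Omega> v) = L2_inner \<Omega> (weak_jacobian \<Omega> u) (weak_jacobian \<Omega> v)"
proof -
  have "has_L2_density \<Omega> (dist_div (regular_vec \<Omega> u)) (\<lambda>x. 0)"
    using u(2) by (simp add: has_L2_density_def div_free_def regular_def L2_def)
  then have AE: "AE x in lebesgue_on \<Omega>. weak_div \<Omega> u x = 0"
    unfolding weak_div_def by (intro has_L2_density_unique[OF open_domain has_L2_density_L2_density])
  have "L2_inner \<Omega> (weak_div \<Omega> u) (weak_div \<Omega> v) = L2_inner \<Omega> (\<lambda>x. 0) (weak_div \<Omega> v)"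
    by (rule L2_inner_cong_AE[OF _ _ _ _ AE])
      (use weak_div_eq(1)[OF H10_vec_H1[OF u(1)]] weak_div_eq(1)[OF H10_vec_H1[OF v]] in
        \<open>auto simp: L2_def\<close>)
  then have "L2_inner \<Omega> (weak_div \<Omega> u) (weak_div \<Omega> v) = 0" by (simp add: L2_inner_def)
  with curl_div_form_eq_jacobian[OF u(1) v] show ?thesis by (simp add: curl_div_form_def)
qed

text \<open>The constraint sits on \<open>u\<close> alone, so the identity may be tested with all of
  \<open>H10_vec \<Omega>\<close> as well as with divergence-free fields.\<close>

lemma curl_curl_form_eq_H1:
  "\<lbrakk>u \<in> H10_div_free \<Omega>; v \<in> H10_vec \<Omega>\<rbrakk> \<Longrightarrow> curl_curl_form \<Omega> u v = H1_vec_inner \<Omega> u v"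
  by (simp add: H10_div_free_def curl_curl_form_def H1_vec_inner_def div_free_curl_curl_form)

lemma laplace_form_eq_H1: "laplace_form \<Omega> = H1_vec_inner \<Omega>"
  by (intro ext) (simp add: laplace_form_def H1_vec_inner_def)

text \<open>Turns a vanishing seminorm into equality almost everywhere, the sense in which solutions
  are unique.\<close>

lemma H10_vec_AE_zero:
  assumes d: "d \<in> H10_vec \<Omega>" and zero: "H1_vec_inner \<Omega> d d = 0"
  shows "AE x in lebesgue_on \<Omega>. d x = 0"
proof -
  have "L2_inner \<Omega> d d = 0"
    using zero unfolding H1_vec_inner_def
    by (smt (verit) L2_inner_self_nonneg)
  moreover have "integrable (lebesgue_on \<Omega>) (\<lambda>x. d x \<bullet> d x)"
    using L2_integrable_mult[OF H10_vec_L2[OF d] H10_vec_L2[OF d]] by (simp add: inner_vec_def)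
  ultimately have "AE x in lebesgue_on \<Omega>. d x \<bullet> d x = 0"
    by (subst (asm) L2_inner_def) (simp add: integral_nonneg_eq_0_iff_AE)
  then show ?thesis by simp
qed

text \<open>Existence is Riesz representation on \<open>Y\<close>; a form that coincides with the H1
  product there gives the stability constant 1.\<close>

lemma well_posed_H1_inner:
  assumes "semi_inner_space Y (H1_vec_inner \<Omega>)"
    and complete: "semi_inner_space.B_complete Y (H1_vec_inner \<Omega>)" and sub: "Y \<subseteq> H10_vec \<Omega>"
    and F: "\<And>u v. \<lbrakk>u \<in> Y; v \<in> Y\<rbrakk> \<Longrightarrow> F u v = H1_vec_inner \<Omega> u v"
  shows "well_posed \<Omega> Y F"
proof -
  interpret Y: semi_inner_space Y "H1_vec_inner \<Omega>" by fact
  have "\<exists>u\<in>Y. weak_solution F Y f u \<and> H1_vec_norm \<Omega> u \<le> 1 * M \<and>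
      (\<forall>w\<in>Y. weak_solution F Y f w \<longrightarrow> (AE x in lebesgue_on \<Omega>. w x = u x))"
    if f: "bounded_functional \<Omega> Y M f" for M f
  proof -
    have M: "0 \<le> M" and bound: "\<And>v. v \<in> Y \<Longrightarrow> \<bar>f v\<bar> \<le> M * sqrt (H1_vec_inner \<Omega> v v)"
      and lin: "\<And>u v a b. \<lbrakk>u \<in> Y; v \<in> Y\<rbrakk> \<Longrightarrow> f (\<lambda>x. a *\<^sub>R u x + b *\<^sub>R v x) = a * f u + b * f v"
      using f unfolding bounded_functional_def linear_on_fields_def H1_vec_norm_def by blast+
    obtain u where u: "u \<in> Y" and eq: "\<And>v. v \<in> Y \<Longrightarrow> H1_vec_inner \<Omega> u v = f v"
      using Y.Riesz_representation[OF complete lin bound] by blast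
    define n where "n = H1_vec_norm \<Omega> u"
    have n: "0 \<le> n" "n\<^sup>2 = H1_vec_inner \<Omega> u u"
      using Y.B_nonneg[OF u] by (simp_all add: n_def H1_vec_norm_square H1_vec_norm_def)
    \<comment> \<open>The solution is tested with itself; cancelling \<open>n\<close> afterwards
      leaves the case \<open>n = 0\<close> to the assumption that \<open>M\<close> is
      nonnegative.\<close>
    have "n * n \<le> M * n"
      using bound[OF u] eq[OF u] n by (simp add: n_def H1_vec_norm_def power2_eq_square)
    then have norm: "n \<le> M" using n(1) M by (cases "n = 0") auto
    have "AE x in lebesgue_on \<Omega>. w x = u x" if w: "w \<in> Y" "weak_solution F Y f w" for w
    proof -
      have wv: "H1_vec_inner \<Omega> w v = f v" if "v \<in> Y" for v
        using w that F by (simp add: weak_solution_def)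
      \<comment> \<open>Trial and test space coincide, so the difference of two solutions is itself
        an admissible test field.\<close>
      have d: "(\<lambda>x. w x - u x) \<in> Y" using w u by (intro Y.diff_closed)
      have "H1_vec_inner \<Omega> (\<lambda>x. w x - u x) (\<lambda>x. w x - u x) = 0"
        using Y.B_diff[OF w(1) u d] wv[OF d] eq[OF d] by simp
      then have "AE x in lebesgue_on \<Omega>. w x - u x = 0"
        using d sub by (intro H10_vec_AE_zero) auto
      then show ?thesis by simp
    qed
    with u eq F norm show ?thesis
      by (intro bexI[of _ u]) (auto simp: weak_solution_def n_def)
  qed
  then show ?thesis unfolding well_posed_def by blast
qed

section \<open>The divergence-free subspace\<close>

lemma dist_div_regular_vec:
  "dist_div (regular_vec \<Omega> u) \<phi> = - (\<Sum>i\<in>UNIV. L2_inner \<Omega> (\<lambda>x. u x $ i) (partial i \<phi>))"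
  by (simp add: dist_div_def regular_vec_def dist_partial_def regular_eq_L2_inner sum_negf)

lemma H10_div_free_comb:
  assumes "u \<in> H10_div_free \<Omega>" "v \<in> H10_div_free \<Omega>"
  shows "(\<lambda>x. a *\<^sub>R u x + b *\<^sub>R v x) \<in> H10_div_free \<Omega>"
proof -
  have u: "u \<in> H10_vec \<Omega>" "div_free \<Omega> u" and v: "v \<in> H10_vec \<Omega>" "div_free \<Omega> v"
    using assms by (auto simp: H10_div_free_def)
  have "dist_div (regular_vec \<Omega> (\<lambda>x. a *\<^sub>R u x + b *\<^sub>R v x)) \<phi> = 0" if \<phi>: "\<phi> \<in> test_functions \<Omega>" for \<phi>
  proof -
    have "L2_inner \<Omega> (\<lambda>x. a * u x $ i + b * v x $ i) (partial i \<phi>)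
        = a * L2_inner \<Omega> (\<lambda>x. u x $ i) (partial i \<phi>) + b * L2_inner \<Omega> (\<lambda>x. v x $ i) (partial i \<phi>)" for i
      using L2.B_comb[OF H10_vec_L2[OF u(1)] H10_vec_L2[OF v(1)] test_L2[OF test_functions_partial[OF \<phi>]],
          of a i b i i] by simp
    then have "dist_div (regular_vec \<Omega> (\<lambda>x. a *\<^sub>R u x + b *\<^sub>R v x)) \<phi>
        = a * dist_div (regular_vec \<Omega> u) \<phi> + b * dist_div (regular_vec \<Omega> v) \<phi>"
      by (simp add: dist_div_regular_vec sum.distrib sum_distrib_left)
    with u(2) v(2) \<phi> show ?thesis by (simp add: div_free_def)
  qed
  then show ?thesis
    using H10_vec.comb[OF u(1) v(1)] by (simp add: H10_div_free_def div_free_def)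
qed

sublocale H10_div_free: semi_inner_space "H10_div_free \<Omega>" "H1_vec_inner \<Omega>"
proof (rule H10_vec.subspace_semi_inner_space)
  show "H10_div_free \<Omega> \<subseteq> H10_vec \<Omega>" by (auto simp: H10_div_free_def)
  have "(\<lambda>x. 0) \<in> H10_div_free \<Omega>"
    by (simp add: H10_div_free_def H10_vec_def zero_H10 div_free_def dist_div_regular_vec L2_inner_def)
  then show "H10_div_free \<Omega> \<noteq> {}" by blast
qed (rule H10_div_free_comb)

text \<open>For a fixed test function the distributional divergence is a finite sum of L2 pairings,
  hence continuous under H1 convergence, so the constraint is preserved in the limit.\<close>

lemma H10_div_free_complete: "H10_div_free.B_complete"
proof (rule H10_vec.complete_subset)
  show "semi_inner_space (H10_div_free \<Omega>) (H1_vec_inner \<Omega>)" ..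
  show "H10_div_free \<Omega> \<subseteq> H10_vec \<Omega>" by (auto simp: H10_div_free_def)
  fix s u assume s: "\<And>n. s n \<in> H10_div_free \<Omega>" and u: "u \<in> H10_vec \<Omega>"
    and lim: "(\<lambda>n. H1_vec_inner \<Omega> (\<lambda>x. s n x - u x) (\<lambda>x. s n x - u x)) \<longlonglongrightarrow> 0"
  have sv: "s n \<in> H10_vec \<Omega>" for n using s by (simp add: H10_div_free_def)
  have comp_lim: "(\<lambda>n. L2_inner \<Omega> (\<lambda>x. s n x $ i - u x $ i) (\<lambda>x. s n x $ i - u x $ i)) \<longlonglongrightarrow> 0" for i
  proof (rule Lim_null_comparison[OF _ lim], rule always_eventually, rule allI)
    fix n
    have "L2_inner \<Omega> (\<lambda>x. s n x $ i - u x $ i) (\<lambda>x. s n x $ i - u x $ i)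
        \<le> H1_inner \<Omega> (\<lambda>x. s n x $ i - u x $ i) (\<lambda>x. s n x $ i - u x $ i)"
      by (simp add: H1_inner_def L2_inner_self_nonneg)
    also note H10_vec_diff_component_le[OF sv u]
    finally show "norm (L2_inner \<Omega> (\<lambda>x. s n x $ i - u x $ i) (\<lambda>x. s n x $ i - u x $ i))
        \<le> H1_vec_inner \<Omega> (\<lambda>x. s n x - u x) (\<lambda>x. s n x - u x)"
      using L2_inner_self_nonneg[of "\<lambda>x. s n x $ i - u x $ i"] by simp
  qed
  have "dist_div (regular_vec \<Omega> u) \<phi> = 0" if \<phi>: "\<phi> \<in> test_functions \<Omega>" for \<phi>
  proof -
    have "(\<lambda>n. dist_div (regular_vec \<Omega> (s n)) \<phi>) \<longlonglongrightarrow> dist_div (regular_vec \<Omega> u) \<phi>"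
      unfolding dist_div_regular_vec
      by (intro tendsto_minus tendsto_sum L2.tendsto_B[OF H10_vec_L2[OF sv] H10_vec_L2[OF u]
            test_L2[OF test_functions_partial[OF \<phi>]] comp_lim])
    moreover have "dist_div (regular_vec \<Omega> (s n)) \<phi> = 0" for n
      using s[of n] \<phi> by (simp add: H10_div_free_def div_free_def)
    ultimately show ?thesis by (simp add: LIMSEQ_const_iff)
  qed
  with u show "u \<in> H10_div_free \<Omega>" by (simp add: H10_div_free_def div_free_def)
qed (rule H10_vec_complete)

end

theorem theorem4p4:
  fixes \<Omega> :: "(real^3) set"
  assumes "H1_extension_domain \<Omega>"
  shows
    "bilinear_on_fields (H10_vec \<Omega>) (curl_div_form \<Omega>) \<and>
     (\<forall>u\<in>H10_vec \<Omega>. curl_div_form \<Omega> u u + (L2_norm \<Omega> u)\<^sup>2 = (H1_vec_norm \<Omega> u)\<^sup>2) \<and>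
     H1_coercive_on \<Omega> (H10_vec \<Omega>) (\<lambda>u v. curl_div_form \<Omega> u v + L2_inner \<Omega> u v) \<and>
     (\<forall>u\<in>H10_vec \<Omega>. div_free \<Omega> u \<longrightarrow>
        (\<forall>v\<in>H10_vec \<Omega>.
           L2_inner \<Omega> (weak_curl \<Omega> u) (weak_curl \<Omega> v) + L2_inner \<Omega> u v
           = L2_inner \<Omega> (weak_jacobian \<Omega> u) (weak_jacobian \<Omega> v) + L2_inner \<Omega> u v)) \<and>
     (\<forall>M f. bounded_functional \<Omega> (H10_vec \<Omega>) M f \<longrightarrow>
        (\<forall>u\<in>H10_div_free \<Omega>.
           weak_solution (curl_curl_form \<Omega>) (H10_vec \<Omega>) f u
           \<longleftrightarrow> weak_solution (laplace_form \<Omega>) (H10_vec \<Omega>) f u)) \<and>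
     well_posed \<Omega> (H10_div_free \<Omega>) (curl_curl_form \<Omega>) \<and>
     well_posed \<Omega> (H10_div_free \<Omega>) (laplace_form \<Omega>) \<and>
     well_posed \<Omega> (H10_vec \<Omega>) (laplace_form \<Omega>)"
proof -
  interpret open_domain \<Omega>
    using assms by unfold_locales (simp add: H1_extension_domain_def bounded_domain_def)
  have sub: "H10_div_free \<Omega> \<subseteq> H10_vec \<Omega>" by (auto simp: H10_div_free_def)
  show ?thesis
  proof (intro conjI ballI impI allI)
    show "bilinear_on_fields (H10_vec \<Omega>) (curl_div_form \<Omega>)"
      by (rule curl_div_form_bilinear)
    show "curl_div_form \<Omega> u u + (L2_norm \<Omega> u)\<^sup>2 = (H1_vec_norm \<Omega> u)\<^sup>2" if "u \<in> H10_vec \<Omega>" for u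
      using curl_div_form_eq_H1[OF that that] by (simp add: L2_norm_square H1_vec_norm_square)
    \<comment> \<open>The constant is 1 because coercivity holds with equality.\<close>
    show "H1_coercive_on \<Omega> (H10_vec \<Omega>) (\<lambda>u v. curl_div_form \<Omega> u v + L2_inner \<Omega> u v)"
      unfolding H1_coercive_on_def
      by (intro exI[of _ 1]) (simp add: curl_div_form_eq_H1 H1_vec_norm_square)
    show "L2_inner \<Omega> (weak_curl \<Omega> u) (weak_curl \<Omega> v) + L2_inner \<Omega> u v
        = L2_inner \<Omega> (weak_jacobian \<Omega> u) (weak_jacobian \<Omega> v) + L2_inner \<Omega> u v"
      if "u \<in> H10_vec \<Omega>" "div_free \<Omega> u" "v \<in> H10_vec \<Omega>" for u v
      using div_free_curl_curl_form[OF that] by simp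
    show "weak_solution (curl_curl_form \<Omega>) (H10_vec \<Omega>) f u
        \<longleftrightarrow> weak_solution (laplace_form \<Omega>) (H10_vec \<Omega>) f u" if "u \<in> H10_div_free \<Omega>" for f u
      using that by (simp add: weak_solution_def curl_curl_form_eq_H1 laplace_form_eq_H1)
    show "well_posed \<Omega> (H10_div_free \<Omega>) (curl_curl_form \<Omega>)"
      using sub by (intro well_posed_H1_inner[OF H10_div_free.semi_inner_space_axioms
          H10_div_free_complete] curl_curl_form_eq_H1) auto
    show "well_posed \<Omega> (H10_div_free \<Omega>) (laplace_form \<Omega>)"
      by (rule well_posed_H1_inner[OF H10_div_free.semi_inner_space_axioms H10_div_free_complete sub])
        (simp add: laplace_form_eq_H1)
    show "well_posed \<Omega> (H10_vec \<Omega>) (laplace_form \<Omega>)"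
      by (rule well_posed_H1_inner[OF H10_vec.semi_inner_space_axioms H10_vec_complete order_refl])
        (simp add: laplace_form_eq_H1)
  qed
qed

end
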